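(* Let $W=(W(t))_{t\ge 0}$ be a standard Brownian motion in $\mathbb{H}\cong\mathbb{R}^4$ started from a fixed point $W(0)\neq 0$, and let $\zeta(t)=\int_{W[0,t]}\eta\in\mathfrak{su}(2)\cong\mathbb{R}^3$ be its quaternionic winding process. Then, as $t\to+\infty$, one has the convergence in distribution $$\sqrt{\frac{2}{\log t}}\;\zeta(t)\longrightarrow \mathcal{N}(0,\mathbf{I}_3),$$ where $\mathbf{I}_3$ is the $3\times 3$ identity matrix.
   Context: $\mathbb{H}=\{q=t+xI+yJ+zK:(t,x,y,z)\in\mathbb{R}^4\}$ is the field of quaternions ($I^2=J^2=K^2=-1$, $IJ=K$), with conjugate $\overline q=t-xI-yJ-zK$ and norm $|q|^2=t^2+x^2+y^2+z^2$. Unit quaternions are identified with $\mathbf{SU}(2)$, and $\mathfrak{su}(2)$ is identified with the imaginary quaternions, hence with $\mathbb{R}^3$ via the basis $I,J,K$. The quaternionic winding form on $\mathbb{H}\setminus\{0\}$ is the $\mathfrak{su}(2)$-valued one-form $\eta=\frac{1}{|q|^2}\mathrm{Im}(\overline q\,dq)=\frac12\frac{\overline q\,dq-\overline{dq}\,q}{|q|^2}=\eta_1I+\eta_2J+\eta_3K$, i.e. $$\eta_1=\frac{t\,dx-x\,dt+z\,dy-y\,dz}{|q|^2},\quad \eta_2=\frac{t\,dy-y\,dt+x\,dz-z\,dx}{|q|^2},\quad \eta_3=\frac{t\,dz-z\,dt+y\,dx-x\,dy}{|q|^2}.$$ A standard (quaternionic) Brownian motion is $W=W_0+W_1I+W_2J+W_3K$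 with $(W_0,W_1,W_2,W_3)$ a standard four-dimensional Brownian motion (generator one half of the Euclidean Laplacian). The winding process is defined by the Stratonovich stochastic line integral $\zeta(t)=\int_{W[0,t]}\eta$ (almost surely $W$ never hits $0$). *)

theory Defs
  imports "HOL-Probability.Probability"
begin

text \<open>
  The quaternion t + x I + y J + z K is the vector with coordinates t, x, y, z at the
  indices 1, 2, 3, 4 (in the index type \<^typ>\<open>4\<close> the numeral 4 equals 0). Imaginary quaternions,
  that is su(2), are identified with \<^typ>\<open>real^3\<close> through the basis I, J, K.
\<close>

type_synonym quat = "real^4"

definition Quat :: "real \<Rightarrow> real \<Rightarrow> real \<Rightarrow> real \<Rightarrow> quat" where
  "Quat t x y z = vector [t, x, y, z]"

lemma Quat_nth [simp]:
  "Quat t x y z $ 1 = t" "Quat t x y z $ 2 = x" "Quat t x y z $ 3 = y" "Quat t x y z $ 4 = z"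
  unfolding Quat_def vector_def by simp_all

definition qmult :: "quat \<Rightarrow> quat \<Rightarrow> quat" where
  "qmult p q = Quat
     (p $ 1 * q $ 1 - p $ 2 * q $ 2 - p $ 3 * q $ 3 - p $ 4 * q $ 4)
     (p $ 1 * q $ 2 + p $ 2 * q $ 1 + p $ 3 * q $ 4 - p $ 4 * q $ 3)
     (p $ 1 * q $ 3 - p $ 2 * q $ 4 + p $ 3 * q $ 1 + p $ 4 * q $ 2)
     (p $ 1 * q $ 4 + p $ 2 * q $ 3 - p $ 3 * q $ 2 + p $ 4 * q $ 1)"

lemma qmult_units:
  "qmult (Quat 0 1 0 0) (Quat 0 1 0 0) = Quat (-1) 0 0 0"
  "qmult (Quat 0 0 1 0) (Quat 0 0 1 0) = Quat (-1) 0 0 0"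
  "qmult (Quat 0 0 0 1) (Quat 0 0 0 1) = Quat (-1) 0 0 0"
  "qmult (Quat 0 1 0 0) (Quat 0 0 1 0) = Quat 0 0 0 1"
  by (simp_all only: qmult_def Quat_nth, simp_all)

definition qcnj :: "quat \<Rightarrow> quat" where
  "qcnj q = Quat (q $ 1) (- (q $ 2)) (- (q $ 3)) (- (q $ 4))"

definition qIm :: "quat \<Rightarrow> real^3" where
  "qIm q = vector [q $ 2, q $ 3, q $ 4]"

text \<open>
  A vector-valued one-form is a function of a base point and a tangent vector. The winding form
  takes the junk value 0 at the base point 0, where it is undefined.
\<close>

definition winding_form :: "quat \<Rightarrow> quat \<Rightarrow> real^3" where
  "winding_form q v = (1 / (norm q)\<^sup>2) *\<^sub>R qIm (qmult (qcnj q) v)"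

lemma winding_form_Quat:
  "winding_form (Quat t x y z) (Quat dt dx dy dz) = vector
     [(t * dx - x * dt + z * dy - y * dz) / (t\<^sup>2 + x\<^sup>2 + y\<^sup>2 + z\<^sup>2),
      (t * dy - y * dt + x * dz - z * dx) / (t\<^sup>2 + x\<^sup>2 + y\<^sup>2 + z\<^sup>2),
      (t * dz - z * dt + y * dx - x * dy) / (t\<^sup>2 + x\<^sup>2 + y\<^sup>2 + z\<^sup>2)]"
proof -
  have "(norm (Quat t x y z))\<^sup>2 = t\<^sup>2 + x\<^sup>2 + y\<^sup>2 + z\<^sup>2"
    by (simp only: norm_vec_def L2_set_def sum_4 Quat_nth) simp
  then show ?thesis
    by (simp only: winding_form_def qIm_def qmult_def qcnj_def Quat_nth)
      (simp add: vec_eq_iff forall_3 algebra_simps)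
qed

text \<open>The density of the centred normal distribution with covariance matrix \<sigma>^2 times the identity.\<close>

definition isotropic_normal_density :: "real \<Rightarrow> real^'n::finite \<Rightarrow> real" where
  "isotropic_normal_density \<sigma> x = (\<Prod>i\<in>UNIV. normal_density 0 \<sigma> (x $ i))"

definition std_normal_measure :: "(real^'n::finite) measure" where
  "std_normal_measure = density lborel (\<lambda>x. ennreal (isotropic_normal_density 1 x))"

text \<open>
  Standard Brownian motion started at \<open>w\<close>. Only the values at times \<open>t \<ge> 0\<close> are meaningful.
\<close>

definition standard_brownian_motion ::
    "'a measure \<Rightarrow> (real \<Rightarrow> 'a \<Rightarrow> real^'n::finite) \<Rightarrow> real^'n \<Rightarrow> bool" where
  "standard_brownian_motion M W w \<longleftrightarrow>
     prob_space M \<and>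
     (\<forall>t\<ge>0. W t \<in> borel_measurable M) \<and>
     (AE \<omega> in M. W 0 \<omega> = w) \<and>
     (AE \<omega> in M. continuous_on {0..} (\<lambda>t. W t \<omega>)) \<and>
     (\<forall>s t. 0 \<le> s \<longrightarrow> s < t \<longrightarrow>
        distributed M lborel (\<lambda>\<omega>. W t \<omega> - W s \<omega>)
          (\<lambda>x. ennreal (isotropic_normal_density (sqrt (t - s)) x))) \<and>
     (\<forall>n (\<tau> :: nat \<Rightarrow> real). 0 \<le> \<tau> 0 \<longrightarrow> (\<forall>k<n. \<tau> k \<le> \<tau> (Suc k)) \<longrightarrow>
        prob_space.indep_vars M (\<lambda>_. borel) (\<lambda>k \<omega>. W (\<tau> (Suc k)) \<omega> - W (\<tau> k) \<omega>) {..<n})"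

definition interval_partition :: "real \<Rightarrow> nat \<Rightarrow> (nat \<Rightarrow> real) \<Rightarrow> bool" where
  "interval_partition t n \<tau> \<longleftrightarrow> \<tau> 0 = 0 \<and> \<tau> n = t \<and> (\<forall>k<n. \<tau> k \<le> \<tau> (Suc k))"

definition stratonovich_sum ::
    "('b::ab_group_add \<Rightarrow> 'b \<Rightarrow> 'c::real_vector) \<Rightarrow> (real \<Rightarrow> 'a \<Rightarrow> 'b) \<Rightarrow> nat \<Rightarrow> (nat \<Rightarrow> real)
      \<Rightarrow> 'a \<Rightarrow> 'c" where
  "stratonovich_sum \<theta> X n \<tau> \<omega> =
     (\<Sum>k<n. (1/2) *\<^sub>R (\<theta> (X (\<tau> k) \<omega>) (X (\<tau> (Suc k)) \<omega> - X (\<tau> k) \<omega>)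
                     + \<theta> (X (\<tau> (Suc k)) \<omega>) (X (\<tau> (Suc k)) \<omega> - X (\<tau> k) \<omega>)))"

text \<open>
  \<open>Z t\<close> is (a version of) the Stratonovich line integral of the one-form \<open>\<theta>\<close> along the path
  \<open>X[0,t]\<close>: the limit in probability of the symmetric Riemann sums over deterministic partitions
  of \<open>[0,t]\<close>, as the mesh tends to 0.
\<close>

definition stratonovich_line_integral ::
    "'a measure \<Rightarrow> ('b::real_normed_vector \<Rightarrow> 'b \<Rightarrow> 'c::euclidean_space)
      \<Rightarrow> (real \<Rightarrow> 'a \<Rightarrow> 'b) \<Rightarrow> (real \<Rightarrow> 'a \<Rightarrow> 'c) \<Rightarrow> bool" where
  "stratonovich_line_integral M \<theta> X Z \<longleftrightarrow>
     (\<forall>t\<ge>0. Z t \<in> borel_measurable M \<and>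
        (\<forall>\<epsilon>>0. \<forall>p>0. \<exists>\<delta>>0. \<forall>n \<tau>.
           interval_partition t n \<tau> \<longrightarrow> (\<forall>k<n. \<tau> (Suc k) - \<tau> k < \<delta>) \<longrightarrow>
           measure M {\<omega> \<in> space M. dist (stratonovich_sum \<theta> X n \<tau> \<omega>) (Z t \<omega>) > \<epsilon>} < p))"

text \<open>
  Weak convergence of measures on a topological space along a filter; the library notion
  \<^const>\<open>weak_conv_m\<close> covers only sequences of measures on the real line.
\<close>

definition weakly_converges ::
    "('i \<Rightarrow> 'b::topological_space measure) \<Rightarrow> 'b measure \<Rightarrow> 'i filter \<Rightarrow> bool" where
  "weakly_converges N \<mu> F \<longleftrightarrow>
     (\<forall>f :: 'b \<Rightarrow> real. continuous_on UNIV f \<longrightarrow> bounded (range f) \<longrightarrow>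
        ((\<lambda>i. integral\<^sup>L (N i) f) \<longlongrightarrow> integral\<^sup>L \<mu> f) F)"

definition converges_in_distribution ::
    "'a measure \<Rightarrow> ('i \<Rightarrow> 'a \<Rightarrow> 'b::topological_space) \<Rightarrow> 'b measure \<Rightarrow> 'i filter \<Rightarrow> bool" where
  "converges_in_distribution M X \<mu> F \<longleftrightarrow> weakly_converges (\<lambda>i. distr M borel (X i)) \<mu> F"

end

theory Submission
  imports Defs "HOL-Library.Landau_Symbols"
begin

text \<open>
  The proof needs no stochastic calculus. If \<open>a (a + 2) = |\<xi>|\<^sup>2\<close>, then \<open>exp (i \<xi> \<bullet> \<zeta>(t)) |W(t)|\<^sup>a\<close> is a martingale:
  \<open>|x|\<^sup>a\<close> solves \<open>\<Delta>f = |\<xi>|\<^sup>2 |x|\<^sup>-\<^sup>2 f\<close>, and the increments of \<open>\<zeta>\<close> are orthogonal to the radial ones.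
  Hence \<open>E (exp (i \<xi> \<bullet> \<zeta>(T)) (|W(T)| / \<surd>T)\<^sup>a) = (|w| / \<surd>T)\<^sup>a\<close>. For \<open>\<xi> = \<surd>(2 / ln T) u\<close> the exponent
  \<open>a\<close> tends to 0 while \<open>a ln T\<close> tends to \<open>|u|\<^sup>2\<close>, so the right-hand side tends to \<open>exp (- |u|\<^sup>2 / 2)\<close>, and the
  radial factor on the left tends to 1 in mean because \<open>W(T) / \<surd>T\<close> is a shifted standard normal vector.

  The martingale identity is obtained along the Stratonovich sums over uniform partitions: a Taylor
  expansion with cubic remainder shows that one step of variance \<open>h\<close> from \<open>x\<close> violates it by at most
  \<open>C h\<^sup>3\<^sup>/\<^sup>2 |x|\<^sup>a\<^sup>-\<^sup>3\<close>, and \<open>E |W(t)|\<^sup>a\<^sup>-\<^sup>3\<close> is bounded in \<open>t\<close> since \<open>|x|\<^sup>-\<^sup>3\<close> is locally integrable in dimension 4.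
  The code writes \<open>a = 2 b\<close>.
\<close>

section \<open>Isotropic normal distributions\<close>

text \<open>The integral is given only as a limit in probability of sums over deterministic
  partitions. The identity is therefore proved for the sums, where increments are independent and
  Fubini replaces conditional expectation.

  The obstacle is the singularity at 0: a step can be long compared with the current radius and can
  jump past the origin, and no stopping time is available to prevent it. So the one-step bound is
  proved for steps of every length, and the blow-up of its constant near 0 is absorbed by the law of
  the current position, which is one shifted normal law. For fixed T, n steps of variance T/n then
  leave a total error of order \<open>1 / sqrt n\<close>.

  No joint limit law of winding and radius is required. The radial factor depends on the end point
  alone, hence is the same for every partition, and it is split off before the mesh tends to 0. Its
  mean distance from 1 is O(b), uniformly in T \<ge> 1, and this is the only error left after the
  mesh has been refined; it vanishes in the limit because the exponent itself does.\<close>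

definition isotropic_normal :: "real \<Rightarrow> (real^'n::finite) measure" where
  "isotropic_normal \<sigma> = density lborel (\<lambda>x. ennreal (isotropic_normal_density \<sigma> x))"

lemma std_normal_measure_eq: "std_normal_measure = isotropic_normal 1"
  by (simp add: std_normal_measure_def isotropic_normal_def)

lemma isotropic_normal_density_measurable [measurable]:
  "isotropic_normal_density \<sigma> \<in> borel_measurable (borel :: (real^'n::finite) measure)"
  unfolding isotropic_normal_density_def by measurable

lemma isotropic_normal_density_nonneg [simp]: "0 \<le> isotropic_normal_density \<sigma> x"
  by (simp add: isotropic_normal_density_def prod_nonneg)

lemma sets_isotropic_normal [simp, measurable_cong]: "sets (isotropic_normal \<sigma>) = sets borel"
  by (simp add: isotropic_normal_def)

lemma space_isotropic_normal [simp]: "space (isotropic_normal \<sigma>) = UNIV"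
  by (simp add: isotropic_normal_def)

lemma nn_integral_lborel_prod_vec:
  fixes f :: "'n::finite \<Rightarrow> real \<Rightarrow> ennreal"
  assumes [measurable]: "\<And>i. f i \<in> borel_measurable borel"
  shows "(\<integral>\<^sup>+x. (\<Prod>i\<in>UNIV. f i (x $ i)) \<partial>lborel) = (\<Prod>i\<in>UNIV. \<integral>\<^sup>+x. f i x \<partial>lborel)"
proof -
  \<comment> \<open>\<open>nn_integral_lborel_prod\<close> indexes its factors by basis vectors. The
    index is recovered from \<open>axis i 1\<close>, unambiguously because \<open>axis\<close> is
    injective.\<close>
  define g where "g b = f (SOME i. b = axis i (1::real))" for b
  have g: "g (axis i 1) = f i" for i
    by (simp add: g_def axis_eq_axis)
  have Basis: "(Basis :: (real^'n) set) = (\<lambda>i. axis i 1) ` UNIV"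
    by (auto simp: Basis_vec_def)
  have inj: "inj (\<lambda>i::'n. axis i (1::real))"
    by (auto simp: inj_on_def axis_eq_axis)
  have "(\<integral>\<^sup>+x. (\<Prod>b\<in>Basis. g b (x \<bullet> b)) \<partial>lborel) = (\<Prod>b\<in>(Basis :: (real^'n) set). \<integral>\<^sup>+x. g b x \<partial>lborel)"
    by (rule nn_integral_lborel_prod) (auto simp: g_def)
  then show ?thesis
    by (simp add: Basis prod.reindex[OF inj] g cart_eq_inner_axis[symmetric])
qed

text \<open>Opens the way from a density on \<open>real^'n\<close> to the product measure, where
  integrals of products factor. Both sides are probability measures determined by boxes, and on a
  box the density splits.\<close>

lemma isotropic_normal_coordinates:
  assumes "0 < \<sigma>"
  shows "distr (isotropic_normal \<sigma>) (\<Pi>\<^sub>M i\<in>UNIV. borel) (\<lambda>x i. x $ i) =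
    (\<Pi>\<^sub>M i\<in>(UNIV::'n::finite set). density lborel (normal_density 0 \<sigma>))"
proof -
  interpret prob_space "density lborel (normal_density 0 \<sigma>)"
    using assms by (rule prob_space_normal_density)
  interpret product_sigma_finite "\<lambda>_::'n. density lborel (normal_density 0 \<sigma>)" ..
  have [measurable]: "(\<lambda>(x::real^'n) i. x $ i) \<in> borel \<rightarrow>\<^sub>M (\<Pi>\<^sub>M i\<in>UNIV. borel)"
    by (rule measurable_PiM_single') (auto simp: PiE_def)
  show ?thesis
  proof (rule PiM_eqI)
    show "sets (distr (isotropic_normal \<sigma>) (\<Pi>\<^sub>M i\<in>UNIV. borel) (\<lambda>x i. x $ i)) =
        sets (\<Pi>\<^sub>M i\<in>(UNIV::'n set). density lborel (normal_density 0 \<sigma>))"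
      by (simp cong: sets_PiM_cong)
  next
    fix A :: "'n \<Rightarrow> real set" assume A: "\<And>i. i \<in> UNIV \<Longrightarrow> A i \<in> sets (density lborel (normal_density 0 \<sigma>))"
    then have [measurable]: "\<And>i. A i \<in> sets borel" by simp
    have "emeasure (distr (isotropic_normal \<sigma>) (\<Pi>\<^sub>M i\<in>UNIV. borel) (\<lambda>x i. x $ i)) (Pi\<^sub>E UNIV A) =
      emeasure (isotropic_normal \<sigma>) {x. \<forall>i. x $ i \<in> A i}"
      by (subst emeasure_distr) (auto intro!: arg_cong[where f="emeasure _"] sets_PiM_I_finite simp: PiE_iff)
    also have "\<dots> = (\<integral>\<^sup>+x. ennreal (isotropic_normal_density \<sigma> x) * indicator {x. \<forall>i. x $ i \<in> A i} x \<partial>lborel)"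
      unfolding isotropic_normal_def by (subst emeasure_density) auto
    also have "\<dots> = (\<integral>\<^sup>+x. (\<Prod>i\<in>UNIV. ennreal (normal_density 0 \<sigma> (x $ i)) * indicator (A i) (x $ i)) \<partial>lborel)"
    proof (intro nn_integral_cong)
      fix x :: "real^'n"
      have "indicator {x. \<forall>i. x $ i \<in> A i} x = (\<Prod>i\<in>UNIV. indicator (A i) (x $ i) :: ennreal)"
        by (auto simp: indicator_def)
      then show "ennreal (isotropic_normal_density \<sigma> x) * indicator {x. \<forall>i. x $ i \<in> A i} x =
        (\<Prod>i\<in>UNIV. ennreal (normal_density 0 \<sigma> (x $ i)) * indicator (A i) (x $ i))"
        by (simp add: isotropic_normal_density_def prod.distrib prod_ennreal)
    qed
    also have "\<dots> = (\<Prod>i\<in>UNIV. emeasure (density lborel (normal_density 0 \<sigma>)) (A i))"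
      by (subst nn_integral_lborel_prod_vec) (auto simp: emeasure_density)
    finally show "emeasure (distr (isotropic_normal \<sigma>) (\<Pi>\<^sub>M i\<in>UNIV. borel) (\<lambda>x i. x $ i)) (Pi\<^sub>E UNIV A) =
      (\<Prod>i\<in>UNIV. emeasure (density lborel (normal_density 0 \<sigma>)) (A i))" .
  qed simp
qed

lemma prob_space_isotropic_normal:
  assumes "0 < \<sigma>"
  shows "prob_space (isotropic_normal \<sigma> :: (real^'n::finite) measure)"
proof
  have "emeasure (isotropic_normal \<sigma> :: (real^'n) measure) UNIV =
     (\<integral>\<^sup>+x. (\<Prod>i\<in>UNIV. ennreal (normal_density 0 \<sigma> ((x::real^'n) $ i))) \<partial>lborel)"
    unfolding isotropic_normal_def
    by (subst emeasure_density) (auto simp: isotropic_normal_density_def prod_ennreal)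
  also have "\<dots> = 1"
    using prob_space.emeasure_space_1[OF prob_space_normal_density[OF assms, of 0]]
    by (subst nn_integral_lborel_prod_vec) (auto simp: emeasure_density)
  finally show "emeasure (isotropic_normal \<sigma> :: (real^'n) measure) (space (isotropic_normal \<sigma>)) = 1"
    by simp
qed

text \<open>Stated over a normed field so that the real case gives the moments and the complex case
  the characteristic function.\<close>

lemma
  fixes f :: "'n::finite \<Rightarrow> real \<Rightarrow> 'b::{real_normed_field, banach, second_countable_topology}"
  assumes \<sigma>: "0 < \<sigma>" and int: "\<And>i. integrable lborel (\<lambda>x. normal_density 0 \<sigma> x *\<^sub>R f i x)"
    and [measurable]: "\<And>i. f i \<in> borel_measurable borel"
  shows isotropic_normal_integrable_prod:
      "integrable (isotropic_normal \<sigma>) (\<lambda>x. \<Prod>i\<in>UNIV. f i (x $ i))"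
    and isotropic_normal_integral_prod:
      "(\<integral>x. (\<Prod>i\<in>UNIV. f i (x $ i)) \<partial>isotropic_normal \<sigma>) =
        (\<Prod>i\<in>UNIV. \<integral>x. normal_density 0 \<sigma> x *\<^sub>R f i x \<partial>lborel)"
proof -
  interpret prob_space "density lborel (normal_density 0 \<sigma>)"
    using \<sigma> by (rule prob_space_normal_density)
  interpret product_sigma_finite "\<lambda>_::'n. density lborel (normal_density 0 \<sigma>)" ..
  have [measurable]: "(\<lambda>(x::real^'n) i. x $ i) \<in> borel \<rightarrow>\<^sub>M (\<Pi>\<^sub>M i\<in>UNIV. borel)"
    by (rule measurable_PiM_single') (auto simp: PiE_def)
  have int': "integrable (density lborel (normal_density 0 \<sigma>)) (f i)" for i
    using int by (subst integrable_density) auto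
  have *: "(\<lambda>x. \<Prod>i\<in>UNIV. f i (x i)) \<in> borel_measurable (\<Pi>\<^sub>M i\<in>UNIV. borel)"
    by measurable
  have "integrable (\<Pi>\<^sub>M i\<in>(UNIV::'n set). density lborel (normal_density 0 \<sigma>)) (\<lambda>x. \<Prod>i\<in>UNIV. f i (x i))"
    using int' by (intro product_integrable_prod) auto
  then show "integrable (isotropic_normal \<sigma>) (\<lambda>x. \<Prod>i\<in>UNIV. f i (x $ i))"
    unfolding isotropic_normal_coordinates[OF \<sigma>, symmetric]
    using * by (subst (asm) integrable_distr_eq) auto
  have "(\<integral>x. (\<Prod>i\<in>UNIV. f i (x i)) \<partial>(\<Pi>\<^sub>M i\<in>(UNIV::'n set). density lborel (normal_density 0 \<sigma>))) =
      (\<Prod>i\<in>UNIV. \<integral>x. f i x \<partial>density lborel (normal_density 0 \<sigma>))"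
    using int' by (intro product_integral_prod) auto
  then show "(\<integral>x. (\<Prod>i\<in>UNIV. f i (x $ i)) \<partial>isotropic_normal \<sigma>) =
        (\<Prod>i\<in>UNIV. \<integral>x. normal_density 0 \<sigma> x *\<^sub>R f i x \<partial>lborel)"
    unfolding isotropic_normal_coordinates[OF \<sigma>, symmetric]
    using * by (subst (asm) integral_distr) (auto simp: integral_density)
qed

lemma
  fixes f :: "real \<Rightarrow> real"
  assumes \<sigma>: "0 < \<sigma>" and int: "integrable lborel (\<lambda>x. normal_density 0 \<sigma> x * f x)"
    and [measurable]: "f \<in> borel_measurable borel"
  shows isotropic_normal_integrable_nth: "integrable (isotropic_normal \<sigma>) (\<lambda>x::real^'n::finite. f (x $ i))"
    and isotropic_normal_integral_nth: "(\<integral>x. f (x $ i) \<partial>(isotropic_normal \<sigma> :: (real^'n) measure)) =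
        (\<integral>x. normal_density 0 \<sigma> x * f x \<partial>lborel)"
proof -
  define g where "g k x = (if k = i then f x else 1)" for k x
  have [measurable]: "\<And>k. g k \<in> borel_measurable borel" by (auto simp: g_def[abs_def])
  have *: "(\<Prod>k\<in>UNIV. g k (x $ k)) = f (x $ i)" for x
    by (simp add: g_def)
  have I: "integrable lborel (\<lambda>x. normal_density 0 \<sigma> x *\<^sub>R g k x)" for k
    using int \<sigma> by (cases "k = i") (simp_all add: g_def)
  have "(\<integral>x. normal_density 0 \<sigma> x *\<^sub>R g k x \<partial>lborel) =
     (if k = i then (\<integral>x. normal_density 0 \<sigma> x * f x \<partial>lborel) else 1)" for k
    using \<sigma> by (auto simp: g_def)
  with isotropic_normal_integrable_prod[of \<sigma> g, OF \<sigma> I] isotropic_normal_integral_prod[of \<sigma> g, OF \<sigma> I]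
  show "integrable (isotropic_normal \<sigma>) (\<lambda>x. f (x $ i))"
    and "(\<integral>x. f (x $ i) \<partial>(isotropic_normal \<sigma> :: (real^'n) measure)) = (\<integral>x. normal_density 0 \<sigma> x * f x \<partial>lborel)"
    by (simp_all add: *)
qed

section \<open>Moments of the isotropic normal law up to order three\<close>

lemma
  assumes \<sigma>: "0 < \<sigma>"
  shows isotropic_normal_integrable_inner: "integrable (isotropic_normal \<sigma>) (\<lambda>x::real^'n::finite. u \<bullet> x)"
    and isotropic_normal_mean: "(\<integral>x. u \<bullet> x \<partial>isotropic_normal \<sigma>) = 0"
proof -
  note I = isotropic_normal_integrable_nth[OF \<sigma>, of "\<lambda>x. x", simplified] integrable_normal_moment_nz_1[OF \<sigma>, of 0]
  note E = isotropic_normal_integral_nth[OF \<sigma>, of "\<lambda>x. x", simplified] integral_normal_moment_nz_1[OF \<sigma>, of 0]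
  show "integrable (isotropic_normal \<sigma>) (\<lambda>x::real^'n. u \<bullet> x)" "(\<integral>x. u \<bullet> x \<partial>isotropic_normal \<sigma>) = 0"
    by (auto simp: inner_vec_def I E)
qed

lemma
  assumes \<sigma>: "0 < \<sigma>"
  shows isotropic_normal_integrable_nth_mult:
      "integrable (isotropic_normal \<sigma>) (\<lambda>x::real^'n::finite. x $ i * x $ j)"
    and isotropic_normal_integral_nth_mult:
      "(\<integral>x. (x::real^'n) $ i * x $ j \<partial>isotropic_normal \<sigma>) = (if i = j then \<sigma>\<^sup>2 else 0)"
proof -
  have I2: "integrable lborel (\<lambda>x. normal_density 0 \<sigma> x * x\<^sup>2)"
    using integrable_normal_moment[OF \<sigma>, of 0 2] by simp
  have E2: "(\<integral>x. normal_density 0 \<sigma> x * x\<^sup>2 \<partial>lborel) = \<sigma>\<^sup>2"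
    using integral_normal_moment_even[OF \<sigma>, of 0 1] \<sigma> by (simp add: fact_numeral)
  \<comment> \<open>Two separate switches cover both cases at once: for \<open>i = j\<close> they
    coincide and give a square, otherwise each gives a linear factor of mean 0.\<close>
  define g where "g k x = (if k = i then x else 1) * (if k = j then x else (1::real))" for k x
  have [measurable]: "\<And>k. g k \<in> borel_measurable borel" by (auto simp: g_def[abs_def])
  have *: "(\<Prod>k\<in>UNIV. g k (x $ k)) = x $ i * x $ j" for x
    by (simp add: g_def prod.distrib)
  have I: "integrable lborel (\<lambda>x. normal_density 0 \<sigma> x *\<^sub>R g k x)" for k
    using \<sigma> I2 integrable_normal_moment_nz_1[OF \<sigma>, of 0]
    by (cases "k = i"; cases "k = j") (simp_all add: g_def power2_eq_square)
  show "integrable (isotropic_normal \<sigma>) (\<lambda>x::real^'n. x $ i * x $ j)"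
    using isotropic_normal_integrable_prod[of \<sigma> g, OF \<sigma> I] by (simp add: *)
  have "(\<integral>x. (x::real^'n) $ i * x $ j \<partial>isotropic_normal \<sigma>) = (\<Prod>k\<in>UNIV. \<integral>x. normal_density 0 \<sigma> x *\<^sub>R g k x \<partial>lborel)"
    using isotropic_normal_integral_prod[of \<sigma> g, OF \<sigma> I] by (simp add: *)
  also have "\<dots> = (if i = j then \<sigma>\<^sup>2 else 0)"
  proof (cases "i = j")
    case True
    have "(\<integral>x. normal_density 0 \<sigma> x *\<^sub>R g k x \<partial>lborel) = (if k = i then \<sigma>\<^sup>2 else 1)" for k
      using \<sigma> E2 True by (auto simp: g_def power2_eq_square)
    then show ?thesis using True by simp
  next
    case False
    then have "(\<integral>x. normal_density 0 \<sigma> x *\<^sub>R g i x \<partial>lborel) = 0"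
      using integral_normal_moment_nz_1[OF \<sigma>, of 0] by (simp add: g_def)
    then show ?thesis using False by (auto intro!: prod_zero)
  qed
  finally show "(\<integral>x. (x::real^'n) $ i * x $ j \<partial>isotropic_normal \<sigma>) = (if i = j then \<sigma>\<^sup>2 else 0)" .
qed

lemma
  assumes \<sigma>: "0 < \<sigma>"
  shows isotropic_normal_integrable_inner_mult:
      "integrable (isotropic_normal \<sigma>) (\<lambda>x::real^'n::finite. (u \<bullet> x) * (v \<bullet> x))"
    and isotropic_normal_covariance:
      "(\<integral>x. (u \<bullet> x) * (v \<bullet> x) \<partial>isotropic_normal \<sigma>) = \<sigma>\<^sup>2 * (u \<bullet> (v :: real^'n))"
proof -
  have *: "(u \<bullet> x) * (v \<bullet> x) = (\<Sum>i\<in>UNIV. \<Sum>j\<in>UNIV. (u $ i * v $ j) * (x $ i * x $ j))" for x :: "real^'n"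
    by (simp add: inner_vec_def sum_product algebra_simps)
  note [simp] = isotropic_normal_integrable_nth_mult[OF \<sigma>] isotropic_normal_integral_nth_mult[OF \<sigma>]
  show "integrable (isotropic_normal \<sigma>) (\<lambda>x::real^'n::finite. (u \<bullet> x) * (v \<bullet> x))"
    unfolding * by simp
  show "(\<integral>x. (u \<bullet> x) * (v \<bullet> x) \<partial>isotropic_normal \<sigma>) = \<sigma>\<^sup>2 * (u \<bullet> (v :: real^'n))"
  proof -
    have "(\<integral>x. (u \<bullet> x) * (v \<bullet> x) \<partial>isotropic_normal \<sigma>) =
      (\<Sum>i\<in>UNIV. \<Sum>j\<in>UNIV. (u $ i * v $ j) * (if i = j then \<sigma>\<^sup>2 else 0))"
      unfolding * by simp
    also have "\<dots> = \<sigma>\<^sup>2 * (u \<bullet> v)"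
      by (simp add: if_distrib inner_vec_def sum_distrib_left mult_ac cong: if_cong)
    finally show ?thesis .
  qed
qed

lemma
  assumes \<sigma>: "0 < \<sigma>"
  shows isotropic_normal_integrable_norm_square: "integrable (isotropic_normal \<sigma>) (\<lambda>x::real^'n::finite. (norm x)\<^sup>2)"
    and isotropic_normal_integral_norm_square:
      "(\<integral>x. (norm (x::real^'n))\<^sup>2 \<partial>isotropic_normal \<sigma>) = \<sigma>\<^sup>2 * CARD('n)"
proof -
  have *: "(norm x)\<^sup>2 = (\<Sum>i\<in>UNIV. x $ i * x $ i)" for x :: "real^'n"
    by (simp add: power2_norm_eq_inner inner_vec_def)
  note [simp] = isotropic_normal_integrable_nth_mult[OF \<sigma>] isotropic_normal_integral_nth_mult[OF \<sigma>]
  show "integrable (isotropic_normal \<sigma>) (\<lambda>x::real^'n::finite. (norm x)\<^sup>2)"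
    "(\<integral>x. (norm (x::real^'n))\<^sup>2 \<partial>isotropic_normal \<sigma>) = \<sigma>\<^sup>2 * CARD('n)"
    unfolding * by simp_all
qed

lemma norm_cube_le_sum_nth:
  fixes x :: "real^'n::finite"
  shows "norm x ^ 3 \<le> real CARD('n) ^ 3 * (\<Sum>i\<in>UNIV. \<bar>x $ i\<bar> ^ 3)"
proof -
  have "finite (range (\<lambda>i. \<bar>x $ i\<bar>))" "range (\<lambda>i. \<bar>x $ i\<bar>) \<noteq> {}" by auto
  from Max_in[OF this] obtain j where j: "Max (range (\<lambda>i. \<bar>x $ i\<bar>)) = \<bar>x $ j\<bar>" by (auto simp only: image_iff)
  have le: "\<bar>x $ i\<bar> \<le> \<bar>x $ j\<bar>" for i by (subst j[symmetric]) (rule Max_ge, auto)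
  have "norm x \<le> (\<Sum>i\<in>UNIV. \<bar>x $ i\<bar>)" by (rule norm_le_l1_cart)
  also have "\<dots> \<le> real CARD('n) * \<bar>x $ j\<bar>" using sum_bounded_above[of UNIV "\<lambda>i. \<bar>x $ i\<bar>", OF le] by simp
  finally have "norm x ^ 3 \<le> (real CARD('n) * \<bar>x $ j\<bar>) ^ 3" by (rule power_mono) simp
  also have "\<dots> \<le> real CARD('n) ^ 3 * (\<Sum>i\<in>UNIV. \<bar>x $ i\<bar> ^ 3)"
    unfolding power_mult_distrib by (intro mult_left_mono member_le_sum) auto
  finally show ?thesis .
qed

lemma isotropic_normal_third_moment:
  obtains C where "0 \<le> C"
    "\<And>\<sigma>. 0 < \<sigma> \<Longrightarrow> integrable (isotropic_normal \<sigma>) (\<lambda>x::real^'n::finite. norm x ^ 3)"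
    "\<And>\<sigma>. 0 < \<sigma> \<Longrightarrow> (\<integral>x. norm (x::real^'n) ^ 3 \<partial>isotropic_normal \<sigma>) \<le> C * \<sigma> ^ 3"
proof
  \<comment> \<open>The first power of the dimension compares the norm with the coordinates, the
    extra factor counts the coordinates, and \<open>2 * sqrt (2 / pi)\<close> is the absolute third
    moment of the standard normal law on the line.\<close>
  define C where "C = real CARD('n) ^ 3 * real CARD('n) * (2 * sqrt (2 / pi))"
  show "0 \<le> C" by (simp add: C_def)
  fix \<sigma> :: real assume \<sigma>: "0 < \<sigma>"
  have I: "integrable lborel (\<lambda>x. normal_density 0 \<sigma> x * \<bar>x\<bar> ^ 3)"
    using integrable_normal_moment_abs[OF \<sigma>, of 0 3] by simp
  have E: "(\<integral>x. normal_density 0 \<sigma> x * \<bar>x\<bar> ^ 3 \<partial>lborel) = 2 * \<sigma> ^ 3 * sqrt (2 / pi)"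
    using integral_normal_moment_abs_odd[OF \<sigma>, of 0 1] by (simp add: numeral_3_eq_3)
  note I' = isotropic_normal_integrable_nth[OF \<sigma> I, where 'n='n]
  have I3: "integrable (isotropic_normal \<sigma>) (\<lambda>x::real^'n. real CARD('n) ^ 3 * (\<Sum>i\<in>UNIV. \<bar>x $ i\<bar> ^ 3))"
    using I' by simp
  show int: "integrable (isotropic_normal \<sigma>) (\<lambda>x::real^'n. norm x ^ 3)"
    by (rule Bochner_Integration.integrable_bound[OF I3])
       (auto intro!: AE_I2 order_trans[OF _ abs_ge_self] norm_cube_le_sum_nth)
  have "(\<integral>x. norm (x::real^'n) ^ 3 \<partial>isotropic_normal \<sigma>) \<le>
    (\<integral>x. real CARD('n) ^ 3 * (\<Sum>i\<in>UNIV. \<bar>(x::real^'n) $ i\<bar> ^ 3) \<partial>isotropic_normal \<sigma>)"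
    by (intro integral_mono int I3 norm_cube_le_sum_nth)
  also have "\<dots> = C * \<sigma> ^ 3"
    using I' isotropic_normal_integral_nth[OF \<sigma> I, where 'n='n]
    by (simp add: E C_def)
  finally show "(\<integral>x. norm (x::real^'n) ^ 3 \<partial>isotropic_normal \<sigma>) \<le> C * \<sigma> ^ 3" .
qed

lemma char_std_normal_measure:
  "(\<integral>x. exp (\<i> * of_real (u \<bullet> x)) \<partial>(std_normal_measure :: (real^'n::finite) measure)) =
     complex_of_real (exp (- (norm u)\<^sup>2 / 2))"
proof -
  have I: "integrable lborel (\<lambda>x. std_normal_density x *\<^sub>R iexp (u $ i * x))" for i
    by (rule Bochner_Integration.integrable_bound[where f=std_normal_density]) auto
  have E: "(\<integral>x. std_normal_density x *\<^sub>R iexp (u $ i * x) \<partial>lborel) = exp (- (u $ i)\<^sup>2 / 2)" for i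
    using fun_cong[OF char_std_normal_distribution, of "u $ i"]
    by (simp add: char_def integral_density)
  have *: "exp (\<i> * of_real (u \<bullet> x)) = (\<Prod>i\<in>UNIV. iexp (u $ i * x $ i))" for x
    by (simp add: inner_vec_def exp_sum[symmetric] sum_distrib_left)
  have "(norm u)\<^sup>2 = (\<Sum>i\<in>UNIV. (u $ i)\<^sup>2)"
    by (simp add: power2_norm_eq_inner inner_vec_def) (simp add: power2_eq_square)
  then have **: "exp (- (norm u)\<^sup>2 / 2) = (\<Prod>i\<in>UNIV. exp (- (u $ i)\<^sup>2 / 2))"
    by (simp add: exp_sum[symmetric] sum_negf sum_divide_distrib)
  show ?thesis
    unfolding std_normal_measure_eq * ** of_real_prod E[symmetric]
    by (rule isotropic_normal_integral_prod[of 1 "\<lambda>i x. iexp (u $ i * x)", OF _ I]) simp_all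
qed

section \<open>Continuity theorem for characteristic functions of random vectors\<close>

definition char_vec :: "(real^'n::finite) measure \<Rightarrow> real^'n \<Rightarrow> complex" where
  "char_vec \<mu> u = (\<integral>x. exp (\<i> * of_real (u \<bullet> x)) \<partial>\<mu>)"

lemma char_vec_std_normal: "char_vec std_normal_measure u = exp (- (norm u)\<^sup>2 / 2)"
  unfolding char_vec_def by (rule char_std_normal_measure)

lemma prob_space_std_normal_measure: "prob_space std_normal_measure"
  by (simp add: std_normal_measure_eq prob_space_isotropic_normal)

lemma sets_std_normal_measure [simp, measurable_cong]: "sets std_normal_measure = sets borel"
  by (simp add: std_normal_measure_eq)

lemma norm_char_vec_le_1:
  assumes "prob_space \<mu>"
  shows "norm (char_vec \<mu> u) \<le> 1"
proof -
  interpret prob_space \<mu> by fact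
  have "norm (char_vec \<mu> u) \<le> (\<integral>x. norm (exp (\<i> * of_real (u \<bullet> x))) \<partial>\<mu>)"
    unfolding char_vec_def by (rule integral_norm_bound)
  then show ?thesis by (simp add: prob_space)
qed

section \<open>Gaussian smoothing and inversion\<close>

lemma isotropic_normal_density_eq_exp:
  fixes z :: "real^'n::finite"
  assumes "0 < s"
  shows "isotropic_normal_density s z = (1 / sqrt (2 * pi * s\<^sup>2)) ^ CARD('n) * exp (- (norm z)\<^sup>2 / (2 * s\<^sup>2))"
proof -
  have "(norm z)\<^sup>2 = (\<Sum>i\<in>UNIV. (z $ i)\<^sup>2)"
    by (simp add: power2_norm_eq_inner inner_vec_def) (simp add: power2_eq_square)
  then have "exp (- (norm z)\<^sup>2 / (2 * s\<^sup>2)) = (\<Prod>i\<in>UNIV. exp (- (z $ i)\<^sup>2 / (2 * s\<^sup>2)))"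
    by (simp add: exp_sum[symmetric] sum_negf sum_divide_distrib)
  then show ?thesis
    by (simp add: isotropic_normal_density_def normal_density_def prod_dividef power_divide)
qed

lemma isotropic_normal_density_le:
  fixes z :: "real^'n::finite"
  assumes "0 < s"
  shows "isotropic_normal_density s z \<le> (1 / sqrt (2 * pi * s\<^sup>2)) ^ CARD('n)"
  unfolding isotropic_normal_density_eq_exp[OF assms]
  by (rule mult_right_le_one_le) auto

text \<open>
  The normal density is itself a characteristic function up to scaling, so a measure smoothed by it is
  expressed through the characteristic function of the measure, by Fubini.
\<close>

lemma integral_isotropic_normal_density_conv:
  fixes \<mu> :: "(real^'n::finite) measure"
  assumes "prob_space \<mu>" and sets [measurable_cong]: "sets \<mu> = sets borel" and s: "0 < s"
  shows "complex_of_real (\<integral>x. isotropic_normal_density s (y - x) \<partial>\<mu>) =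
    of_real ((1 / sqrt (2 * pi * s\<^sup>2)) ^ CARD('n)) *
    (\<integral>u. char_vec \<mu> ((1 / s) *\<^sub>R u) * exp (- (\<i> * of_real (u \<bullet> y / s))) \<partial>std_normal_measure)"
proof -
  interpret prob_space \<mu> by fact
  interpret G: prob_space "std_normal_measure :: (real^'n) measure"
    by (rule prob_space_std_normal_measure)
  interpret P: pair_prob_space \<mu> "std_normal_measure :: (real^'n) measure" ..
  define c where "c = (1 / sqrt (2 * pi * s\<^sup>2)) ^ CARD('n)"
  define h where "h x u = exp (\<i> * of_real (((1 / s) *\<^sub>R (x - y)) \<bullet> u))" for x u :: "real^'n"
  have [measurable]: "(\<lambda>(x, u). h x u) \<in> borel_measurable (\<mu> \<Otimes>\<^sub>M std_normal_measure)"
    unfolding h_def by measurable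
  have int: "integrable (\<mu> \<Otimes>\<^sub>M std_normal_measure) (\<lambda>(x, u). h x u)"
    by (rule P.P.integrable_const_bound[where B=1]) (auto simp: h_def)
  have inner: "(\<integral>x. h x u \<partial>\<mu>) = char_vec \<mu> ((1 / s) *\<^sub>R u) * exp (- (\<i> * of_real (u \<bullet> y / s)))" for u
  proof -
    have "h x u = exp (\<i> * of_real (((1 / s) *\<^sub>R u) \<bullet> x)) * exp (- (\<i> * of_real (u \<bullet> y / s)))" for x
      unfolding h_def exp_add[symmetric]
      by (simp add: inner_diff_left inner_commute algebra_simps diff_divide_distrib)
    then show ?thesis by (simp add: char_vec_def)
  qed
  have *: "complex_of_real (isotropic_normal_density s (y - x)) = of_real c * (\<integral>u. h x u \<partial>std_normal_measure)" for x
    unfolding h_def char_std_normal_measure isotropic_normal_density_eq_exp[OF s] c_def of_real_mult[symmetric]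
    using s by (simp add: power_divide norm_minus_commute)
  have "complex_of_real (\<integral>x. isotropic_normal_density s (y - x) \<partial>\<mu>) =
     of_real c * (\<integral>x. (\<integral>u. h x u \<partial>std_normal_measure) \<partial>\<mu>)"
    by (simp add: * integral_complex_of_real[symmetric])
  also have "(\<integral>x. (\<integral>u. h x u \<partial>std_normal_measure) \<partial>\<mu>) = (\<integral>u. (\<integral>x. h x u \<partial>\<mu>) \<partial>std_normal_measure)"
    by (rule P.Fubini_integral[OF int, symmetric])
  also have "\<dots> = (\<integral>u. char_vec \<mu> ((1 / s) *\<^sub>R u) * exp (- (\<i> * of_real (u \<bullet> y / s))) \<partial>std_normal_measure)"
    by (simp only: inner)
  finally show ?thesis by (simp add: c_def)
qed

lemma integral_shift_isotropic_normal:
  fixes f :: "real^'n::finite \<Rightarrow> real"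
  assumes [measurable]: "f \<in> borel_measurable borel"
  shows "(\<integral>y. f y * isotropic_normal_density s (y - x) \<partial>lborel) = (\<integral>z. f (x + z) \<partial>isotropic_normal s)"
proof -
  have "(\<integral>y. f y * isotropic_normal_density s (y - x) \<partial>lborel) =
    (\<integral>y. f y * isotropic_normal_density s (y - x) \<partial>distr lborel borel ((+) x))"
    by (simp add: lborel_distr_plus)
  also have "\<dots> = (\<integral>z. f (x + z) * isotropic_normal_density s z \<partial>lborel)"
    by (subst integral_distr) auto
  also have "\<dots> = (\<integral>z. f (x + z) \<partial>isotropic_normal s)"
    unfolding isotropic_normal_def by (subst integral_density) (auto simp: mult.commute)
  finally show ?thesis .
qed

text \<open>Small displacements are handled by uniform continuity. For displacements of length at
  least \<open>d\<close> the trivial bound \<open>2 * B\<close> is multiplied by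
  \<open>norm z ^ 3 / d ^ 3\<close>, which is at least 1 there, and the third moment makes this of
  order \<open>s ^ 3\<close>.\<close>

lemma isotropic_normal_smoothing_uniform:
  fixes f :: "real^'n::finite \<Rightarrow> real"
  assumes uc: "uniformly_continuous_on UNIV f" and B: "\<And>x. \<bar>f x\<bar> \<le> B" and e: "0 < e"
  obtains s where "0 < s" "\<And>x. \<bar>(\<integral>z. f (x + z) \<partial>isotropic_normal s) - f x\<bar> \<le> e"
proof -
  have "continuous_on UNIV f" using uc by (rule uniformly_continuous_imp_continuous)
  then have [measurable]: "f \<in> borel_measurable borel" by (rule borel_measurable_continuous_onI)
  obtain d where d: "0 < d" "\<And>x x'. dist x' x < d \<Longrightarrow> dist (f x') (f x) < e / 2"
    using uc e unfolding uniformly_continuous_on_def by (metis UNIV_I half_gt_zero)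
  obtain C where C: "0 \<le> C"
    "\<And>\<sigma>. 0 < \<sigma> \<Longrightarrow> integrable (isotropic_normal \<sigma>) (\<lambda>x::real^'n. norm x ^ 3)"
    "\<And>\<sigma>. 0 < \<sigma> \<Longrightarrow> (\<integral>x. norm (x::real^'n) ^ 3 \<partial>isotropic_normal \<sigma>) \<le> C * \<sigma> ^ 3"
    by (rule isotropic_normal_third_moment[where 'n='n]) blast
  have B0: "0 \<le> B" using B[of 0] by simp
  define K where "K = 2 * B * C / d ^ 3"
  have K: "0 \<le> K" using B0 C d by (simp add: K_def)
  \<comment> \<open>The cap 1 gives \<open>s ^ 3 \<le> s\<close>, and \<open>K + 1\<close> keeps the
    denominator positive when \<open>K = 0\<close>.\<close>
  define s where "s = min 1 (e / (2 * (K + 1)))"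
  have s: "0 < s" using K e by (simp add: s_def)
  have "s ^ 3 \<le> s" using s power_decreasing[of 1 3 s] by (simp add: s_def)
  then have "K * s ^ 3 \<le> (K + 1) * s" using K s by (intro mult_mono) auto
  also have "\<dots> \<le> (K + 1) * (e / (2 * (K + 1)))" using K by (intro mult_left_mono) (auto simp: s_def)
  also have "\<dots> = e / 2" using K by (simp add: field_simps)
  finally have Ks: "K * s ^ 3 \<le> e / 2" .
  interpret prob_space "isotropic_normal s :: (real^'n) measure"
    using s by (rule prob_space_isotropic_normal)
  have "\<bar>(\<integral>z. f (x + z) \<partial>isotropic_normal s) - f x\<bar> \<le> e" for x
  proof -
    have int: "integrable (isotropic_normal s) (\<lambda>z. f (x + z))"
      by (rule integrable_const_bound[where B=B]) (use B in auto)
    have int3: "integrable (isotropic_normal s) (\<lambda>z::real^'n. e / 2 + 2 * B / d ^ 3 * norm z ^ 3)"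
      using C(2)[OF s] by simp
    have pt: "\<bar>f (x + z) - f x\<bar> \<le> e / 2 + 2 * B / d ^ 3 * norm z ^ 3" for z
    proof (cases "norm z < d")
      case True
      then have "\<bar>f (x + z) - f x\<bar> < e / 2" using d(2)[of "x + z" x] by (simp add: dist_norm)
      moreover have "0 \<le> 2 * B / d ^ 3 * norm z ^ 3" using B0 d by simp
      ultimately show ?thesis by linarith
    next
      case False
      then have "d ^ 3 \<le> norm z ^ 3" using d by (intro power_mono) auto
      then have "2 * B \<le> 2 * B / d ^ 3 * norm z ^ 3"
        using B0 d by (simp add: pos_le_divide_eq mult_left_mono)
      moreover have "\<bar>f (x + z) - f x\<bar> \<le> 2 * B" using B[of "x + z"] B[of x] by linarith
      ultimately show ?thesis using e by linarith
    qed
    have "(\<integral>z. f (x + z) \<partial>isotropic_normal s) - f x = (\<integral>z. f (x + z) - f x \<partial>isotropic_normal s)"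
      using int prob_space by (simp add: Bochner_Integration.integral_diff)
    also have "\<bar>\<dots>\<bar> \<le> (\<integral>z. e / 2 + 2 * B / d ^ 3 * norm z ^ 3 \<partial>(isotropic_normal s :: (real^'n) measure))"
      by (rule integral_abs_bound_integral) (use int int3 pt in auto)
    also have "\<dots> = e / 2 + 2 * B / d ^ 3 * (\<integral>z. norm z ^ 3 \<partial>(isotropic_normal s :: (real^'n) measure))"
      using C(2)[OF s] prob_space by simp
    also have "\<dots> \<le> e / 2 + 2 * B / d ^ 3 * (C * s ^ 3)"
      using B0 d C(3)[OF s] by (intro add_left_mono mult_left_mono) auto
    also have "\<dots> \<le> e" using Ks by (simp add: K_def)
    finally show ?thesis .
  qed
  with s show ?thesis by (rule that)
qed

text \<open>Moves the smoothing from the test function to the measure, whose smoothed density is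
  accessible through characteristic functions. Lebesgue integrability of \<open>f\<close> supplies
  the dominating function for Fubini, as the normal density is bounded.\<close>

lemma integral_smoothing_swap:
  fixes f :: "real^'n::finite \<Rightarrow> real" and \<mu> :: "(real^'n) measure"
  assumes "prob_space \<mu>" and [measurable_cong]: "sets \<mu> = sets borel" and s: "0 < s"
    and f: "integrable lborel f"
  shows "(\<integral>x. (\<integral>z. f (x + z) \<partial>isotropic_normal s) \<partial>\<mu>) =
    (\<integral>y. f y * (\<integral>x. isotropic_normal_density s (y - x) \<partial>\<mu>) \<partial>lborel)"
proof -
  interpret prob_space \<mu> by fact
  interpret P: pair_sigma_finite \<mu> "lborel :: (real^'n) measure" ..
  have [measurable]: "f \<in> borel_measurable borel" using f by auto
  define c where "c = (1 / sqrt (2 * pi * s\<^sup>2)) ^ CARD('n)"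
  have intf: "integrable (\<mu> \<Otimes>\<^sub>M lborel) (\<lambda>(x, y). c * f y)"
    using f by (intro P.Fubini_integrable) auto
  have int: "integrable (\<mu> \<Otimes>\<^sub>M lborel) (\<lambda>(x, y). f y * isotropic_normal_density s (y - x))"
  proof (rule Bochner_Integration.integrable_bound[OF intf])
    show "AE p in \<mu> \<Otimes>\<^sub>M lborel. norm (case p of (x, y) \<Rightarrow> f y * isotropic_normal_density s (y - x)) \<le>
        norm (case p of (x, y) \<Rightarrow> c * f y)"
    proof (rule AE_I2, clarsimp simp: abs_mult)
      fix x y :: "real^'n"
      have "isotropic_normal_density s (y - x) \<le> \<bar>c\<bar>"
        using isotropic_normal_density_le[OF s, of "y - x"] by (simp add: c_def)
      then show "\<bar>f y\<bar> * isotropic_normal_density s (y - x) \<le> \<bar>c\<bar> * \<bar>f y\<bar>"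
        by (subst mult.commute) (rule mult_right_mono, simp_all)
    qed
  qed measurable
  have "(\<integral>x. (\<integral>z. f (x + z) \<partial>isotropic_normal s) \<partial>\<mu>) =
    (\<integral>x. (\<integral>y. f y * isotropic_normal_density s (y - x) \<partial>lborel) \<partial>\<mu>)"
    by (simp add: integral_shift_isotropic_normal)
  also have "\<dots> = (\<integral>y. (\<integral>x. f y * isotropic_normal_density s (y - x) \<partial>\<mu>) \<partial>lborel)"
    by (rule P.Fubini_integral[OF int, symmetric])
  finally show ?thesis by simp
qed

text \<open>After smoothing, dominated convergence applies twice: characteristic functions are
  bounded by 1, so the smoothed densities converge pointwise; these are bounded and \<open>f\<close>
  is integrable, so the integrals converge. The smoothing is then removed at a cost that is uniform
  over all probability measures.\<close>

lemma char_vec_tendsto_imp_integral_compact_support_tendsto: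
  fixes \<mu> :: "(real^'n::finite) measure" and N :: "nat \<Rightarrow> (real^'n) measure" and f :: "real^'n \<Rightarrow> real"
  assumes N: "\<And>k. prob_space (N k)" "\<And>k. sets (N k) = sets borel"
    and \<mu>: "prob_space \<mu>" "sets \<mu> = sets borel"
    and conv: "\<And>u. (\<lambda>k. char_vec (N k) u) \<longlonglongrightarrow> char_vec \<mu> u"
    and f: "continuous_on UNIV f" and supp: "\<And>x. x \<notin> cball 0 R \<Longrightarrow> f x = 0"
  shows "(\<lambda>k. \<integral>x. f x \<partial>N k) \<longlonglongrightarrow> (\<integral>x. f x \<partial>\<mu>)"
proof -
  have [measurable]: "f \<in> borel_measurable borel" using f by (rule borel_measurable_continuous_onI)
  obtain B where B: "\<And>x. \<bar>f x\<bar> \<le> B"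
  proof -
    have "bounded (f ` cball 0 R)"
      by (intro compact_imp_bounded compact_continuous_image continuous_on_subset[OF f]) auto
    then obtain B where "\<And>x. x \<in> cball 0 R \<Longrightarrow> \<bar>f x\<bar> \<le> B" unfolding bounded_iff real_norm_def by blast
    then have "\<bar>f x\<bar> \<le> max B 0" for x using supp[of x] by (cases "x \<in> cball 0 R") force+
    then show ?thesis by (rule that)
  qed
  have uc: "uniformly_continuous_on UNIV f"
  proof -
    \<comment> \<open>For two points at distance less than 1, either both lie in the ball of radius
      \<open>R + 2\<close>, or both lie outside the ball of radius \<open>R\<close>, where
      \<open>f\<close> vanishes.\<close>
    have "uniformly_continuous_on (cball 0 (R + 2)) f"
      by (intro compact_uniformly_continuous continuous_on_subset[OF f]) auto
    then show ?thesis
      unfolding uniformly_continuous_on_def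
    proof (intro allI impI)
      fix e :: real assume e: "0 < e" and *: "\<forall>e>0. \<exists>d>0. \<forall>x\<in>cball 0 (R + 2). \<forall>x'\<in>cball 0 (R + 2). dist x' x < d \<longrightarrow> dist (f x') (f x) < e"
      from * e obtain d where d: "d > 0" "\<And>x x'. x \<in> cball 0 (R + 2) \<Longrightarrow> x' \<in> cball 0 (R + 2) \<Longrightarrow> dist x' x < d \<Longrightarrow> dist (f x') (f x) < e"
        by blast
      have "dist (f x') (f x) < e" if "dist x' x < min d 1" for x x'
      proof (cases "norm x \<le> R + 1")
        case True
        moreover have "norm x' \<le> norm x + dist x' x"
          by (metis add.commute diff_le_eq dist_norm norm_triangle_ineq2)
        ultimately show ?thesis using that by (intro d) auto
      next
        case False
        moreover have "norm x \<le> norm x' + dist x' x"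
          by (metis add.commute diff_le_eq dist_norm norm_triangle_ineq2 norm_minus_commute)
        ultimately have "f x = 0" "f x' = 0" using that by (auto intro!: supp)
        then show ?thesis using e by simp
      qed
      then show "\<exists>d>0. \<forall>x\<in>UNIV. \<forall>x'\<in>UNIV. dist x' x < d \<longrightarrow> dist (f x') (f x) < e"
        using d(1) by (intro exI[of _ "min d 1"]) auto
    qed
  qed
  have B0: "0 \<le> B" using B[of 0] by simp
  have fin: "emeasure lborel (cball (0::real^'n) R) < \<infinity>"
    using emeasure_bounded_finite[of "cball (0::real^'n) R"] by simp
  have intR: "integrable lborel (\<lambda>x::real^'n. c * indicator (cball 0 R) x :: real)" for c
    using fin by simp
  have intf: "integrable lborel f"
    by (rule Bochner_Integration.integrable_bound[OF intR[of B]])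
       (use B supp in \<open>auto intro!: AE_I2 simp: indicator_def not_le intro: order_trans[OF _ abs_ge_self]\<close>)
  have smooth: "(\<lambda>k. \<integral>x. (\<integral>z. f (x + z) \<partial>isotropic_normal s) \<partial>N k) \<longlonglongrightarrow>
      (\<integral>x. (\<integral>z. f (x + z) \<partial>isotropic_normal s) \<partial>\<mu>)" if s: "0 < s" for s
  proof -
    define c where "c = (1 / sqrt (2 * pi * s\<^sup>2)) ^ CARD('n)"
    interpret G: prob_space "std_normal_measure :: (real^'n) measure"
      by (rule prob_space_std_normal_measure)
    define q where "q \<nu> y = (\<integral>x. isotropic_normal_density s (y - x) \<partial>\<nu>)" for \<nu> and y :: "real^'n"
    have meas_char: "(\<lambda>u. char_vec \<nu> ((1 / s) *\<^sub>R u)) \<in> borel_measurable borel"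
      if "prob_space \<nu>" and [measurable_cong]: "sets \<nu> = sets borel" for \<nu> :: "(real^'n) measure"
    proof -
      interpret prob_space \<nu> by fact
      show ?thesis unfolding char_vec_def by measurable
    qed
    have meas_q: "q \<nu> \<in> borel_measurable borel"
      if "prob_space \<nu>" and [measurable_cong]: "sets \<nu> = sets borel" for \<nu> :: "(real^'n) measure"
    proof -
      interpret prob_space \<nu> by fact
      show ?thesis unfolding q_def[abs_def] by measurable
    qed
    have q_bound: "\<bar>q \<nu> y\<bar> \<le> c" if "prob_space \<nu>" and [measurable_cong]: "sets \<nu> = sets borel" for \<nu> y
    proof -
      interpret prob_space \<nu> by fact
      have "q \<nu> y \<le> (\<integral>x. c \<partial>\<nu>)" unfolding q_def
        by (intro integral_mono_AE AE_I2 integrable_const_bound[where B=c])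
           (use isotropic_normal_density_le[OF s, where 'n='n] in \<open>auto simp: c_def\<close>)
      moreover have "0 \<le> q \<nu> y" unfolding q_def by (intro integral_nonneg_AE) auto
      ultimately show ?thesis by (simp add: prob_space)
    qed
    have q: "(\<lambda>k. q (N k) y) \<longlonglongrightarrow> q \<mu> y" for y
    proof -
      have "(\<lambda>k. \<integral>u. char_vec (N k) ((1 / s) *\<^sub>R u) * exp (- (\<i> * of_real (u \<bullet> y / s))) \<partial>std_normal_measure) \<longlonglongrightarrow>
        (\<integral>u. char_vec \<mu> ((1 / s) *\<^sub>R u) * exp (- (\<i> * of_real (u \<bullet> y / s))) \<partial>std_normal_measure)"
        by (rule integral_dominated_convergence[where w="\<lambda>_. 1"])
           (use meas_char N \<mu> conv norm_char_vec_le_1[OF N(1)] in \<open>auto intro!: tendsto_mult AE_I2 simp: norm_mult\<close>)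
      then have "(\<lambda>k. complex_of_real (q (N k) y)) \<longlonglongrightarrow> complex_of_real (q \<mu> y)"
        unfolding q_def integral_isotropic_normal_density_conv[OF N s] integral_isotropic_normal_density_conv[OF \<mu> s]
        by (intro tendsto_mult tendsto_const)
      then show ?thesis by (simp only: tendsto_of_real_iff)
    qed
    have "(\<lambda>k. \<integral>y. f y * q (N k) y \<partial>lborel) \<longlonglongrightarrow> (\<integral>y. f y * q \<mu> y \<partial>lborel)"
    proof (rule integral_dominated_convergence[where w="\<lambda>y. \<bar>f y\<bar> * c"])
      show "integrable lborel (\<lambda>y. \<bar>f y\<bar> * c)" using intf by simp
      show "AE y in lborel. (\<lambda>k. f y * q (N k) y) \<longlonglongrightarrow> f y * q \<mu> y"
        using q by (intro AE_I2 tendsto_mult) auto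
    qed (use meas_q N \<mu> q_bound in \<open>auto intro!: AE_I2 mult_left_mono simp: abs_mult\<close>)
    then show ?thesis
      unfolding integral_smoothing_swap[OF N s intf] integral_smoothing_swap[OF \<mu> s intf] q_def .
  qed
  show ?thesis
  proof (rule LIMSEQ_I)
    fix r :: real assume r: "0 < r"
    obtain s where s: "0 < s" "\<And>x. \<bar>(\<integral>z. f (x + z) \<partial>isotropic_normal s) - f x\<bar> \<le> r / 4"
      using isotropic_normal_smoothing_uniform[OF uc B, of "r / 4"] r by auto
    define F where "F x = (\<integral>z. f (x + z) \<partial>isotropic_normal s)" for x
    interpret I: prob_space "isotropic_normal s :: (real^'n) measure"
      using s(1) by (rule prob_space_isotropic_normal)
    have close: "\<bar>(\<integral>x. F x \<partial>\<nu>) - (\<integral>x. f x \<partial>\<nu>)\<bar> \<le> r / 4"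
      if "prob_space \<nu>" and [measurable_cong]: "sets \<nu> = sets borel" for \<nu>
    proof -
      interpret prob_space \<nu> by fact
      have [measurable]: "F \<in> borel_measurable borel" unfolding F_def[abs_def] by measurable
      have FB: "\<bar>F x\<bar> \<le> B + r / 4" for x
        using s(2)[of x, folded F_def] B[of x] by linarith
      have iF: "integrable \<nu> F" by (rule integrable_const_bound[where B="B + r / 4"]) (use FB in auto)
      have ifn: "integrable \<nu> f" by (rule integrable_const_bound[where B=B]) (use B in auto)
      have "\<bar>\<integral>x. F x - f x \<partial>\<nu>\<bar> \<le> (\<integral>x. r / 4 \<partial>\<nu>)"
        by (rule integral_abs_bound_integral) (use iF ifn s(2) in \<open>auto simp flip: F_def\<close>)
      then show ?thesis using iF ifn by (simp add: prob_space)
    qed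
    obtain n0 where n0: "\<And>k. k \<ge> n0 \<Longrightarrow> norm ((\<integral>x. F x \<partial>N k) - (\<integral>x. F x \<partial>\<mu>)) < r / 4"
      using LIMSEQ_D[OF smooth[OF s(1)], of "r / 4"] r by (auto simp: F_def)
    have "norm ((\<integral>x. f x \<partial>N k) - (\<integral>x. f x \<partial>\<mu>)) < r" if "k \<ge> n0" for k
      using n0[OF that] close[OF N, of k] close[OF \<mu>] r unfolding real_norm_def by linarith
    then show "\<exists>no. \<forall>n\<ge>no. norm ((\<integral>x. f x \<partial>N n) - (\<integral>x. f x \<partial>\<mu>)) < r" by blast
  qed
qed

text \<open>Tightness comes for free because the limit is already known to be a probability measure:
  the mass that \<open>N k\<close> keeps under a compactly supported cutoff converges to the mass
  that \<open>\<mu>\<close> keeps, which is close to 1 for a wide cutoff.\<close>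

lemma levy_continuity_vec:
  fixes \<mu> :: "(real^'n::finite) measure" and N :: "nat \<Rightarrow> (real^'n) measure"
  assumes N: "\<And>k. prob_space (N k)" "\<And>k. sets (N k) = sets borel"
    and \<mu>: "prob_space \<mu>" "sets \<mu> = sets borel"
    and conv: "\<And>u. (\<lambda>k. char_vec (N k) u) \<longlonglongrightarrow> char_vec \<mu> u"
  shows "weakly_converges N \<mu> sequentially"
  unfolding weakly_converges_def
proof (intro allI impI)
  fix f :: "real^'n \<Rightarrow> real" assume f: "continuous_on UNIV f" and "bounded (range f)"
  then obtain B where B: "\<And>x. \<bar>f x\<bar> \<le> B" by (auto simp: bounded_iff)
  have B0: "0 \<le> B" using B[of 0] by simp
  have [measurable]: "f \<in> borel_measurable borel" using f by (rule borel_measurable_continuous_onI)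
  \<comment> \<open>A continuous cutoff, equal to 1 on the ball of radius \<open>R\<close> and to 0
    outside the ball of radius \<open>R + 1\<close>.\<close>
  define \<kappa> where "\<kappa> R x = max 0 (min 1 (real R + 1 - norm x))" for R and x :: "real^'n"
  have \<kappa>_cont: "continuous_on UNIV (\<kappa> R)" for R unfolding \<kappa>_def by (intro continuous_intros)
  then have [measurable]: "\<kappa> R \<in> borel_measurable borel" for R by (rule borel_measurable_continuous_onI)
  have \<kappa>01: "0 \<le> \<kappa> R x" "\<kappa> R x \<le> 1" for R x by (auto simp: \<kappa>_def)
  have \<kappa>_supp: "x \<notin> cball 0 (real R + 1) \<Longrightarrow> \<kappa> R x = 0" for R x by (auto simp: \<kappa>_def)
  have \<kappa>_lim: "(\<lambda>R. \<integral>x. \<kappa> R x \<partial>\<mu>) \<longlonglongrightarrow> 1"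
  proof -
    interpret prob_space \<mu> by (rule \<mu>)
    note [measurable_cong] = \<mu>(2)
    have "(\<lambda>R. \<integral>x. \<kappa> R x \<partial>\<mu>) \<longlonglongrightarrow> (\<integral>x. 1 \<partial>\<mu>)"
    proof (rule integral_dominated_convergence[where w="\<lambda>_. 1"])
      have "(\<lambda>R. \<kappa> R x) \<longlonglongrightarrow> 1" for x
      proof (rule tendsto_eventually)
        obtain R0 where "norm x \<le> real R0" using real_arch_simple by blast
        then show "\<forall>\<^sub>F R in sequentially. \<kappa> R x = 1"
          by (intro eventually_sequentiallyI[of R0]) (auto simp: \<kappa>_def)
      qed
      then show "AE x in \<mu>. (\<lambda>R. \<kappa> R x) \<longlonglongrightarrow> 1" by auto
    qed (use \<kappa>01 in auto)
    then show ?thesis by (simp add: prob_space)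
  qed
  have split: "\<bar>(\<integral>x. f x \<partial>\<nu>) - (\<integral>x. f x * \<kappa> R x \<partial>\<nu>)\<bar> \<le> B * (1 - (\<integral>x. \<kappa> R x \<partial>\<nu>))"
    if "prob_space \<nu>" and [measurable_cong]: "sets \<nu> = sets borel" for \<nu> R
  proof -
    interpret prob_space \<nu> by fact
    have i1: "integrable \<nu> f" by (rule integrable_const_bound[where B=B]) (use B in auto)
    have i2: "integrable \<nu> (\<kappa> R)" by (rule integrable_const_bound[where B=1]) (use \<kappa>01 in auto)
    have i3: "integrable \<nu> (\<lambda>x. f x * \<kappa> R x)"
    proof (rule integrable_const_bound[where B="B * 1"])
      have "norm (f x * \<kappa> R x) \<le> B * 1" for x
        unfolding norm_mult using B \<kappa>01 B0 by (intro mult_mono) (auto simp: abs_of_nonneg)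
      then show "AE x in \<nu>. norm (f x * \<kappa> R x) \<le> B * 1" by blast
    qed measurable
    have "\<bar>\<integral>x. f x - f x * \<kappa> R x \<partial>\<nu>\<bar> \<le> (\<integral>x. B * (1 - \<kappa> R x) \<partial>\<nu>)"
    proof (rule integral_abs_bound_integral)
      fix x
      have "\<bar>f x\<bar> * \<bar>1 - \<kappa> R x\<bar> \<le> B * (1 - \<kappa> R x)"
        using B \<kappa>01 B0 by (intro mult_mono) auto
      then show "\<bar>f x - f x * \<kappa> R x\<bar> \<le> B * (1 - \<kappa> R x)"
        by (simp add: abs_mult[symmetric] algebra_simps)
    qed (use i1 i2 i3 in auto)
    also have "(\<integral>x. B * (1 - \<kappa> R x) \<partial>\<nu>) = B * (1 - (\<integral>x. \<kappa> R x \<partial>\<nu>))"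
      using i2 by (simp add: prob_space)
    finally show ?thesis using i1 i3 by simp
  qed
  show "(\<lambda>k. \<integral>x. f x \<partial>N k) \<longlonglongrightarrow> (\<integral>x. f x \<partial>\<mu>)"
  proof (rule LIMSEQ_I)
    fix r :: real assume r: "0 < r"
    \<comment> \<open>The cutoff costs at most \<open>B * e\<close> for \<open>\<mu>\<close> and
      \<open>B * (2 * e)\<close> for \<open>N k\<close>, and the cut integrals differ by less than
      \<open>r / 6\<close>.\<close>
    define e where "e = r / (6 * (B + 1))"
    have e: "0 < e" "B * e < r / 6" using r B0 by (auto simp: e_def field_simps)
    obtain R where "norm ((\<integral>x. \<kappa> R x \<partial>\<mu>) - 1) < e" using LIMSEQ_D[OF \<kappa>_lim e(1)] by blast
    then have R: "1 - (\<integral>x. \<kappa> R x \<partial>\<mu>) \<le> e" by (auto simp: abs_less_iff)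
    have l1: "(\<lambda>k. \<integral>x. \<kappa> R x \<partial>N k) \<longlonglongrightarrow> (\<integral>x. \<kappa> R x \<partial>\<mu>)"
      using \<kappa>_supp by (intro char_vec_tendsto_imp_integral_compact_support_tendsto[OF N \<mu> conv \<kappa>_cont]) auto
    have l2: "(\<lambda>k. \<integral>x. f x * \<kappa> R x \<partial>N k) \<longlonglongrightarrow> (\<integral>x. f x * \<kappa> R x \<partial>\<mu>)"
      using \<kappa>_supp
      by (intro char_vec_tendsto_imp_integral_compact_support_tendsto[OF N \<mu> conv, of _ "real R + 1"]
            continuous_on_mult f \<kappa>_cont) auto
    obtain n1 where n1: "\<And>k. k \<ge> n1 \<Longrightarrow> norm ((\<integral>x. \<kappa> R x \<partial>N k) - (\<integral>x. \<kappa> R x \<partial>\<mu>)) < e"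
      using LIMSEQ_D[OF l1 e(1)] by blast
    obtain n2 where n2: "\<And>k. k \<ge> n2 \<Longrightarrow> norm ((\<integral>x. f x * \<kappa> R x \<partial>N k) - (\<integral>x. f x * \<kappa> R x \<partial>\<mu>)) < r / 6"
      using LIMSEQ_D[OF l2, of "r / 6"] r by auto
    have "norm ((\<integral>x. f x \<partial>N k) - (\<integral>x. f x \<partial>\<mu>)) < r" if k: "k \<ge> max n1 n2" for k
    proof -
      have "1 - (\<integral>x. \<kappa> R x \<partial>N k) \<le> 2 * e" using n1[of k] k R by (auto simp: abs_less_iff)
      then have "B * (1 - (\<integral>x. \<kappa> R x \<partial>N k)) \<le> B * (2 * e)" using B0 by (rule mult_left_mono)
      moreover have "B * (1 - (\<integral>x. \<kappa> R x \<partial>\<mu>)) \<le> B * e" using R B0 by (rule mult_left_mono)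
      ultimately show ?thesis
        using split[OF N, of k R] split[OF \<mu>, of R] n2[of k] k e
        unfolding real_norm_def by linarith
    qed
    then show "\<exists>no. \<forall>n\<ge>no. norm ((\<integral>x. f x \<partial>N n) - (\<integral>x. f x \<partial>\<mu>)) < r" by blast
  qed
qed

section \<open>Second-order expansion of one winding step\<close>

lemma bigo_of_real_iff:
  "(\<lambda>x. of_real (f x)) \<in> O[F](\<lambda>x. of_real (g x) :: 'b::real_normed_field) \<longleftrightarrow> f \<in> O[F](g)"
  "(\<lambda>x. of_real (f x)) \<in> O[F](\<lambda>x. 1 :: 'b::real_normed_field) \<longleftrightarrow> f \<in> O[F](\<lambda>_. 1)"
  by (simp_all add: bigo_def)

text \<open>The bound 9/16 is the largest \<open>\<bar>m\<bar>\<close> that a step with \<rho> \<le>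
  1/4 can produce, namely 2/4 + 1/16. It keeps 1 + m between 7/16 and 25/16, away from the
  singularity of the power.\<close>

lemma one_plus_powr_taylor2:
  fixes b :: real
  obtains C where "\<And>m. \<bar>m\<bar> \<le> 9 / 16 \<Longrightarrow> \<bar>(1 + m) powr b - (1 + b * m + b * (b - 1) / 2 * m\<^sup>2)\<bar> \<le> C * \<bar>m\<bar> ^ 3"
proof -
  \<comment> \<open>Lagrange remainder: the third derivative is
    \<open>b * (b - 1) * (b - 2) * t powr (b - 3)\<close>, divided by 3! = 6. The sum of the two
    powers bounds \<open>t powr (b - 3)\<close> for either sign of \<open>b - 3\<close>.\<close>
  define c where "c = \<bar>b * (b - 1) * (b - 2)\<bar> * ((25/16) powr \<bar>b - 3\<bar> + (7/16) powr (- \<bar>b - 3\<bar>)) / 6"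
  define diff where "diff k x = (\<Prod>j<k. b - real j) * x powr (b - real k)" for k x
  have "\<bar>(1 + m) powr b - (1 + b * m + b * (b - 1) / 2 * m\<^sup>2)\<bar> \<le> c * \<bar>m\<bar> ^ 3" if m: "\<bar>m\<bar> \<le> 9 / 16" for m
  proof (cases "m = 0")
    case False
    have "\<exists>t. (if 1 + m < 1 then 1 + m < t \<and> t < 1 else 1 < t \<and> t < 1 + m) \<and>
       (1 + m) powr b = (\<Sum>k<3. diff k 1 / fact k * ((1 + m) - 1) ^ k) + diff 3 t / fact 3 * ((1 + m) - 1) ^ 3"
    proof (rule Taylor[where a = "7/16" and b = "25/16"])
      show "diff 0 = (\<lambda>x. x powr b)" by (simp add: diff_def fun_eq_iff)
      show "\<forall>k t. k < 3 \<and> 7/16 \<le> t \<and> t \<le> 25/16 \<longrightarrow> DERIV (diff k) t :> diff (Suc k) t"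
        unfolding diff_def by (auto intro!: derivative_eq_intros simp: algebra_simps)
    qed (use m False in auto)
    then obtain t where t: "if 1 + m < 1 then 1 + m < t \<and> t < 1 else 1 < t \<and> t < 1 + m"
      and eq: "(1 + m) powr b = (\<Sum>k<3. diff k 1 / fact k * m ^ k) + diff 3 t / fact 3 * m ^ 3"
      by auto
    have t: "7/16 \<le> t" "t \<le> 25/16" using t m by (auto split: if_splits)
    have "t powr (b - 3) \<le> (25/16) powr \<bar>b - 3\<bar> + (7/16) powr (- \<bar>b - 3\<bar>)"
    proof (cases "b \<ge> 3")
      case True
      then have "t powr (b - 3) \<le> (25/16) powr \<bar>b - 3\<bar>" using t by (auto intro!: powr_mono2)
      then show ?thesis by (simp add: add_increasing2)
    next
      case False
      then have "t powr (b - 3) \<le> (7/16) powr (- \<bar>b - 3\<bar>)" using t by (auto intro!: powr_mono2')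
      then show ?thesis by (simp add: add_increasing)
    qed
    then have "\<bar>diff 3 t / fact 3\<bar> \<le> c"
      by (simp add: diff_def c_def abs_mult numeral_3_eq_3 fact_numeral mult_left_mono divide_right_mono)
    then have "\<bar>diff 3 t / fact 3 * m ^ 3\<bar> \<le> c * \<bar>m\<bar> ^ 3"
      by (simp only: abs_mult power_abs) (intro mult_right_mono, auto)
    then show ?thesis unfolding eq
      by (simp add: diff_def numeral_3_eq_3 fact_numeral power2_eq_square algebra_simps)
  qed simp
  then show ?thesis by (rule that)
qed

text \<open>
  With \<open>\<rho> = |Y| / |X|\<close>, \<open>y = X \<bullet> Y / |X|\<^sup>2\<close>, \<open>m = 2 y + \<rho>\<^sup>2\<close> and \<open>s = \<xi> \<bullet> Im (cnj X * Y) / |X|\<^sup>2\<close>, one has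
  \<open>|X + Y|\<^sup>2 = |X|\<^sup>2 (1 + m)\<close>, and \<open>winding_step b m s\<close> is the factor by which the step from \<open>X\<close> to
  \<open>X + Y\<close> multiplies \<open>exp (i \<xi> \<bullet> \<zeta>) |W|\<^sup>2\<^sup>b\<close>.
\<close>

definition winding_step :: "real \<Rightarrow> real \<Rightarrow> real \<Rightarrow> complex" where
  "winding_step b m s = exp (\<i> * of_real (s * (1 + 1 / (1 + m)) / 2)) * of_real ((1 + m) powr b)"

text \<open>Modulo cubic terms in \<rho>, \<open>m\<^sup>2\<close> is \<open>4 * y\<^sup>2\<close>
  and the phase \<open>s * (1 + 1 / (1 + m)) / 2\<close> is \<open>s - s * y\<close>. In the
  imaginary part the \<open>- s * y\<close> of the phase meets \<open>2 * b * s * y\<close> from the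
  product with the power. The term \<open>b * m\<close> is kept whole, as its \<rho>^2 part is of
  second order too.\<close>

definition winding_step_taylor :: "real \<Rightarrow> real \<Rightarrow> real \<Rightarrow> real \<Rightarrow> complex" where
  "winding_step_taylor b y m s = Complex (1 + b * m + 2 * b * (b - 1) * y\<^sup>2 - s\<^sup>2 / 2) (s + (2 * b - 1) * (s * y))"

text \<open>The restriction \<rho> \<le> 1/4 keeps 1 + m at least 7/16, so that both
  \<open>1 / (1 + m)\<close> and the power can be expanded.\<close>

lemma winding_step_near:
  fixes b \<Lambda> :: real
  obtains C where "\<And>y s \<rho>. \<bar>y\<bar> \<le> \<rho> \<Longrightarrow> \<bar>s\<bar> \<le> \<Lambda> * \<rho> \<Longrightarrow> \<rho> \<le> 1 / 4 \<Longrightarrow>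
    norm (winding_step b (2 * y + \<rho>\<^sup>2) s - winding_step_taylor b y (2 * y + \<rho>\<^sup>2) s) \<le> C * \<rho> ^ 3"
proof -
  define D where "D = {(y, s, \<rho>). \<bar>y\<bar> \<le> \<rho> \<and> \<bar>s\<bar> \<le> \<Lambda> * \<rho> \<and> \<rho> \<le> (1 / 4 :: real)}"
  \<comment> \<open>Over a principal filter, \<open>O[F]\<close> means a bound with one constant on
    all of \<open>D\<close>, so the Landau rules deliver the uniform constant.\<close>
  define F where "F = principal D"
  define Y S R :: "real \<times> real \<times> real \<Rightarrow> real" where YSR: "Y = fst" "S = (\<lambda>p. fst (snd p))" "R = (\<lambda>p. snd (snd p))"
  define m where "m p = 2 * Y p + (R p)\<^sup>2" for p
  define \<theta> where "\<theta> p = S p * (1 + 1 / (1 + m p)) / 2" for p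
  have evI: "(\<And>p. p \<in> D \<Longrightarrow> P p) \<Longrightarrow> eventually P F" for P by (simp add: F_def eventually_principal)
  have D: "\<bar>Y p\<bar> \<le> R p" "\<bar>S p\<bar> \<le> \<Lambda> * R p" "0 \<le> R p" "R p \<le> 1 / 4" if "p \<in> D" for p
    using that by (auto simp: D_def YSR)
  have Rsq: "(R p)\<^sup>2 \<le> R p / 4" if "p \<in> D" for p
    using mult_left_mono[OF D(4)[OF that] D(3)[OF that]] by (simp add: power2_eq_square)
  have mD: "\<bar>m p\<bar> \<le> 9 / 4 * R p" "\<bar>m p\<bar> \<le> 9 / 16" if "p \<in> D" for p
    using D[OF that] Rsq[OF that] zero_le_power2[of "R p"] unfolding m_def by linarith+
  have YO: "Y \<in> O[F](R)" by (rule bigoI[where c=1], rule evI) (use D in auto)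
  have SO: "S \<in> O[F](R)" by (rule bigoI[where c=\<Lambda>], rule evI) (use D in auto)
  have mO: "m \<in> O[F](R)" by (rule bigoI[where c="9/4"], rule evI) (use D mD in auto)
  have RO1: "R \<in> O[F](\<lambda>_. 1)" by (rule bigoI[where c=1], rule evI) (use D(3,4) in fastforce)
  note mult = landau_o.big.mult
  have R3le2: "(\<lambda>p. R p ^ 3) \<in> O[F](\<lambda>p. R p ^ 2)"
    using landau_o.big.mult[OF RO1 landau_o.big_refl[of "\<lambda>p. R p ^ 2"]] by (simp add: power3_eq_cube power2_eq_square mult.assoc)
  obtain C1 where C1: "\<And>m. \<bar>m\<bar> \<le> 9 / 16 \<Longrightarrow> \<bar>(1 + m) powr b - (1 + b * m + b * (b - 1) / 2 * m\<^sup>2)\<bar> \<le> C1 * \<bar>m\<bar> ^ 3"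
    by (rule one_plus_powr_taylor2[of b]) blast
  define A0 where "A0 p = 1 + b * m p + 2 * b * (b - 1) * (Y p)\<^sup>2" for p
  define A where "A p = (1 + m p) powr b" for p
  define E0 where "E0 p = Complex (1 - (S p)\<^sup>2 / 2) (S p - S p * Y p)" for p
  define E where "E p = exp (\<i> * of_real (\<theta> p))" for p
  have A_A0: "(\<lambda>p. A p - A0 p) \<in> O[F](\<lambda>p. R p ^ 3)"
  proof -
    have "(\<lambda>p. A p - (1 + b * m p + b * (b - 1) / 2 * (m p)\<^sup>2)) \<in> O[F](\<lambda>p. m p ^ 3)"
      by (rule bigoI[where c=C1], rule evI) (use C1 mD in \<open>auto simp: A_def power_abs\<close>)
    also have "(\<lambda>p. m p ^ 3) \<in> O[F](\<lambda>p. R p ^ 3)" using mO by (rule landau_o.big_power)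
    finally have 1: "(\<lambda>p. A p - (1 + b * m p + b * (b - 1) / 2 * (m p)\<^sup>2)) \<in> O[F](\<lambda>p. R p ^ 3)" .
    \<comment> \<open>The replacement of \<open>m\<^sup>2\<close> by \<open>4 * y\<^sup>2\<close>
      costs \<open>(m - 2 * y) * (m + 2 * y)\<close>, whose first factor is exactly
      \<rho>^2.\<close>
    have "(\<lambda>p. (b * (b - 1) / 2) * (R p ^ 2 * (m p + 2 * Y p))) \<in> O[F](\<lambda>p. R p ^ 2 * R p)"
      using mult[OF landau_o.big_refl sum_in_bigo(1)[OF mO, of "\<lambda>p. 2 * Y p"], of "\<lambda>p. R p ^ 2"] YO by simp
    then have 2: "(\<lambda>p. (b * (b - 1) / 2) * (R p ^ 2 * (m p + 2 * Y p))) \<in> O[F](\<lambda>p. R p ^ 3)"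
      by (simp only: power3_eq_cube power2_eq_square)
    have "A p - A0 p = (A p - (1 + b * m p + b * (b - 1) / 2 * (m p)\<^sup>2)) +
        (b * (b - 1) / 2) * (R p ^ 2 * (m p + 2 * Y p))" for p
      by (simp add: A0_def m_def power2_eq_square field_simps)
    then show ?thesis by (simp only: sum_in_bigo(1)[OF 1 2])
  qed
  have \<theta>_expand: "(\<lambda>p. \<theta> p - (S p - S p * Y p)) \<in> O[F](\<lambda>p. R p ^ 3)"
  proof -
    have inv: "(\<lambda>p. 1 / (1 + m p)) \<in> O[F](\<lambda>_. 1)"
    proof (rule bigoI[where c="16/7"], rule evI)
      fix p assume "p \<in> D"
      then have "7 / 16 \<le> 1 + m p" using mD[of p] by (auto simp: abs_le_iff)
      then show "norm (1 / (1 + m p)) \<le> 16 / 7 * norm (1::real)" by (simp add: field_simps)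
    qed
    \<comment> \<open>With \<open>1 / (1 + m) = 1 - m + m\<^sup>2 / (1 + m)\<close> and
      \<open>m = 2 * y + \<rho>\<^sup>2\<close>, the linear terms cancel and this cubic product is
      all that remains.\<close>
    have "(\<lambda>p. S p * (m p * m p * (1 / (1 + m p)) - R p * R p)) \<in> O[F](\<lambda>p. R p * (R p * R p * 1))"
      using mult[OF mult[OF mO mO] inv] by (intro mult[OF SO] sum_in_bigo) auto
    then have "(\<lambda>p. S p * (m p * m p * (1 / (1 + m p)) - R p * R p) * (1/2)) \<in> O[F](\<lambda>p. R p ^ 3)"
      by (simp add: power3_eq_cube mult.assoc)
    moreover have "\<theta> p - (S p - S p * Y p) = S p * (m p * m p * (1 / (1 + m p)) - R p * R p) * (1/2)" if "p \<in> D" for p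
    proof -
      have "1 + m p \<noteq> 0" using mD[OF that] by auto
      then have I: "m p * m p * (1 / (1 + m p)) = 1 / (1 + m p) - 1 + m p" by (simp add: field_simps)
      show ?thesis
        unfolding I unfolding \<theta>_def using m_def[of p] by (simp add: field_simps power2_eq_square)
    qed
    ultimately show ?thesis by (subst landau_o.big.in_cong[OF evI])
  qed
  have \<theta>O: "\<theta> \<in> O[F](R)"
  proof -
    have "(\<lambda>p. \<theta> p - (S p - S p * Y p)) \<in> O[F](\<lambda>p. R p * 1)"
      using landau_o.big_trans[OF \<theta>_expand] mult[OF landau_o.big_refl mult[OF RO1 RO1], of R]
      by (simp add: power3_eq_cube mult.assoc)
    moreover have "(\<lambda>p. S p - S p * Y p) \<in> O[F](\<lambda>p. R p * 1)"
      using SO mult[OF SO landau_o.big_trans[OF YO RO1]] by (intro sum_in_bigo) auto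
    ultimately have "(\<lambda>p. (\<theta> p - (S p - S p * Y p)) + (S p - S p * Y p)) \<in> O[F](\<lambda>p. R p * 1)"
      by (rule sum_in_bigo)
    then show ?thesis by simp
  qed
  have E_E0: "(\<lambda>p. E p - E0 p) \<in> O[F](\<lambda>p. of_real (R p ^ 3))"
  proof -
    have "(\<lambda>p. E p - (1 + \<i> * of_real (\<theta> p) - of_real (\<theta> p ^ 2 / 2))) \<in> O[F](\<lambda>p. of_real (\<theta> p ^ 3))"
    proof (rule bigoI[where c="1/6"], rule evI)
      fix p
      show "norm (E p - (1 + \<i> * of_real (\<theta> p) - of_real (\<theta> p ^ 2 / 2))) \<le> 1 / 6 * norm (of_real (\<theta> p ^ 3) :: complex)"
      proof -
        have "(\<Sum>k\<le>2. (\<i> * of_real (\<theta> p)) ^ k / fact k) = 1 + \<i> * of_real (\<theta> p) - of_real (\<theta> p ^ 2 / 2)"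
          by (simp add: numeral_2_eq_2 algebra_simps)
        then show ?thesis
          using iexp_approx1[of "\<theta> p" 2] by (simp add: E_def norm_power fact_numeral)
      qed
    qed
    moreover have "(\<lambda>p. of_real (\<theta> p ^ 3)) \<in> O[F](\<lambda>p. of_real (R p ^ 3) :: complex)"
      using landau_o.big_power[OF \<theta>O, of 3] by (simp only: bigo_of_real_iff)
    ultimately have 1: "(\<lambda>p. E p - (1 + \<i> * of_real (\<theta> p) - of_real (\<theta> p ^ 2 / 2))) \<in> O[F](\<lambda>p. of_real (R p ^ 3))"
      by (rule landau_o.big_trans)
    have 2: "(\<lambda>p. \<i> * of_real (\<theta> p - (S p - S p * Y p))) \<in> O[F](\<lambda>p. of_real (R p ^ 3))"
      using \<theta>_expand by (simp only: cmult_in_bigo_iff bigo_of_real_iff simp_thms)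
    have "(\<lambda>p. \<theta> p - S p) \<in> O[F](\<lambda>p. R p * R p)"
    proof -
      have "(\<lambda>p. (\<theta> p - (S p - S p * Y p)) - S p * Y p) \<in> O[F](\<lambda>p. R p * R p)"
        using sum_in_bigo(2)[OF landau_o.big_trans[OF \<theta>_expand R3le2[unfolded power2_eq_square]] mult[OF SO YO]] .
      then show ?thesis by (simp add: algebra_simps)
    qed
    \<comment> \<open>Half the difference of the squares of \<theta> and s, factored so that an
      O(\<rho>^2) term meets an O(\<rho>) term.\<close>
    then have "(\<lambda>p. (\<theta> p - S p) * (\<theta> p + S p) * (1/2)) \<in> O[F](\<lambda>p. R p * R p * R p)"
      using mult[OF _ sum_in_bigo(1)[OF \<theta>O SO]] by simp
    then have 3: "(\<lambda>p. of_real ((\<theta> p - S p) * (\<theta> p + S p) * (1/2))) \<in> O[F](\<lambda>p. of_real (R p ^ 3) :: complex)"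
      by (simp only: bigo_of_real_iff power3_eq_cube)
    have "E p - E0 p = (E p - (1 + \<i> * of_real (\<theta> p) - of_real (\<theta> p ^ 2 / 2))) +
       \<i> * of_real (\<theta> p - (S p - S p * Y p)) - of_real ((\<theta> p - S p) * (\<theta> p + S p) * (1/2))" for p
      by (simp add: E0_def complex_eq_iff power2_eq_square algebra_simps)
    then show ?thesis using sum_in_bigo(2)[OF sum_in_bigo(1)[OF 1 2] 3] by (simp only:)
  qed
  have "(\<lambda>p. E p * of_real (A p) - winding_step_taylor b (Y p) (m p) (S p)) \<in> O[F](\<lambda>p. of_real (R p ^ 3))"
  proof -
    have E1: "E \<in> O[F](\<lambda>_. 1)" by (rule bigoI[where c=1], rule evI) (simp add: E_def)
    \<comment> \<open>The product is compared in three stages: phase times error of the power, error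
      of the phase times \<open>A0\<close>, and the product of the two expansions against its own
      second-order part.\<close>
    have a: "(\<lambda>p. E p * of_real (A p - A0 p)) \<in> O[F](\<lambda>p. 1 * of_real (R p ^ 3))"
      using A_A0 by (intro mult E1) (simp only: bigo_of_real_iff)
    have A01: "A0 \<in> O[F](\<lambda>_. 1)"
    proof -
      have "Y \<in> O[F](\<lambda>_. 1)" "m \<in> O[F](\<lambda>_. 1)" using YO mO RO1 landau_o.big_trans by blast+
      then show ?thesis unfolding A0_def[abs_def] using landau_o.big_power[of Y F "\<lambda>_. 1" 2]
        by (intro sum_in_bigo) auto
    qed
    have b: "(\<lambda>p. (E p - E0 p) * of_real (A0 p)) \<in> O[F](\<lambda>p. of_real (R p ^ 3) * 1)"
      using A01 by (intro mult E_E0) (simp add: bigo_of_real_iff)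
    have "(\<lambda>p. E0 p * of_real (A0 p) - winding_step_taylor b (Y p) (m p) (S p)) \<in> O[F](\<lambda>p. of_real (R p ^ 3))"
    proof -
      have Y1: "Y \<in> O[F](\<lambda>_. 1)" using YO RO1 landau_o.big_trans by blast
      have U: "(\<lambda>p. b * m p + 2 * b * (b - 1) * (Y p * Y p)) \<in> O[F](R)"
        using mO mult[OF YO Y1] by (intro sum_in_bigo) auto
      have re: "(\<lambda>p. - (1/2) * (S p * S p * (b * m p + 2 * b * (b - 1) * (Y p * Y p)))) \<in> O[F](\<lambda>p. R p ^ 3)"
        using mult[OF mult[OF SO SO] U] by (simp add: power3_eq_cube)
      have YY: "(\<lambda>p. Y p * Y p) \<in> O[F](\<lambda>p. R p * R p)" by (rule mult[OF YO YO])
      have V: "(\<lambda>p. b * (R p * R p) + 2 * b * (b - 1) * (Y p * Y p) - Y p * (b * m p + 2 * b * (b - 1) * (Y p * Y p)))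
         \<in> O[F](\<lambda>p. R p * R p)"
        using YY mult[OF YO U] by (intro sum_in_bigo) auto
      have im: "(\<lambda>p. S p * (b * (R p * R p) + 2 * b * (b - 1) * (Y p * Y p) - Y p * (b * m p + 2 * b * (b - 1) * (Y p * Y p))))
         \<in> O[F](\<lambda>p. R p ^ 3)"
        using mult[OF SO V] by (simp add: power3_eq_cube mult.assoc)
      have "E0 p * of_real (A0 p) - winding_step_taylor b (Y p) (m p) (S p) =
        of_real (- (1/2) * (S p * S p * (b * m p + 2 * b * (b - 1) * (Y p * Y p)))) +
        \<i> * of_real (S p * (b * (R p * R p) + 2 * b * (b - 1) * (Y p * Y p) - Y p * (b * m p + 2 * b * (b - 1) * (Y p * Y p))))" for p
        by (simp add: E0_def A0_def winding_step_taylor_def complex_eq_iff)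
           (simp add: m_def power2_eq_square field_simps)
      moreover have "(\<lambda>p. of_real (- (1/2) * (S p * S p * (b * m p + 2 * b * (b - 1) * (Y p * Y p)))) +
        \<i> * of_real (S p * (b * (R p * R p) + 2 * b * (b - 1) * (Y p * Y p) - Y p * (b * m p + 2 * b * (b - 1) * (Y p * Y p)))))
         \<in> O[F](\<lambda>p. of_real (R p ^ 3) :: complex)"
        using re im
        by (intro sum_in_bigo) (simp_all only: bigo_of_real_iff cmult_in_bigo_iff simp_thms)
      ultimately show ?thesis by simp
    qed
    with a b[unfolded mult_1_right] have "(\<lambda>p. E p * of_real (A p - A0 p) + (E p - E0 p) * of_real (A0 p) +
       (E0 p * of_real (A0 p) - winding_step_taylor b (Y p) (m p) (S p))) \<in> O[F](\<lambda>p. of_real (R p ^ 3))"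
      unfolding mult_1_left by (rule sum_in_bigo(1)[OF sum_in_bigo(1)])
    then show ?thesis by (simp add: algebra_simps)
  qed
  then obtain c where c: "eventually (\<lambda>p. norm (E p * of_real (A p) - winding_step_taylor b (Y p) (m p) (S p)) \<le> c * norm (of_real (R p ^ 3) :: complex)) F"
    by (elim landau_o.bigE) blast
  then have c: "norm (E p * of_real (A p) - winding_step_taylor b (Y p) (m p) (S p)) \<le> c * R p ^ 3" if "p \<in> D" for p
  proof -
    have "norm (of_real (R p ^ 3) :: complex) = R p ^ 3" using D(3)[OF that] by (simp add: norm_power)
    with c that show ?thesis by (auto simp: F_def eventually_principal simp del: of_real_power)
  qed
  show ?thesis
  proof (rule that[of c])
    fix y s \<rho> :: real assume "\<bar>y\<bar> \<le> \<rho>" "\<bar>s\<bar> \<le> \<Lambda> * \<rho>" "\<rho> \<le> 1 / 4"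
    then have "(y, s, \<rho>) \<in> D" by (simp add: D_def)
    from c[OF this] show "norm (winding_step b (2 * y + \<rho>\<^sup>2) s - winding_step_taylor b y (2 * y + \<rho>\<^sup>2) s) \<le> c * \<rho> ^ 3"
      by (simp add: winding_step_def E_def A_def \<theta>_def m_def YSR)
  qed
qed

text \<open>For \<rho> \<ge> 1/4 no expansion is attempted: since b \<le> 1, the factor and its
  Taylor polynomial both grow at most quadratically in \<rho>, and \<rho>^3 dominates every lower
  power there. This case includes the steps that reach the origin or jump past it.\<close>

lemma winding_step_taylor_bound:
  fixes b \<Lambda> :: real
  assumes b: "0 \<le> b" "b \<le> 1" and \<Lambda>: "0 \<le> \<Lambda>"
  obtains C where "0 \<le> C" "\<And>y s \<rho>. \<bar>y\<bar> \<le> \<rho> \<Longrightarrow> \<bar>s\<bar> \<le> \<Lambda> * \<rho> \<Longrightarrow>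
    norm (winding_step b (2 * y + \<rho>\<^sup>2) s - winding_step_taylor b y (2 * y + \<rho>\<^sup>2) s) \<le> C * \<rho> ^ 3"
proof -
  obtain C where C: "\<And>y s \<rho>. \<bar>y\<bar> \<le> \<rho> \<Longrightarrow> \<bar>s\<bar> \<le> \<Lambda> * \<rho> \<Longrightarrow> \<rho> \<le> 1 / 4 \<Longrightarrow>
    norm (winding_step b (2 * y + \<rho>\<^sup>2) s - winding_step_taylor b y (2 * y + \<rho>\<^sup>2) s) \<le> C * \<rho> ^ 3"
    by (rule winding_step_near[of \<Lambda> b]) blast
  \<comment> \<open>Coefficients of 1, \<rho> and \<rho>^2 in the sum of the two norm bounds, each
    multiplied by the factor in 1 \<le> 64 \<rho>^3, \<rho> \<le> 16 \<rho>^3 and \<rho>^2 \<le> 4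
    \<rho>^3.\<close>
  define K where "K = 3 * 64 + (4 + \<Lambda>) * 16 + (4 + \<Lambda> + \<Lambda>\<^sup>2 / 2) * 4"
  have K: "0 \<le> K" using \<Lambda> by (simp add: K_def)
  have far: "norm (winding_step b (2 * y + \<rho>\<^sup>2) s - winding_step_taylor b y (2 * y + \<rho>\<^sup>2) s) \<le> K * \<rho> ^ 3"
    if y: "\<bar>y\<bar> \<le> \<rho>" and s: "\<bar>s\<bar> \<le> \<Lambda> * \<rho>" and \<rho>: "1 / 4 \<le> \<rho>" for y s \<rho>
  proof -
    have b1: "\<bar>b - 1\<bar> \<le> 1" "\<bar>2 * b - 1\<bar> \<le> 1" using b by auto
    have y2: "y\<^sup>2 \<le> \<rho>\<^sup>2" and s2: "s\<^sup>2 \<le> \<Lambda>\<^sup>2 * \<rho>\<^sup>2"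
      using power_mono[OF y, of 2] power_mono[OF s, of 2] by (auto simp: power_mult_distrib)
    \<comment> \<open>The expression is at least \<open>(1 + y)\<^sup>2\<close>, because y^2 \<le>
      \<rho>^2.\<close>
    have m: "0 \<le> 1 + (2 * y + \<rho>\<^sup>2)" using zero_le_power2[of "1 + y"] y2 by (simp add: power2_eq_square algebra_simps)
    have m': "\<bar>2 * y + \<rho>\<^sup>2\<bar> \<le> 2 * \<rho> + \<rho>\<^sup>2" using y zero_le_power2[of \<rho>] by linarith
    have "(1 + (2 * y + \<rho>\<^sup>2)) powr b \<le> 1 + (1 + (2 * y + \<rho>\<^sup>2))"
    proof (cases "1 + (2 * y + \<rho>\<^sup>2) \<le> 1")
      case True
      then have "(1 + (2 * y + \<rho>\<^sup>2)) powr b \<le> 1" using m b by (intro powr_le1) linarith+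
      then show ?thesis using m by linarith
    next
      case False
      then have "(1 + (2 * y + \<rho>\<^sup>2)) powr b \<le> (1 + (2 * y + \<rho>\<^sup>2)) powr 1" using b by (intro powr_mono) auto
      then show ?thesis using m by simp
    qed
    then have 1: "norm (winding_step b (2 * y + \<rho>\<^sup>2) s) \<le> 2 + 2 * \<rho> + \<rho>\<^sup>2"
      using m' by (simp add: winding_step_def norm_mult)
    have t1: "\<bar>b * (2 * y + \<rho>\<^sup>2)\<bar> \<le> 1 * (2 * \<rho> + \<rho>\<^sup>2)"
      unfolding abs_mult using b m' by (intro mult_mono) auto
    have t2: "\<bar>2 * b * (b - 1) * y\<^sup>2\<bar> \<le> 2 * 1 * 1 * \<rho>\<^sup>2"
      unfolding abs_mult using b b1 y2 by (intro mult_mono) auto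
    have t3: "\<bar>(2 * b - 1) * (s * y)\<bar> \<le> 1 * ((\<Lambda> * \<rho>) * \<rho>)"
      unfolding abs_mult using b1 s y \<Lambda> \<rho> by (intro mult_mono) auto
    have abs4: "\<bar>1 + p + q - r / 2\<bar> \<le> 1 + P + Q + R / 2" if "\<bar>p\<bar> \<le> P" "\<bar>q\<bar> \<le> Q" "0 \<le> r" "r \<le> R" for p q r P Q R :: real
      using that by linarith
    have "\<bar>1 + b * (2 * y + \<rho>\<^sup>2) + 2 * b * (b - 1) * y\<^sup>2 - s\<^sup>2 / 2\<bar> \<le>
        1 + 1 * (2 * \<rho> + \<rho>\<^sup>2) + 2 * 1 * 1 * \<rho>\<^sup>2 + \<Lambda>\<^sup>2 * \<rho>\<^sup>2 / 2"
      by (rule abs4[OF t1 t2 zero_le_power2 s2])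
    moreover have "\<bar>s + (2 * b - 1) * (s * y)\<bar> \<le> \<Lambda> * \<rho> + 1 * ((\<Lambda> * \<rho>) * \<rho>)"
      by (rule order_trans[OF abs_triangle_ineq add_mono[OF s t3]])
    ultimately have
      "\<bar>1 + b * (2 * y + \<rho>\<^sup>2) + 2 * b * (b - 1) * y\<^sup>2 - s\<^sup>2 / 2\<bar> \<le> 1 + (2 * \<rho> + \<rho>\<^sup>2) + 2 * \<rho>\<^sup>2 + \<Lambda>\<^sup>2 * \<rho>\<^sup>2 / 2"
      "\<bar>s + (2 * b - 1) * (s * y)\<bar> \<le> \<Lambda> * \<rho> + \<Lambda> * \<rho>\<^sup>2"
      by (simp_all add: power2_eq_square mult.assoc)
    then have 2: "norm (winding_step_taylor b y (2 * y + \<rho>\<^sup>2) s) \<le>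
        1 + (2 * \<rho> + \<rho>\<^sup>2) + 2 * \<rho>\<^sup>2 + \<Lambda>\<^sup>2 * \<rho>\<^sup>2 / 2 + (\<Lambda> * \<rho> + \<Lambda> * \<rho>\<^sup>2)"
      using cmod_le[of "winding_step_taylor b y (2 * y + \<rho>\<^sup>2) s"] unfolding winding_step_taylor_def by simp
    have r1: "\<rho>\<^sup>2 \<le> 4 * \<rho> ^ 3" using mult_right_mono[OF \<rho>, of "\<rho>\<^sup>2"] by (simp add: power2_eq_square power3_eq_cube)
    have "\<rho> \<le> 4 * \<rho>\<^sup>2" using mult_right_mono[OF \<rho>, of \<rho>] \<rho> by (simp add: power2_eq_square)
    with r1 have r2: "\<rho> \<le> 16 * \<rho> ^ 3" by linarith
    with \<rho> have r3: "1 \<le> 64 * \<rho> ^ 3" by linarith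
    have "norm (winding_step b (2 * y + \<rho>\<^sup>2) s - winding_step_taylor b y (2 * y + \<rho>\<^sup>2) s) \<le>
        3 * 1 + (4 + \<Lambda>) * \<rho> + (4 + \<Lambda> + \<Lambda>\<^sup>2 / 2) * \<rho>\<^sup>2"
      using norm_triangle_ineq4[of "winding_step b (2 * y + \<rho>\<^sup>2) s" "winding_step_taylor b y (2 * y + \<rho>\<^sup>2) s"] 1 2
      by (simp add: algebra_simps)
    also have "\<dots> \<le> 3 * (64 * \<rho> ^ 3) + (4 + \<Lambda>) * (16 * \<rho> ^ 3) + (4 + \<Lambda> + \<Lambda>\<^sup>2 / 2) * (4 * \<rho> ^ 3)"
      using r1 r2 r3 \<Lambda> by (intro add_mono mult_left_mono) auto
    also have "\<dots> = K * \<rho> ^ 3" by (simp add: K_def algebra_simps)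
    finally show ?thesis .
  qed
  show ?thesis
  proof (rule that[of "max C K"])
    fix y s \<rho> :: real assume *: "\<bar>y\<bar> \<le> \<rho>" "\<bar>s\<bar> \<le> \<Lambda> * \<rho>"
    have "0 \<le> \<rho>" using * by linarith
    then have le: "C * \<rho> ^ 3 \<le> max C K * \<rho> ^ 3" "K * \<rho> ^ 3 \<le> max C K * \<rho> ^ 3" by (auto intro!: mult_right_mono)
    show "norm (winding_step b (2 * y + \<rho>\<^sup>2) s - winding_step_taylor b y (2 * y + \<rho>\<^sup>2) s) \<le> max C K * \<rho> ^ 3"
    proof (cases "\<rho> \<le> 1 / 4")
      case True
      from order_trans[OF C[OF * True] le(1)] show ?thesis .
    next
      case False
      then have "1 / 4 \<le> \<rho>" by simp
      from order_trans[OF far[OF * this] le(2)] show ?thesis .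
    qed
  qed (use K in auto)
qed

section \<open>Quaternion algebra and mean of one step\<close>

lemma integral_norm_bound_AE:
  fixes f :: "'a \<Rightarrow> 'b::{banach, second_countable_topology}"
  assumes "integrable M f" "integrable M g" "AE x in M. norm (f x) \<le> g x"
  shows "norm (\<integral>x. f x \<partial>M) \<le> (\<integral>x. g x \<partial>M)"
  using integral_norm_bound[of M f] integral_mono_AE[OF integrable_norm[OF assms(1)] assms(2,3)] by linarith

text \<open>The quaternion product of X with the imaginary quaternion \<xi> on the right. It
  represents the functional \<open>\<xi> \<bullet> qIm (qmult (qcnj X) Y)\<close> of Y as an inner
  product.\<close>

definition winding_dual :: "quat \<Rightarrow> real^3 \<Rightarrow> quat" where
  "winding_dual X \<xi> = Quat
     (- \<xi> $ 1 * X $ 2 - \<xi> $ 2 * X $ 3 - \<xi> $ 3 * X $ 4)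
     (\<xi> $ 1 * X $ 1 - \<xi> $ 2 * X $ 4 + \<xi> $ 3 * X $ 3)
     (\<xi> $ 1 * X $ 4 + \<xi> $ 2 * X $ 1 - \<xi> $ 3 * X $ 2)
     (- \<xi> $ 1 * X $ 3 + \<xi> $ 2 * X $ 2 + \<xi> $ 3 * X $ 1)"

lemma qIm_nth [simp]: "qIm q $ 1 = q $ 2" "qIm q $ 2 = q $ 3" "qIm q $ 3 = q $ 4"
  by (simp_all add: qIm_def)

lemma inner_quat: "(X :: quat) \<bullet> Y = X $ 1 * Y $ 1 + X $ 2 * Y $ 2 + X $ 3 * Y $ 3 + X $ 4 * Y $ 4"
  by (simp add: inner_vec_def sum_4)

lemma inner_real3: "(u :: real^3) \<bullet> v = u $ 1 * v $ 1 + u $ 2 * v $ 2 + u $ 3 * v $ 3"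
  by (simp add: inner_vec_def sum_3)

lemma inner_qIm_qmult_qcnj: "\<xi> \<bullet> qIm (qmult (qcnj X) Y) = winding_dual X \<xi> \<bullet> Y"
  by (simp only: inner_quat inner_real3 qIm_nth qmult_def qcnj_def winding_dual_def Quat_nth)
     (simp add: algebra_simps)

text \<open>Right multiplication by an imaginary quaternion is skew-symmetric.\<close>

lemma winding_dual_orthogonal: "winding_dual X \<xi> \<bullet> X = 0"
  by (simp only: inner_quat winding_dual_def Quat_nth) (simp add: algebra_simps)

lemma inner_winding_dual_self: "winding_dual X \<xi> \<bullet> winding_dual X \<xi> = (\<xi> \<bullet> \<xi>) * (X \<bullet> X)"
  by (simp only: inner_quat inner_real3 winding_dual_def Quat_nth) (simp add: algebra_simps)

lemma norm_winding_dual: "norm (winding_dual X \<xi>) = norm \<xi> * norm X"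
  by (simp add: norm_eq_sqrt_inner inner_winding_dual_self real_sqrt_mult)

lemma winding_dual_add: "winding_dual (X + Y) \<xi> = winding_dual X \<xi> + winding_dual Y \<xi>"
  unfolding vec_eq_iff forall_4 by (simp only: winding_dual_def Quat_nth vector_add_component) (simp add: algebra_simps)

definition stratonovich_increment :: "quat \<Rightarrow> quat \<Rightarrow> real^3" where
  "stratonovich_increment X Y = (1/2) *\<^sub>R (winding_form X Y + winding_form (X + Y) Y)"

lemma inner_winding_form: "\<xi> \<bullet> winding_form X Y = (winding_dual X \<xi> \<bullet> Y) / (norm X)\<^sup>2"
  by (simp add: winding_form_def inner_qIm_qmult_qcnj)

text \<open>Both ends of the step share one numerator, since \<open>winding_dual Y \<xi>\<close> is
  orthogonal to Y; the two evaluations differ only in the radius.\<close>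

lemma inner_stratonovich_increment:
  "\<xi> \<bullet> stratonovich_increment X Y = (winding_dual X \<xi> \<bullet> Y) * (1 / (norm X)\<^sup>2 + 1 / (norm (X + Y))\<^sup>2) / 2"
  by (simp add: stratonovich_increment_def inner_add_right inner_winding_form winding_dual_add
      inner_add_left winding_dual_orthogonal algebra_simps add_divide_distrib)

text \<open>A step that ends exactly at 0 is included: then \<open>1 + m = 0\<close>, and
  \<open>0 powr b = 0\<close> makes both sides vanish.\<close>

lemma stratonovich_increment_eq_winding_step:
  fixes X Y :: quat and \<xi> :: "real^3"
  assumes X: "X \<noteq> 0"
  defines "\<rho> \<equiv> norm Y / norm X" and "y \<equiv> (X \<bullet> Y) / (norm X)\<^sup>2" and "s \<equiv> (winding_dual X \<xi> \<bullet> Y) / (norm X)\<^sup>2"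
  shows "exp (\<i> * of_real (\<xi> \<bullet> stratonovich_increment X Y)) * of_real (norm (X + Y) powr (2 * b)) =
    of_real (norm X powr (2 * b)) * winding_step b (2 * y + \<rho>\<^sup>2) s"
    and "\<bar>y\<bar> \<le> \<rho>" and "\<bar>s\<bar> \<le> norm \<xi> * \<rho>"
proof -
  have nX: "0 < norm X" using X by simp
  have n2: "(norm (X + Y))\<^sup>2 = (norm X)\<^sup>2 * (1 + (2 * y + \<rho>\<^sup>2))"
    using nX by (simp add: \<rho>_def y_def power_divide field_simps power2_norm_eq_inner inner_add_left inner_add_right inner_commute)
  have m: "0 \<le> 1 + (2 * y + \<rho>\<^sup>2)"
    using n2 nX by (metis zero_le_mult_iff zero_le_power2 power2_eq_square mult_pos_pos not_less)
  have "norm (X + Y) powr (2 * b) = ((norm (X + Y))\<^sup>2) powr b"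
    by (simp add: powr_powr flip: powr_numeral)
  also have "\<dots> = ((norm X)\<^sup>2) powr b * (1 + (2 * y + \<rho>\<^sup>2)) powr b"
    unfolding n2 using m by (simp add: powr_mult)
  also have "((norm X)\<^sup>2) powr b = norm X powr (2 * b)"
    by (simp add: powr_powr flip: powr_numeral)
  finally have pw: "norm (X + Y) powr (2 * b) = norm X powr (2 * b) * (1 + (2 * y + \<rho>\<^sup>2)) powr b" .
  have st: "\<xi> \<bullet> stratonovich_increment X Y = s * (1 + 1 / (1 + (2 * y + \<rho>\<^sup>2))) / 2"
  proof -
    have "1 / (norm X)\<^sup>2 + 1 / ((norm X)\<^sup>2 * (1 + (2 * y + \<rho>\<^sup>2))) = (1 + 1 / (1 + (2 * y + \<rho>\<^sup>2))) / (norm X)\<^sup>2"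
      by (simp add: add_divide_distrib mult.commute)
    then show ?thesis unfolding inner_stratonovich_increment n2 s_def by simp
  qed
  show "exp (\<i> * of_real (\<xi> \<bullet> stratonovich_increment X Y)) * of_real (norm (X + Y) powr (2 * b)) =
    of_real (norm X powr (2 * b)) * winding_step b (2 * y + \<rho>\<^sup>2) s"
    unfolding winding_step_def pw st by (simp only: of_real_mult mult_ac)
  have "\<bar>X \<bullet> Y\<bar> \<le> norm X * norm Y" by (rule Cauchy_Schwarz_ineq2)
  then show "\<bar>y\<bar> \<le> \<rho>" using nX by (simp add: y_def \<rho>_def field_simps power2_eq_square)
  have "\<bar>winding_dual X \<xi> \<bullet> Y\<bar> \<le> norm \<xi> * norm X * norm Y"
    using Cauchy_Schwarz_ineq2[of "winding_dual X \<xi>" Y] by (simp add: norm_winding_dual)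
  then show "\<bar>s\<bar> \<le> norm \<xi> * \<rho>" using nX by (simp add: s_def \<rho>_def field_simps power2_eq_square)
qed

text \<open>The linear terms and the mixed term have mean 0, the latter by orthogonality. With r =
  |X|, the quadratic ones contribute \<open>h\<^sup>2 / r\<^sup>2 * (4 * b + 2 * b * (b - 1) - (norm
  \<xi>)\<^sup>2 / 2)\<close>, where the 4 is the dimension, and this vanishes precisely by the
  relation between b and \<xi>.\<close>

lemma winding_step_taylor_expectation:
  fixes X :: quat and \<xi> :: "real^3"
  assumes X: "X \<noteq> 0" and h: "0 < h" and b: "4 * b * (b + 1) = (norm \<xi>)\<^sup>2"
  defines "f \<equiv> \<lambda>Y. winding_step_taylor b ((X \<bullet> Y) / (norm X)\<^sup>2)
      (2 * ((X \<bullet> Y) / (norm X)\<^sup>2) + (norm Y / norm X)\<^sup>2) ((winding_dual X \<xi> \<bullet> Y) / (norm X)\<^sup>2)"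
  shows "integrable (isotropic_normal h) f" and "(\<integral>Y. f Y \<partial>isotropic_normal h) = 1"
proof -
  define V where "V = winding_dual X \<xi>"
  define n where "n = norm X"
  have n: "0 < n" using X by (simp add: n_def)
  interpret prob_space "isotropic_normal h :: quat measure" by (rule prob_space_isotropic_normal[OF h])
  have f: "f Y = of_real (1 + (2 * b / n\<^sup>2) * (X \<bullet> Y) + (b / n\<^sup>2) * (norm Y)\<^sup>2 +
        (2 * b * (b - 1) / n ^ 4) * ((X \<bullet> Y) * (X \<bullet> Y)) - (1 / (2 * n ^ 4)) * ((V \<bullet> Y) * (V \<bullet> Y))) +
      \<i> * of_real ((1 / n\<^sup>2) * (V \<bullet> Y) + ((2 * b - 1) / n ^ 4) * ((V \<bullet> Y) * (X \<bullet> Y)))" for Y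
    unfolding f_def winding_step_taylor_def complex_eq_iff V_def[symmetric] n_def[symmetric]
    using n by (simp add: field_simps power2_eq_square power4_eq_xxxx)
  note I [simp] = isotropic_normal_integrable_inner[OF h] isotropic_normal_integrable_inner_mult[OF h]
    isotropic_normal_integrable_norm_square[OF h]
  note E = isotropic_normal_mean[OF h] isotropic_normal_covariance[OF h] isotropic_normal_integral_norm_square[OF h]
  show "integrable (isotropic_normal h) f"
    unfolding f[abs_def] by (intro Bochner_Integration.integrable_add integrable_mult_right integrable_of_real
      Bochner_Integration.integrable_diff I integrable_const)
  have VV: "V \<bullet> V = (norm \<xi>)\<^sup>2 * n\<^sup>2" and XX: "X \<bullet> X = n\<^sup>2" and VX: "V \<bullet> X = 0"
    by (simp_all add: V_def n_def inner_winding_dual_self power2_norm_eq_inner winding_dual_orthogonal)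
  have "(\<integral>Y. f Y \<partial>isotropic_normal h) =
    of_real (\<integral>Y. 1 + (2 * b / n\<^sup>2) * (X \<bullet> Y) + (b / n\<^sup>2) * (norm Y)\<^sup>2 +
        (2 * b * (b - 1) / n ^ 4) * ((X \<bullet> Y) * (X \<bullet> Y)) - (1 / (2 * n ^ 4)) * ((V \<bullet> Y) * (V \<bullet> Y)) \<partial>isotropic_normal h) +
      \<i> * of_real (\<integral>Y. (1 / n\<^sup>2) * (V \<bullet> Y) + ((2 * b - 1) / n ^ 4) * ((V \<bullet> Y) * (X \<bullet> Y)) \<partial>isotropic_normal h)"
    unfolding f integral_complex_of_real[symmetric]
    by (subst Bochner_Integration.integral_add)
       (auto intro!: Bochner_Integration.integrable_add integrable_mult_right integrable_of_real
         Bochner_Integration.integrable_diff I integrable_const simp del: of_real_add of_real_mult of_real_diff)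
  also have "(\<integral>Y. 1 + (2 * b / n\<^sup>2) * (X \<bullet> Y) + (b / n\<^sup>2) * (norm Y)\<^sup>2 +
        (2 * b * (b - 1) / n ^ 4) * ((X \<bullet> Y) * (X \<bullet> Y)) - (1 / (2 * n ^ 4)) * ((V \<bullet> Y) * (V \<bullet> Y)) \<partial>isotropic_normal h) =
     1 + b / n\<^sup>2 * (h\<^sup>2 * 4) + 2 * b * (b - 1) / n ^ 4 * (h\<^sup>2 * n\<^sup>2) - 1 / (2 * n ^ 4) * (h\<^sup>2 * ((norm \<xi>)\<^sup>2 * n\<^sup>2))"
    using prob_space by (simp add: E XX VV)
  also have "\<dots> = 1"
    unfolding b[symmetric] using n by (simp add: field_simps power2_eq_square power4_eq_xxxx)
  also have "(\<integral>Y. (1 / n\<^sup>2) * (V \<bullet> Y) + ((2 * b - 1) / n ^ 4) * ((V \<bullet> Y) * (X \<bullet> Y)) \<partial>isotropic_normal h) = 0"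
    by (simp add: E VX)
  finally show "(\<integral>Y. f Y \<partial>isotropic_normal h) = 1" by simp
qed

lemma stratonovich_increment_measurable [measurable (raw)]:
  assumes f: "f \<in> borel_measurable N" and g: "g \<in> borel_measurable N"
  shows "(\<lambda>x. stratonovich_increment (f x) (g x)) \<in> borel_measurable N"
proof -
  have nth: "(\<lambda>p. stratonovich_increment (fst p) (snd p) \<bullet> i) \<in> borel_measurable (borel \<Otimes>\<^sub>M borel)" for i
  proof -
    have [measurable]: "(\<lambda>p. (fst p :: quat) $ k) \<in> borel_measurable (borel \<Otimes>\<^sub>M (borel :: quat measure))"
        "(\<lambda>p. (snd p :: quat) $ k) \<in> borel_measurable ((borel :: quat measure) \<Otimes>\<^sub>M borel)" for k
      unfolding borel_prod by (intro borel_measurable_continuous_onI continuous_intros)+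
    show ?thesis
      unfolding inner_commute[of _ i] inner_stratonovich_increment winding_dual_def inner_quat Quat_nth by measurable
  qed
  have "(\<lambda>p. stratonovich_increment (fst p) (snd p)) \<in> borel_measurable (borel \<Otimes>\<^sub>M borel)"
    using nth by (subst borel_measurable_euclidean_space) auto
  from measurable_compose[OF measurable_Pair[OF f g] this] show ?thesis by simp
qed

lemma norm_powr_le_one_plus_square:
  fixes x :: "'a::real_normed_vector"
  assumes "0 \<le> b" "b \<le> 1"
  shows "norm x powr (2 * b) \<le> 1 + (norm x)\<^sup>2"
proof (cases "norm x \<le> 1")
  case True
  then have "norm x powr (2 * b) \<le> 1" using assms by (intro powr_le1) auto
  then show ?thesis using zero_le_power2[of "norm x"] by linarith
next
  case False
  then have "norm x powr (2 * b) \<le> norm x powr 2" using assms by (intro powr_mono) auto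
  also have "\<dots> = (norm x)\<^sup>2" using False by (simp add: powr_numeral)
  finally show ?thesis by simp
qed

text \<open>The Taylor polynomial has mean exactly 1, so only the cubic remainder counts, and its
  mean is controlled by the third moment of the step. Here h is the standard deviation of the step,
  so \<open>h ^ 3\<close> is the power 3/2 of its variance.\<close>

lemma stratonovich_increment_expectation:
  fixes \<xi> :: "real^3"
  assumes b: "0 \<le> b" "b \<le> 1" "4 * b * (b + 1) = (norm \<xi>)\<^sup>2"
  obtains C where "0 \<le> C"
    "\<And>X h. X \<noteq> 0 \<Longrightarrow> 0 < h \<Longrightarrow>
      norm ((\<integral>Y. exp (\<i> * of_real (\<xi> \<bullet> stratonovich_increment X Y)) * of_real (norm (X + Y) powr (2 * b)) \<partial>isotropic_normal h)
        - of_real (norm X powr (2 * b))) \<le> C * h ^ 3 * norm X powr (2 * b - 3)"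
proof -
  obtain C where C: "0 \<le> C" "\<And>y s \<rho>. \<bar>y\<bar> \<le> \<rho> \<Longrightarrow> \<bar>s\<bar> \<le> norm \<xi> * \<rho> \<Longrightarrow>
    norm (winding_step b (2 * y + \<rho>\<^sup>2) s - winding_step_taylor b y (2 * y + \<rho>\<^sup>2) s) \<le> C * \<rho> ^ 3"
    by (rule winding_step_taylor_bound[OF b(1,2), of "norm \<xi>"]) auto
  obtain K where K: "0 \<le> K"
    "\<And>\<sigma>. 0 < \<sigma> \<Longrightarrow> integrable (isotropic_normal \<sigma>) (\<lambda>x::quat. norm x ^ 3)"
    "\<And>\<sigma>. 0 < \<sigma> \<Longrightarrow> (\<integral>x. norm (x::quat) ^ 3 \<partial>isotropic_normal \<sigma>) \<le> K * \<sigma> ^ 3"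
    by (rule isotropic_normal_third_moment[where 'n=4]) blast
  show ?thesis
  proof (rule that[of "C * K"])
    show "0 \<le> C * K" using C K by simp
    fix X :: quat and h :: real assume X: "X \<noteq> 0" and h: "0 < h"
    interpret prob_space "isotropic_normal h :: quat measure" by (rule prob_space_isotropic_normal[OF h])
    define \<rho> where "\<rho> Y = norm Y / norm X" for Y :: quat
    define y where "y Y = (X \<bullet> Y) / (norm X)\<^sup>2" for Y
    define s where "s Y = (winding_dual X \<xi> \<bullet> Y) / (norm X)\<^sup>2" for Y
    define g where "g Y = exp (\<i> * of_real (\<xi> \<bullet> stratonovich_increment X Y)) * of_real (norm (X + Y) powr (2 * b))" for Y
    define T where "T Y = winding_step_taylor b (y Y) (2 * y Y + (\<rho> Y)\<^sup>2) (s Y)" for Y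
    have [measurable]: "g \<in> borel_measurable borel" unfolding g_def[abs_def] by measurable
    have T: "integrable (isotropic_normal h) T" "(\<integral>Y. T Y \<partial>isotropic_normal h) = 1"
      using winding_step_taylor_expectation[OF X h b(3)] by (simp_all add: T_def[abs_def] y_def \<rho>_def s_def)
    define N where "N = norm X powr (2 * b)"
    have g: "g Y = of_real N * winding_step b (2 * y Y + (\<rho> Y)\<^sup>2) (s Y)" "\<bar>y Y\<bar> \<le> \<rho> Y" "\<bar>s Y\<bar> \<le> norm \<xi> * \<rho> Y" for Y
      using stratonovich_increment_eq_winding_step(1)[OF X, where Y=Y and \<xi>=\<xi> and b=b]
        stratonovich_increment_eq_winding_step(2)[OF X, where Y=Y]
        stratonovich_increment_eq_winding_step(3)[OF X, where Y=Y and \<xi>=\<xi>] by (simp_all add: g_def y_def \<rho>_def s_def N_def)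
    have pt: "norm (g Y - of_real N * T Y) \<le> N * C / norm X ^ 3 * norm Y ^ 3" for Y
    proof -
      have "norm (g Y - of_real N * T Y) = N * norm (winding_step b (2 * y Y + (\<rho> Y)\<^sup>2) (s Y) - T Y)"
        unfolding g(1) right_diff_distrib[symmetric] norm_mult by (simp add: N_def)
      also have "\<dots> \<le> N * (C * \<rho> Y ^ 3)"
        unfolding T_def using C(2)[OF g(2,3)] by (intro mult_left_mono) (simp_all add: N_def)
      finally show ?thesis by (simp add: \<rho>_def power_divide)
    qed
    have int3: "integrable (isotropic_normal h) (\<lambda>Y::quat. N * C / norm X ^ 3 * norm Y ^ 3)" using K(2)[OF h] by simp
    have intd: "integrable (isotropic_normal h) (\<lambda>Y. g Y - of_real N * T Y)"
    proof (rule Bochner_Integration.integrable_bound[OF int3])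
      show "AE Y in isotropic_normal h. norm (g Y - of_real N * T Y) \<le> norm (N * C / norm X ^ 3 * norm Y ^ 3)"
        unfolding real_norm_def by (rule AE_I2, rule order_trans[OF pt abs_ge_self])
    qed (use T(1) in measurable)
    then have intg: "integrable (isotropic_normal h) g"
      using Bochner_Integration.integrable_add[OF intd integrable_mult_right[OF T(1), of "of_real N"]] by simp
    have "(\<integral>Y. g Y \<partial>isotropic_normal h) - of_real N = (\<integral>Y. g Y - of_real N * T Y \<partial>isotropic_normal h)"
      using intg T by simp
    also have "norm \<dots> \<le> (\<integral>Y. N * C / norm X ^ 3 * norm (Y :: quat) ^ 3 \<partial>isotropic_normal h)"
      using pt by (intro integral_norm_bound_AE[OF intd int3]) auto
    also have "\<dots> = N * C / norm X ^ 3 * (\<integral>Y. norm Y ^ 3 \<partial>(isotropic_normal h :: quat measure))" by simp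
    also have "\<dots> \<le> N * C / norm X ^ 3 * (K * h ^ 3)"
      using K(3)[OF h] C by (intro mult_left_mono) (auto simp: N_def)
    also have "\<dots> = C * K * h ^ 3 * norm X powr (2 * b - 3)"
      using X by (simp add: N_def powr_diff powr_numeral)
    finally show "norm ((\<integral>Y. exp (\<i> * of_real (\<xi> \<bullet> stratonovich_increment X Y)) * of_real (norm (X + Y) powr (2 * b)) \<partial>isotropic_normal h)
        - of_real (norm X powr (2 * b))) \<le> C * K * h ^ 3 * norm X powr (2 * b - 3)"
      by (simp only: g_def N_def)
  qed
qed

section \<open>Negative moments of the radius\<close>

lemma nn_integral_lborel_translate:
  fixes f :: "'a::euclidean_space \<Rightarrow> ennreal"
  assumes [measurable]: "f \<in> borel_measurable borel"
  shows "(\<integral>\<^sup>+x. f (a + x) \<partial>lborel) = (\<integral>\<^sup>+x. f x \<partial>lborel)"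
proof -
  have "(\<integral>\<^sup>+x. f x \<partial>lborel) = (\<integral>\<^sup>+x. f x \<partial>distr lborel borel ((+) a))"
    by (simp add: lborel_distr_plus)
  then show ?thesis by (simp add: nn_integral_distr)
qed

lemma nn_integral_isotropic_normal_scale:
  fixes F :: "real^'n::finite \<Rightarrow> ennreal"
  assumes \<sigma>: "0 < \<sigma>" and [measurable]: "F \<in> borel_measurable borel"
  shows "(\<integral>\<^sup>+z. F z \<partial>isotropic_normal \<sigma>) = (\<integral>\<^sup>+z. F (\<sigma> *\<^sub>R z) \<partial>isotropic_normal 1)"
proof -
  have *: "ennreal (\<sigma> ^ CARD('n)) * ennreal (isotropic_normal_density \<sigma> (\<sigma> *\<^sub>R z)) = ennreal (isotropic_normal_density 1 z)" for z :: "real^'n"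
  proof -
    have "(1 / sqrt (2 * pi * \<sigma>\<^sup>2)) ^ CARD('n) = (1 / sqrt (2 * pi)) ^ CARD('n) / \<sigma> ^ CARD('n)"
      using \<sigma> by (simp add: real_sqrt_mult power_mult_distrib power_divide)
    moreover have "(norm (\<sigma> *\<^sub>R z))\<^sup>2 / (2 * \<sigma>\<^sup>2) = (norm z)\<^sup>2 / 2"
      using \<sigma> by (simp add: power_mult_distrib)
    ultimately have "\<sigma> ^ CARD('n) * isotropic_normal_density \<sigma> (\<sigma> *\<^sub>R z) = isotropic_normal_density 1 z"
      using \<sigma> by (simp add: isotropic_normal_density_eq_exp)
    then show ?thesis using \<sigma> by (simp flip: ennreal_mult)
  qed
  have "(\<integral>\<^sup>+z. F z \<partial>isotropic_normal \<sigma>) = (\<integral>\<^sup>+z. ennreal (isotropic_normal_density \<sigma> z) * F z \<partial>lborel)"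
    unfolding isotropic_normal_def by (rule nn_integral_density) auto
  also have "\<dots> = (\<integral>\<^sup>+z. ennreal (isotropic_normal_density \<sigma> z) * F z
      \<partial>density (distr lborel borel (\<lambda>x. 0 + \<sigma> *\<^sub>R x)) (\<lambda>_. ennreal (\<bar>\<sigma>\<bar> ^ DIM(real^'n))))"
    using \<sigma> by (subst lborel_affine[of \<sigma> 0, symmetric]) auto
  also have "\<dots> = (\<integral>\<^sup>+z. ennreal (\<sigma> ^ CARD('n)) * (ennreal (isotropic_normal_density \<sigma> (\<sigma> *\<^sub>R z)) * F (\<sigma> *\<^sub>R z)) \<partial>lborel)"
    using \<sigma> by (subst nn_integral_density) (simp_all add: nn_integral_distr)
  also have "\<dots> = (\<integral>\<^sup>+z. ennreal (isotropic_normal_density 1 z) * F (\<sigma> *\<^sub>R z) \<partial>lborel)"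
    unfolding mult.assoc[symmetric] * ..
  also have "\<dots> = (\<integral>\<^sup>+z. F (\<sigma> *\<^sub>R z) \<partial>isotropic_normal 1)"
    unfolding isotropic_normal_def by (rule nn_integral_density[symmetric]) auto
  finally show ?thesis .
qed

lemma nn_integral_abs_powr_finite:
  assumes p: "- 1 < p"
  shows "(\<integral>\<^sup>+t. indicator {-1..1} t * ennreal (\<bar>t\<bar> powr p) \<partial>lborel) < \<infinity>"
proof -
  define I where "I = (\<integral>\<^sup>+t. ennreal (indicator {0..1} t * t powr p) \<partial>lborel)"
  have "(\<lambda>t. t powr p) integrable_on {0..1}" using p by (intro integrable_on_powr_from_0) auto
  then obtain r where "((\<lambda>t. t powr p) has_integral r) {0..1}" by blast
  then have I: "I < \<infinity>" unfolding I_def by (subst nn_integral_has_integral_lebesgue) auto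
  have I2: "(\<integral>\<^sup>+t. ennreal (indicator {0..1} (- t) * (- t) powr p) \<partial>lborel) = I"
  proof -
    have "I = (\<integral>\<^sup>+t. ennreal (indicator {0..1} t * t powr p) \<partial>distr lborel borel uminus)"
      unfolding I_def by (simp add: lborel_distr_uminus)
    then show ?thesis by (simp add: nn_integral_distr)
  qed
  have "(\<integral>\<^sup>+t. indicator {-1..1} t * ennreal (\<bar>t\<bar> powr p) \<partial>lborel) \<le>
    (\<integral>\<^sup>+t. ennreal (indicator {0..1} t * t powr p) + ennreal (indicator {0..1} (- t) * (- t) powr p) \<partial>lborel)"
    by (intro nn_integral_mono) (auto simp: indicator_def split: if_splits)
  also have "\<dots> = I + I" by (subst nn_integral_add) (auto simp: I2 I_def)
  also have "\<dots> < \<infinity>" using I by simp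
  finally show ?thesis .
qed

text \<open>One exponent serves all powers \<open>- p\<close> with p \<le> 3, because they are
  smaller on the unit ball.\<close>

definition inv_cube_mass :: ennreal where
  "inv_cube_mass = (\<integral>\<^sup>+x. indicator (ball 0 1) x * ennreal (norm (x :: quat) powr (-3)) \<partial>lborel)"

lemma inv_cube_mass_finite: "inv_cube_mass < \<infinity>"
proof -
  \<comment> \<open>\<open>|x|\<^sup>-\<^sup>3\<close> is at most the product of the four \<open>|x\<^sub>i|\<close> to the power \<open>- 3 / 4\<close>. The value \<open>\<top>\<close> at 0 replaces the junk value \<open>0 powr p = 0\<close>.\<close>
  define f where "f t = (if t = 0 then \<top> else indicator {-1..1} t * ennreal (\<bar>t\<bar> powr (-3/4)))" for t :: real
  have [measurable]: "f \<in> borel_measurable borel" unfolding f_def[abs_def] by measurable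
  have f1: "(\<integral>\<^sup>+t. f t \<partial>lborel) < \<infinity>"
  proof -
    have "(\<integral>\<^sup>+t. f t \<partial>lborel) = (\<integral>\<^sup>+t. indicator {-1..1} t * ennreal (\<bar>t\<bar> powr (-3/4)) \<partial>lborel)"
      by (intro nn_integral_cong_AE eventually_mono[OF AE_lborel_singleton[of 0]]) (simp add: f_def)
    also have "\<dots> < \<infinity>" by (rule nn_integral_abs_powr_finite) simp
    finally show ?thesis .
  qed
  have "indicator (ball 0 1) x * ennreal (norm x powr (-3)) \<le> (\<Prod>i\<in>UNIV. f (x $ i))" for x :: quat
  proof (cases "norm x < 1")
    case True
    then have le: "\<bar>x $ i\<bar> \<le> 1" for i using component_le_norm_cart[of x i] by linarith
    show ?thesis
    proof (cases "\<exists>i. x $ i = 0")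
      case zero: True
      \<comment> \<open>A vanishing factor would annihilate \<top>, since
        \<open>0 * \<top> = 0\<close>. On the unit ball no factor vanishes, so one zero coordinate
        makes the product infinite.\<close>
      have "f (x $ i) \<noteq> 0" for i
        using le[of i] by (auto simp: f_def indicator_def abs_le_iff)
      then have "(\<Prod>i\<in>UNIV. f (x $ i)) = \<top>"
        using zero by (subst ennreal_prod_eq_top) (auto simp: f_def)
      then show ?thesis by simp
    next
      case False
      then have nz: "x $ i \<noteq> 0" for i by blast
      then have "x \<noteq> 0" by auto
      then have n: "0 < norm x" by simp
      have "norm x powr (-3) = (\<Prod>i\<in>(UNIV :: 4 set). norm x powr (-3/4))"
        using n by (simp add: powr_powr flip: powr_realpow)
      also have "\<dots> \<le> (\<Prod>i\<in>UNIV. \<bar>x $ i\<bar> powr (-3/4))"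
        using nz component_le_norm_cart[of x] by (intro prod_mono conjI powr_mono2') auto
      finally have "ennreal (norm x powr (-3)) \<le> (\<Prod>i\<in>UNIV. ennreal (\<bar>x $ i\<bar> powr (-3/4)))"
        by (simp add: prod_ennreal ennreal_leI)
      also have "\<dots> = (\<Prod>i\<in>UNIV. f (x $ i))"
        using nz le by (intro prod.cong) (auto simp: f_def abs_le_iff indicator_def)
      finally show ?thesis using True by simp
    qed
  qed simp
  then have "inv_cube_mass \<le> (\<integral>\<^sup>+x. (\<Prod>i\<in>UNIV. f ((x::quat) $ i)) \<partial>lborel)"
    unfolding inv_cube_mass_def by (intro nn_integral_mono) auto
  also have "\<dots> = (\<Prod>i\<in>(UNIV::4 set). \<integral>\<^sup>+t. f t \<partial>lborel)" by (rule nn_integral_lborel_prod_vec) auto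
  also have "\<dots> < \<infinity>" using f1 by (simp add: power_less_top_ennreal)
  finally show ?thesis .
qed

text \<open>Away from the ball of radius r the power is at most \<open>r powr (- p)\<close> and the
  total mass is 1; inside, the density is at most D and the power is integrable. A density bound
  only near the origin is what survives as \<sigma> tends to 0.\<close>

lemma nn_integral_negative_moment_le:
  fixes v :: quat
  assumes \<sigma>: "0 < \<sigma>" and r: "0 < r" "r \<le> 1" and p: "0 \<le> p" "p \<le> 3" and D: "0 \<le> D"
    and dens: "\<And>y. norm y < r \<Longrightarrow> isotropic_normal_density \<sigma> (y - v) \<le> D"
  shows "(\<integral>\<^sup>+z. ennreal (norm (v + z) powr (- p)) \<partial>isotropic_normal \<sigma>) \<le> ennreal (r powr (- p)) + ennreal D * inv_cube_mass"
proof -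
  have [measurable]: "ball (0::quat) 1 \<in> sets borel" by simp
  let ?g = "\<lambda>y. ennreal (isotropic_normal_density \<sigma> (y - v))"
  have "(\<integral>\<^sup>+z. ennreal (norm (v + z) powr (- p)) \<partial>isotropic_normal \<sigma>) =
     (\<integral>\<^sup>+z. ?g (v + z) * ennreal (norm (v + z) powr (- p)) \<partial>lborel)"
    unfolding isotropic_normal_def by (subst nn_integral_density) auto
  also have "\<dots> = (\<integral>\<^sup>+y. ?g y * ennreal (norm y powr (- p)) \<partial>lborel)"
    by (rule nn_integral_lborel_translate) measurable
  also have "\<dots> \<le> (\<integral>\<^sup>+y. ?g y * ennreal (r powr (- p)) +
      ennreal D * (indicator (ball 0 1) y * ennreal (norm y powr (-3))) \<partial>lborel)"
  proof (intro nn_integral_mono)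
    fix y :: quat
    show "?g y * ennreal (norm y powr (- p)) \<le> ?g y * ennreal (r powr (- p)) +
      ennreal D * (indicator (ball 0 1) y * ennreal (norm y powr (-3)))"
    proof (cases "norm y < r")
      case True
      have "norm y powr (- p) \<le> norm y powr (-3)"
        using True r p by (cases "y = 0") (auto intro!: powr_mono')
      then have "?g y * ennreal (norm y powr (- p)) \<le> ennreal D * (1 * ennreal (norm y powr (-3)))"
        using dens[OF True] by (simp add: mult_mono ennreal_leI)
      also have "1 = (indicator (ball 0 1) y :: ennreal)" using True r by simp
      finally show ?thesis by (simp add: add_increasing)
    next
      case False
      then have "norm y powr (- p) \<le> r powr (- p)" using r p by (intro powr_mono2') auto
      then have "?g y * ennreal (norm y powr (- p)) \<le> ?g y * ennreal (r powr (- p))"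
        by (intro mult_left_mono ennreal_leI) auto
      then show ?thesis by (simp add: add_increasing2)
    qed
  qed
  also have "\<dots> = (\<integral>\<^sup>+y. ?g y \<partial>lborel) * ennreal (r powr (- p)) + ennreal D * inv_cube_mass"
    unfolding inv_cube_mass_def by (subst nn_integral_add) (auto simp: nn_integral_multc nn_integral_cmult)
  also have "(\<integral>\<^sup>+y. ?g y \<partial>lborel) = 1"
  proof -
    have "(\<integral>\<^sup>+y. ?g y \<partial>lborel) = (\<integral>\<^sup>+z. ?g (v + z) \<partial>lborel)"
      by (rule nn_integral_lborel_translate[symmetric]) measurable
    also have "\<dots> = emeasure (isotropic_normal \<sigma>) (space (isotropic_normal \<sigma> :: quat measure))"
      unfolding isotropic_normal_def by (subst emeasure_density) auto
    finally show ?thesis using prob_space.emeasure_space_1[OF prob_space_isotropic_normal[OF \<sigma>, where 'n=4]] by simp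
  qed
  finally show ?thesis by simp
qed

text \<open>Uniformity in \<sigma> is the point. For large \<sigma> the density is small everywhere,
  and for small \<sigma> it is exponentially small near the origin, which stays at distance at least
  \<open>norm w / 2\<close> from the centre.\<close>

lemma negative_moment_start_nonzero:
  fixes w :: quat
  assumes w: "w \<noteq> 0" and p: "0 \<le> p" "p \<le> 3"
  obtains K where "0 \<le> K"
    "\<And>\<sigma>. 0 < \<sigma> \<Longrightarrow> (\<integral>\<^sup>+z. ennreal (norm (w + z) powr (- p)) \<partial>isotropic_normal \<sigma>) \<le> ennreal K"
proof -
  define d where "d = norm w / 2"
  define r where "r = min 1 d"
  \<comment> \<open>With \<open>u = d\<^sup>2 / (2 * \<sigma>\<^sup>2)\<close> the density near 0 is
    at most \<open>u\<^sup>2 * exp (- u) / (pi * d\<^sup>2)\<^sup>2\<close>, and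
    \<open>u\<^sup>2 * exp (- u) \<le> 2\<close> for all u > 0.\<close>
  define D where "D = 2 / (pi * d\<^sup>2)\<^sup>2"
  have d: "0 < d" using w by (simp add: d_def)
  have r: "0 < r" "r \<le> 1" "r \<le> d" using d by (auto simp: r_def)
  have fin: "ennreal (r powr (- p)) + ennreal D * inv_cube_mass < \<top>"
    using inv_cube_mass_finite by (simp add: ennreal_mult_less_top)
  have "(\<integral>\<^sup>+z. ennreal (norm (w + z) powr (- p)) \<partial>isotropic_normal \<sigma>) \<le> ennreal (r powr (- p)) + ennreal D * inv_cube_mass"
    if \<sigma>: "0 < \<sigma>" for \<sigma>
  proof (rule nn_integral_negative_moment_le[OF \<sigma> r(1,2) p])
    show "0 \<le> D" by (simp add: D_def)
    fix y :: quat assume y: "norm y < r"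
    have "norm w \<le> norm y + norm (y - w)"
      using norm_triangle_ineq4[of y "y - w"] by simp
    then have "d \<le> norm (y - w)" using y r by (simp add: d_def)
    then have sq: "d\<^sup>2 \<le> (norm (y - w))\<^sup>2" using d by (intro power_mono) auto
    define u where "u = d\<^sup>2 / (2 * \<sigma>\<^sup>2)"
    have u: "0 < u" using d \<sigma> by (simp add: u_def)
    have "exp (- (norm (y - w))\<^sup>2 / (2 * \<sigma>\<^sup>2)) \<le> exp (- u)"
      using sq \<sigma> by (simp add: u_def divide_right_mono)
    moreover have "(1 / sqrt (2 * pi * \<sigma>\<^sup>2)) ^ 4 = u\<^sup>2 / (pi * d\<^sup>2)\<^sup>2"
    proof -
      have "(sqrt (2 * pi * \<sigma>\<^sup>2)) ^ 4 = (2 * pi * \<sigma>\<^sup>2)\<^sup>2"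
        using power_mult[of "sqrt (2 * pi * \<sigma>\<^sup>2)" 2 2] by (simp del: real_sqrt_mult)
      then show ?thesis using d \<sigma> by (simp add: u_def power_divide power_mult_distrib field_simps)
    qed
    ultimately have "(1 / sqrt (2 * pi * \<sigma>\<^sup>2)) ^ 4 * exp (- (norm (y - w))\<^sup>2 / (2 * \<sigma>\<^sup>2)) \<le> u\<^sup>2 / (pi * d\<^sup>2)\<^sup>2 * exp (- u)"
      by (intro mult_mono) auto
    then have "isotropic_normal_density \<sigma> (y - w) \<le> u\<^sup>2 / (pi * d\<^sup>2)\<^sup>2 * exp (- u)"
      unfolding isotropic_normal_density_eq_exp[OF \<sigma>] by simp
    also have "\<dots> = (u\<^sup>2 * exp (- u)) / (pi * d\<^sup>2)\<^sup>2" by simp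
    also have "\<dots> \<le> D"
    proof -
      have "u\<^sup>2 / 2 \<le> exp u" using exp_lower_Taylor_quadratic[of u] u by simp
      then have "u\<^sup>2 * exp (- u) \<le> 2" by (simp add: exp_minus field_simps)
      then show ?thesis unfolding D_def by (rule divide_right_mono) simp
    qed
    finally show "isotropic_normal_density \<sigma> (y - w) \<le> D" .
  qed
  moreover obtain K where "0 \<le> K" "ennreal (r powr (- p)) + ennreal D * inv_cube_mass = ennreal K"
    using fin by (cases "ennreal (r powr (- p)) + ennreal D * inv_cube_mass") auto
  ultimately show ?thesis using that[of K] by simp
qed

text \<open>The factor a is what matters, as it tends to 0 later. For \<rho> \<ge> 1 convexity of
  exp gives \<open>\<rho> powr a \<le> a * \<rho> + (1 - a)\<close>; for \<rho> < 1 the deviation is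
  at most \<open>- a * ln \<rho>\<close>, hence at most a / \<rho>.\<close>

lemma abs_one_minus_powr_le:
  fixes a \<rho> :: real
  assumes a: "0 \<le> a" "a \<le> 1" and \<rho>: "0 < \<rho>"
  shows "\<bar>1 - \<rho> powr a\<bar> \<le> a * (\<rho> + \<rho> powr (-1))"
proof (cases "1 \<le> \<rho>")
  case True
  have "\<rho> powr a \<le> a * \<rho> + (1 - a) * 1"
  proof -
    have "exp (a * ln \<rho> + (1 - a) * 0) \<le> a * exp (ln \<rho>) + (1 - a) * exp 0"
      using a convex_onD[OF exp_convex, of a 0 "ln \<rho>"] by (simp add: algebra_simps)
    then show ?thesis using \<rho> by (simp add: powr_def)
  qed
  moreover have "1 \<le> \<rho> powr a" using True a by (simp add: ge_one_powr_ge_zero)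
  ultimately have "\<bar>1 - \<rho> powr a\<bar> \<le> a * \<rho>" using a by (simp add: algebra_simps)
  also have "\<dots> \<le> a * (\<rho> + \<rho> powr (-1))" using a by (intro mult_left_mono) auto
  finally show ?thesis .
next
  case False
  have "1 + a * ln \<rho> \<le> \<rho> powr a" using \<rho> exp_ge_add_one_self[of "a * ln \<rho>"] by (simp add: powr_def)
  moreover have "\<rho> powr a \<le> 1" using False \<rho> a by (intro powr_le1) auto
  ultimately have "\<bar>1 - \<rho> powr a\<bar> \<le> a * (- ln \<rho>)" by simp
  also have "- ln \<rho> = ln (inverse \<rho>)" using \<rho> by (simp add: ln_inverse)
  also have "\<dots> \<le> inverse \<rho>" using ln_le_minus_one[of "inverse \<rho>"] \<rho> by simp
  also have "inverse \<rho> \<le> \<rho> + \<rho> powr (-1)" using \<rho> by (simp add: powr_minus)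
  finally show ?thesis using a by (simp add: mult_left_mono)
qed

text \<open>Brownian scaling turns the starting point into \<open>w / sqrt T\<close>, whose norm is
  at most |w| for T \<ge> 1. First moments of the radius and of its inverse under the standard
  normal law are then bounded independently of T.\<close>

lemma radial_power_close_to_one:
  fixes w :: quat
  obtains K where "0 \<le> K" "\<And>T b. 1 \<le> T \<Longrightarrow> 0 \<le> b \<Longrightarrow> b \<le> 1 / 2 \<Longrightarrow>
    (\<integral>\<^sup>+z. ennreal \<bar>1 - (norm (w + z) / sqrt T) powr (2 * b)\<bar> \<partial>isotropic_normal (sqrt T)) \<le> ennreal (K * b)"
proof -
  interpret G: prob_space "isotropic_normal 1 :: quat measure" by (rule prob_space_isotropic_normal) simp
  have C: "integrable (isotropic_normal 1) (\<lambda>x::quat. norm x ^ 3)"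
    by (rule isotropic_normal_third_moment[where 'n=4]) simp
  define m1 where "m1 = (\<integral>\<^sup>+z. ennreal (norm w + (1 + norm (z :: quat) ^ 3)) \<partial>isotropic_normal 1)"
  have m1: "m1 < \<top>"
  proof -
    have "integrable (isotropic_normal 1) (\<lambda>z::quat. norm w + (1 + norm z ^ 3))" using C by simp
    then show ?thesis unfolding m1_def by (subst nn_integral_eq_integral) auto
  qed
  \<comment> \<open>The bracket is the negative moment bound with r = 1, p = 1 and D = 1; the
    standard normal density in dimension 4 never exceeds 1.\<close>
  define c where "c = m1 + (ennreal (1 powr (-1)) + ennreal 1 * inv_cube_mass)"
  have "c < \<top>" using m1 inv_cube_mass_finite by (simp add: c_def)
  then obtain K where K: "0 \<le> K" "c = ennreal K" by (cases c) auto
  show ?thesis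
  proof (rule that[of "2 * K"])
    fix T b :: real assume T: "1 \<le> T" and b: "0 \<le> b" "b \<le> 1 / 2"
    define v where "v = w /\<^sub>R sqrt T"
    have v: "norm v \<le> norm w" using T by (simp add: v_def mult_left_le_one_le inverse_le_1_iff)
    have sT: "0 < sqrt T" using T by simp
    \<comment> \<open>The point 0 must be excluded: there \<open>0 powr (-1) = 0\<close>, so the
      inequality for powers can fail.\<close>
    have AE0: "AE z in isotropic_normal 1. v + z \<noteq> 0"
    proof -
      have "AE z in lborel. z \<noteq> - v" by (rule AE_lborel_singleton)
      then show ?thesis unfolding isotropic_normal_def
        by (subst AE_density) (auto simp: add_eq_0_iff elim!: eventually_mono)
    qed
    have "(\<integral>\<^sup>+z. ennreal \<bar>1 - (norm (w + z) / sqrt T) powr (2 * b)\<bar> \<partial>isotropic_normal (sqrt T)) =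
      (\<integral>\<^sup>+z. ennreal \<bar>1 - norm (v + z) powr (2 * b)\<bar> \<partial>isotropic_normal 1)"
    proof -
      have "norm (w + sqrt T *\<^sub>R z) / sqrt T = norm (v + z)" for z
      proof -
        have "w + sqrt T *\<^sub>R z = sqrt T *\<^sub>R (v + z)" using sT by (simp add: v_def scaleR_add_right)
        then show ?thesis using sT T by simp
      qed
      then show ?thesis by (subst nn_integral_isotropic_normal_scale[OF sT]) simp_all
    qed
    also have "\<dots> \<le> (\<integral>\<^sup>+z. ennreal (2 * b) * (ennreal (norm w + (1 + norm z ^ 3)) + ennreal (norm (v + z) powr (-1))) \<partial>isotropic_normal 1)"
    proof (rule nn_integral_mono_AE, rule eventually_mono[OF AE0])
      fix z :: quat assume nz: "v + z \<noteq> 0"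
      have "norm z \<le> 1 + norm z ^ 3"
      proof (cases "norm z \<le> 1")
        case True
        moreover have "0 \<le> norm z ^ 3" by simp
        ultimately show ?thesis by linarith
      next
        case False
        then show ?thesis using power_increasing[of 1 3 "norm z"] by simp
      qed
      then have "norm (v + z) \<le> norm w + (1 + norm z ^ 3)" using norm_triangle_ineq[of v z] v by linarith
      then have "norm (v + z) + norm (v + z) powr (-1) \<le> (norm w + (1 + norm z ^ 3)) + norm (v + z) powr (-1)" by simp
      then have "\<bar>1 - norm (v + z) powr (2 * b)\<bar> \<le> 2 * b * ((norm w + (1 + norm z ^ 3)) + norm (v + z) powr (-1))"
        using order_trans[OF abs_one_minus_powr_le[of "2 * b" "norm (v + z)"] mult_left_mono] nz b by simp
      then have "ennreal \<bar>1 - norm (v + z) powr (2 * b)\<bar> \<le> ennreal (2 * b * ((norm w + (1 + norm z ^ 3)) + norm (v + z) powr (-1)))"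
        by (rule ennreal_leI)
      then show "ennreal \<bar>1 - norm (v + z) powr (2 * b)\<bar> \<le>
        ennreal (2 * b) * (ennreal (norm w + (1 + norm z ^ 3)) + ennreal (norm (v + z) powr (-1)))"
        using b by (simp add: ennreal_mult ennreal_plus[symmetric] del: ennreal_plus)
    qed
    also have "\<dots> = ennreal (2 * b) * (m1 + (\<integral>\<^sup>+z. ennreal (norm (v + z) powr (-1)) \<partial>isotropic_normal 1))"
      unfolding m1_def by (subst nn_integral_cmult) (auto simp: nn_integral_add simp del: ennreal_plus)
    also have "\<dots> \<le> ennreal (2 * b) * c"
    proof -
      have "(1 / sqrt (2 * pi * 1\<^sup>2)) ^ 4 \<le> (1::real)"
        using pi_gt3 by (intro power_le_one) (auto simp: real_le_rsqrt)
      then have "isotropic_normal_density 1 (y - v) \<le> 1" for y :: quat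
        using isotropic_normal_density_le[of 1 "y - v"] by simp
      then show ?thesis unfolding c_def
        by (intro mult_left_mono add_left_mono nn_integral_negative_moment_le) auto
    qed
    also have "\<dots> = ennreal (2 * K * b)" using K b by (simp add: ennreal_mult[symmetric] mult_ac)
    finally show "(\<integral>\<^sup>+z. ennreal \<bar>1 - (norm (w + z) / sqrt T) powr (2 * b)\<bar> \<partial>isotropic_normal (sqrt T)) \<le> ennreal (2 * K * b)" .
  qed (use K in simp)
qed

section \<open>Telescoping along a random walk\<close>

text \<open>Independence in the form that Fubini consumes, carried over from families of increments
  to functions of them.\<close>

lemma (in prob_space) indep_var_distr_pair:
  assumes ind: "indep_var S A T Y" and [measurable]: "f \<in> measurable S S'" "g \<in> measurable T T'"
  shows "distr M S' (\<lambda>\<omega>. f (A \<omega>)) \<Otimes>\<^sub>M distr M T' (\<lambda>\<omega>. g (Y \<omega>)) =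
    distr M (S' \<Otimes>\<^sub>M T') (\<lambda>\<omega>. (f (A \<omega>), g (Y \<omega>)))"
proof -
  have [measurable]: "A \<in> measurable M S" "Y \<in> measurable M T"
    using ind by (auto dest: indep_var_rv1 indep_var_rv2)
  have eq: "distr M S A \<Otimes>\<^sub>M distr M T Y = distr M (S \<Otimes>\<^sub>M T) (\<lambda>\<omega>. (A \<omega>, Y \<omega>))"
    using ind by (simp add: indep_var_distribution_eq)
  interpret Y: prob_space "distr M T' (\<lambda>\<omega>. g (Y \<omega>))" by (rule prob_space_distr) simp
  have "distr M S' (\<lambda>\<omega>. f (A \<omega>)) \<Otimes>\<^sub>M distr M T' (\<lambda>\<omega>. g (Y \<omega>)) =
    distr (distr M S A) S' f \<Otimes>\<^sub>M distr (distr M T Y) T' g"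
    by (simp add: distr_distr comp_def)
  also have "\<dots> = distr (distr M S A \<Otimes>\<^sub>M distr M T Y) (S' \<Otimes>\<^sub>M T') (\<lambda>(x, y). (f x, g y))"
    by (rule pair_measure_distr) (auto simp: distr_distr comp_def intro: Y.sigma_finite_measure_axioms)
  also have "\<dots> = distr M (S' \<Otimes>\<^sub>M T') (\<lambda>\<omega>. (f (A \<omega>), g (Y \<omega>)))"
    unfolding eq by (subst distr_distr) (auto simp: comp_def)
  finally show ?thesis .
qed

text \<open>Replaces conditioning on the past: A is frozen and the independent Y is integrated out,
  so a bound for each fixed past passes to the expectation.\<close>

lemma (in prob_space) indep_integral_diff_le:
  fixes G :: "'b \<times> 'c \<Rightarrow> complex" and F :: "'b \<Rightarrow> complex" and B :: "'b \<Rightarrow> real"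
  assumes [measurable]: "A \<in> measurable M S" "Y \<in> measurable M T"
    and eq: "distr M S A \<Otimes>\<^sub>M distr M T Y = distr M (S \<Otimes>\<^sub>M T) (\<lambda>\<omega>. (A \<omega>, Y \<omega>))"
    and [measurable]: "G \<in> borel_measurable (S \<Otimes>\<^sub>M T)" "F \<in> borel_measurable S" "B \<in> borel_measurable S"
    and G: "integrable M (\<lambda>\<omega>. G (A \<omega>, Y \<omega>))" and F: "integrable M (\<lambda>\<omega>. F (A \<omega>))" and B: "integrable M (\<lambda>\<omega>. B (A \<omega>))"
    and le: "AE \<omega> in M. norm ((\<integral>y. G (A \<omega>, y) \<partial>distr M T Y) - F (A \<omega>)) \<le> B (A \<omega>)"
  shows "norm ((\<integral>\<omega>. G (A \<omega>, Y \<omega>) \<partial>M) - (\<integral>\<omega>. F (A \<omega>) \<partial>M)) \<le> (\<integral>\<omega>. B (A \<omega>) \<partial>M)"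
proof -
  interpret X: prob_space "distr M S A" by (rule prob_space_distr) simp
  interpret Y: prob_space "distr M T Y" by (rule prob_space_distr) simp
  interpret XY: pair_prob_space "distr M S A" "distr M T Y" ..
  define H where "H x = (\<integral>y. G (x, y) \<partial>distr M T Y)" for x
  have GI: "integrable (distr M S A \<Otimes>\<^sub>M distr M T Y) G"
    unfolding eq using G by (subst integrable_distr_eq) auto
  have [measurable]: "H \<in> borel_measurable S" unfolding H_def[abs_def] by measurable
  have HI: "integrable M (\<lambda>\<omega>. H (A \<omega>))"
    using XY.integrable_fst'[OF GI] unfolding H_def[symmetric] by (subst (asm) integrable_distr_eq) auto
  have "(\<integral>\<omega>. G (A \<omega>, Y \<omega>) \<partial>M) = (\<integral>p. G p \<partial>distr M (S \<Otimes>\<^sub>M T) (\<lambda>\<omega>. (A \<omega>, Y \<omega>)))"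
    by (subst integral_distr) auto
  also have "\<dots> = (\<integral>x. H x \<partial>distr M S A)"
    unfolding eq[symmetric] H_def using XY.integral_fst'[OF GI] by simp
  also have "\<dots> = (\<integral>\<omega>. H (A \<omega>) \<partial>M)" by (subst integral_distr) auto
  finally have "(\<integral>\<omega>. G (A \<omega>, Y \<omega>) \<partial>M) - (\<integral>\<omega>. F (A \<omega>) \<partial>M) = (\<integral>\<omega>. H (A \<omega>) - F (A \<omega>) \<partial>M)"
    using HI F by simp
  also have "norm \<dots> \<le> (\<integral>\<omega>. B (A \<omega>) \<partial>M)"
    using HI F B le by (intro integral_norm_bound_AE) (auto simp: H_def)
  finally show ?thesis .
qed

text \<open>The past enters through the current position and the accumulated sum. The sum
  contributes only a phase of modulus 1, so the one-step error is merely averaged over the law of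
  the position.\<close>

lemma (in prob_space) random_walk_step:
  fixes Y :: "nat \<Rightarrow> 'a \<Rightarrow> quat" and w :: quat and \<xi> :: "real^3" and b \<sigma> :: real and n :: nat
  defines "X k \<omega> \<equiv> w + (\<Sum>j<k. Y j \<omega>)"
    and "S k \<omega> \<equiv> (\<Sum>j<k. stratonovich_increment (w + (\<Sum>i<j. Y i \<omega>)) (Y j \<omega>))"
  assumes ind: "indep_vars (\<lambda>_. borel) Y {..<n}" and k: "k < n"
    and \<sigma>: "0 < \<sigma>" and law: "distr M borel (Y k) = isotropic_normal \<sigma>"
    and step: "\<And>x. x \<noteq> 0 \<Longrightarrow>
      norm ((\<integral>y. exp (\<i> * of_real (\<xi> \<bullet> stratonovich_increment x y)) * of_real (norm (x + y) powr (2 * b)) \<partial>isotropic_normal \<sigma>)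
        - of_real (norm x powr (2 * b))) \<le> C * norm x powr (2 * b - 3)"
    and int: "integrable M (\<lambda>\<omega>. norm (X k \<omega>) powr (2 * b))" "integrable M (\<lambda>\<omega>. norm (X (Suc k) \<omega>) powr (2 * b))"
      "integrable M (\<lambda>\<omega>. norm (X k \<omega>) powr (2 * b - 3))"
    and nz: "AE \<omega> in M. X k \<omega> \<noteq> 0"
  shows "norm ((\<integral>\<omega>. exp (\<i> * of_real (\<xi> \<bullet> S (Suc k) \<omega>)) * of_real (norm (X (Suc k) \<omega>) powr (2 * b)) \<partial>M) -
      (\<integral>\<omega>. exp (\<i> * of_real (\<xi> \<bullet> S k \<omega>)) * of_real (norm (X k \<omega>) powr (2 * b)) \<partial>M))
    \<le> C * (\<integral>\<omega>. norm (X k \<omega>) powr (2 * b - 3) \<partial>M)"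
proof -
  define A where "A \<omega> = (X k \<omega>, S k \<omega>)" for \<omega>
  define G where "G p = exp (\<i> * of_real (\<xi> \<bullet> snd (fst p))) *
    (exp (\<i> * of_real (\<xi> \<bullet> stratonovich_increment (fst (fst p)) (snd p))) * of_real (norm (fst (fst p) + snd p) powr (2 * b)))"
    for p :: "(quat \<times> (real^3)) \<times> quat"
  define F where "F p = exp (\<i> * of_real (\<xi> \<bullet> snd p)) * of_real (norm (fst p) powr (2 * b))" for p :: "quat \<times> (real^3)"
  define B where "B p = C * norm (fst p) powr (2 * b - 3)" for p :: "quat \<times> (real^3)"
  have rv [measurable]: "Y j \<in> borel_measurable M" if "j < n" for j
    using ind that by (auto simp: indep_vars_def)
  \<comment> \<open>Rebuilds the past from the first \<open>k\<close> increments, which as a family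
    are independent of increment \<open>k\<close>.\<close>
  define \<phi> where "\<phi> f = (w + (\<Sum>j<k. f j), \<Sum>j<k. stratonovich_increment (w + (\<Sum>i<j. f i)) (f j))" for f :: "nat \<Rightarrow> quat"
  have [measurable]: "\<phi> \<in> measurable (PiM {..<k} (\<lambda>_. borel)) (borel \<Otimes>\<^sub>M borel)"
    unfolding \<phi>_def[abs_def]
    by (intro measurable_Pair borel_measurable_add borel_measurable_const borel_measurable_sum stratonovich_increment_measurable measurable_component_singleton) auto
  have ind': "indep_var (PiM {..<k} (\<lambda>_. borel)) (\<lambda>\<omega>. restrict (\<lambda>i. Y i \<omega>) {..<k}) (PiM {k} (\<lambda>_. borel)) (\<lambda>\<omega>. restrict (\<lambda>i. Y i \<omega>) {k})"
    using k by (intro indep_var_restrict[OF ind]) auto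
  have eq: "distr M (borel \<Otimes>\<^sub>M borel) A \<Otimes>\<^sub>M distr M borel (Y k) = distr M ((borel \<Otimes>\<^sub>M borel) \<Otimes>\<^sub>M borel) (\<lambda>\<omega>. (A \<omega>, Y k \<omega>))"
  proof -
    have "(\<lambda>\<omega>. \<phi> (restrict (\<lambda>i. Y i \<omega>) {..<k})) = A"
      by (auto simp: fun_eq_iff \<phi>_def A_def X_def S_def intro!: sum.cong arg_cong2[where f=stratonovich_increment])
    with indep_var_distr_pair[OF ind', of \<phi> "borel \<Otimes>\<^sub>M borel" "\<lambda>f. f k" borel] show ?thesis
      by (simp add: fun_eq_iff)
  qed
  have [measurable]: "A \<in> measurable M (borel \<Otimes>\<^sub>M borel)"
    unfolding A_def[abs_def] X_def S_def using k
    by (intro measurable_Pair borel_measurable_add borel_measurable_const borel_measurable_sum stratonovich_increment_measurable rv) auto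
  have [measurable]: "G \<in> borel_measurable ((borel \<Otimes>\<^sub>M borel) \<Otimes>\<^sub>M borel)" unfolding G_def[abs_def] by measurable
  have [measurable]: "F \<in> borel_measurable (borel \<Otimes>\<^sub>M borel)" unfolding F_def[abs_def] by measurable
  have [measurable]: "B \<in> borel_measurable (borel \<Otimes>\<^sub>M borel)" unfolding B_def[abs_def] by measurable
  have GA: "G (A \<omega>, Y k \<omega>) = exp (\<i> * of_real (\<xi> \<bullet> S (Suc k) \<omega>)) * of_real (norm (X (Suc k) \<omega>) powr (2 * b))" for \<omega>
    by (simp add: G_def A_def X_def S_def add.assoc inner_add_right exp_add[symmetric] distrib_left mult.assoc[symmetric])
  have GI: "integrable M (\<lambda>\<omega>. G (A \<omega>, Y k \<omega>))"
  proof (rule Bochner_Integration.integrable_bound[OF int(2)])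
    show "(\<lambda>\<omega>. G (A \<omega>, Y k \<omega>)) \<in> borel_measurable M" using k by measurable
  qed (simp add: GA norm_mult)
  have FI: "integrable M (\<lambda>\<omega>. F (A \<omega>))"
    by (rule Bochner_Integration.integrable_bound[OF int(1)]) (measurable, simp add: F_def A_def norm_mult)
  have "norm ((\<integral>\<omega>. G (A \<omega>, Y k \<omega>) \<partial>M) - (\<integral>\<omega>. F (A \<omega>) \<partial>M)) \<le> (\<integral>\<omega>. B (A \<omega>) \<partial>M)"
  proof (rule indep_integral_diff_le[OF _ _ eq _ _ _ GI FI])
    show "integrable M (\<lambda>\<omega>. B (A \<omega>))" using int(3) by (simp add: B_def A_def)
    show "AE \<omega> in M. norm ((\<integral>y. G (A \<omega>, y) \<partial>distr M borel (Y k)) - F (A \<omega>)) \<le> B (A \<omega>)"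
      using nz
    proof eventually_elim
      case (elim \<omega>)
      have "(\<integral>y. G (A \<omega>, y) \<partial>distr M borel (Y k)) - F (A \<omega>) = exp (\<i> * of_real (\<xi> \<bullet> S k \<omega>)) *
         ((\<integral>y. exp (\<i> * of_real (\<xi> \<bullet> stratonovich_increment (X k \<omega>) y)) * of_real (norm (X k \<omega> + y) powr (2 * b)) \<partial>isotropic_normal \<sigma>)
          - of_real (norm (X k \<omega>) powr (2 * b)))"
        unfolding law G_def F_def A_def fst_conv snd_conv right_diff_distrib by simp
      then show ?case using step[OF elim] by (simp add: norm_mult B_def A_def)
    qed
  qed (use k in auto)
  then show ?thesis by (simp only: GA) (simp add: F_def B_def A_def)
qed

text \<open>K bounds the negative moment for every variance, hence at every time of the walk, so
  each step costs at most \<open>C * K\<close> and the costs add up by the triangle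
  inequality.\<close>

lemma (in prob_space) random_walk_winding_char:
  fixes Y :: "nat \<Rightarrow> 'a \<Rightarrow> quat" and w :: quat and \<xi> :: "real^3" and b \<sigma> :: real and n :: nat
  defines "X k \<omega> \<equiv> w + (\<Sum>j<k. Y j \<omega>)"
    and "S k \<omega> \<equiv> (\<Sum>j<k. stratonovich_increment (w + (\<Sum>i<j. Y i \<omega>)) (Y j \<omega>))"
  assumes w: "w \<noteq> 0" and b: "0 \<le> b" "b \<le> 1"
    and ind: "indep_vars (\<lambda>_. borel) Y {..<n}"
    and \<sigma>: "0 < \<sigma>" and law: "\<And>k. k < n \<Longrightarrow> distr M borel (Y k) = isotropic_normal \<sigma>"
    and sum_law: "\<And>k. 0 < k \<Longrightarrow> k \<le> n \<Longrightarrow> distr M borel (\<lambda>\<omega>. \<Sum>j<k. Y j \<omega>) = isotropic_normal (sqrt k * \<sigma>)"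
    and C: "0 \<le> C" and step: "\<And>x. x \<noteq> 0 \<Longrightarrow>
      norm ((\<integral>y. exp (\<i> * of_real (\<xi> \<bullet> stratonovich_increment x y)) * of_real (norm (x + y) powr (2 * b)) \<partial>isotropic_normal \<sigma>)
        - of_real (norm x powr (2 * b))) \<le> C * norm x powr (2 * b - 3)"
    and K: "0 \<le> K" "norm w powr (2 * b - 3) \<le> K"
      "\<And>\<sigma>. 0 < \<sigma> \<Longrightarrow> (\<integral>\<^sup>+z. ennreal (norm (w + z) powr (2 * b - 3)) \<partial>isotropic_normal \<sigma>) \<le> ennreal K"
  shows "norm ((\<integral>\<omega>. exp (\<i> * of_real (\<xi> \<bullet> S n \<omega>)) * of_real (norm (X n \<omega>) powr (2 * b)) \<partial>M) - of_real (norm w powr (2 * b)))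
    \<le> real n * (C * K)"
proof -
  have rv: "Y j \<in> borel_measurable M" if "j < n" for j
    using ind that by (auto simp: indep_vars_def)
  have sum_rv: "(\<lambda>\<omega>. \<Sum>j<k. Y j \<omega>) \<in> borel_measurable M" if "k \<le> n" for k
    using that by (intro borel_measurable_sum rv) auto
  have facts: "integrable M (\<lambda>\<omega>. norm (X k \<omega>) powr (2 * b))" "integrable M (\<lambda>\<omega>. norm (X k \<omega>) powr (2 * b - 3))"
    "(\<integral>\<omega>. norm (X k \<omega>) powr (2 * b - 3) \<partial>M) \<le> K" "AE \<omega> in M. X k \<omega> \<noteq> 0" if "k \<le> n" for k
  proof -
    have "integrable M (\<lambda>\<omega>. norm (X k \<omega>) powr (2 * b)) \<and> integrable M (\<lambda>\<omega>. norm (X k \<omega>) powr (2 * b - 3)) \<and>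
      (\<integral>\<omega>. norm (X k \<omega>) powr (2 * b - 3) \<partial>M) \<le> K \<and> (AE \<omega> in M. X k \<omega> \<noteq> 0)"
    \<comment> \<open>At time 0 the position is the constant \<open>w\<close>, which is no normal
      law with positive \<sigma>; this is why the value at \<open>w\<close> is bounded by K in a
      hypothesis of its own.\<close>
    proof (cases "k = 0")
      case True
      then show ?thesis using w K(2) by (simp add: X_def prob_space)
    next
      case False
      define s where "s = sqrt k * \<sigma>"
      have s: "0 < s" using False \<sigma> by (simp add: s_def)
      have D: "distr M borel (\<lambda>\<omega>. \<Sum>j<k. Y j \<omega>) = isotropic_normal s"
        using sum_law[of k] False that by (simp add: s_def)
      note [measurable] = sum_rv[OF that]
      interpret I: prob_space "isotropic_normal s :: quat measure" by (rule prob_space_isotropic_normal[OF s])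
      have i2: "integrable (isotropic_normal s) (\<lambda>z. norm (w + z) powr (2 * b))"
      proof (rule Bochner_Integration.integrable_bound)
        show "integrable (isotropic_normal s) (\<lambda>z. 1 + ((norm w)\<^sup>2 + 2 * (w \<bullet> z) + (norm z)\<^sup>2))"
          by (intro Bochner_Integration.integrable_add I.integrable_const integrable_mult_right
              isotropic_normal_integrable_norm_square[OF s] isotropic_normal_integrable_inner[OF s])
        show "AE z in isotropic_normal s. norm (norm (w + z) powr (2 * b)) \<le> norm (1 + ((norm w)\<^sup>2 + 2 * (w \<bullet> z) + (norm z)\<^sup>2))"
        proof (rule AE_I2)
          fix z
          have "(norm w)\<^sup>2 + 2 * (w \<bullet> z) + (norm z)\<^sup>2 = (norm (w + z))\<^sup>2"
            by (simp add: power2_norm_eq_inner inner_add_left inner_add_right inner_commute)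
          then show "norm (norm (w + z) powr (2 * b)) \<le> norm (1 + ((norm w)\<^sup>2 + 2 * (w \<bullet> z) + (norm z)\<^sup>2))"
            using norm_powr_le_one_plus_square[OF b, of "w + z"] by simp
        qed
      qed measurable
      have i3: "integrable (isotropic_normal s) (\<lambda>z. norm (w + z) powr (2 * b - 3))"
        using K(3)[OF s] by (intro integrableI_bounded) (auto intro: le_less_trans)
      have le: "(\<integral>z. norm (w + z) powr (2 * b - 3) \<partial>isotropic_normal s) \<le> K"
        using K(1) K(3)[OF s] by (simp add: nn_integral_eq_integral[OF i3])
      have nz: "AE z in isotropic_normal s. w + z \<noteq> 0"
      proof -
        have "AE z in lborel. z \<noteq> - w" by (rule AE_lborel_singleton)
        then show ?thesis unfolding isotropic_normal_def
          by (subst AE_density) (auto simp: add_eq_0_iff elim!: eventually_mono)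
      qed
      have "integrable M (\<lambda>\<omega>. norm (X k \<omega>) powr (2 * b))"
        using integrable_distr[OF sum_rv[OF that] i2[folded D]] by (simp add: X_def)
      moreover have "integrable M (\<lambda>\<omega>. norm (X k \<omega>) powr (2 * b - 3))"
        using integrable_distr[OF sum_rv[OF that] i3[folded D]] by (simp add: X_def)
      moreover have "(\<integral>\<omega>. norm (X k \<omega>) powr (2 * b - 3) \<partial>M) \<le> K"
      proof -
        have "(\<integral>z. norm (w + z) powr (2 * b - 3) \<partial>distr M borel (\<lambda>\<omega>. \<Sum>j<k. Y j \<omega>)) = (\<integral>\<omega>. norm (X k \<omega>) powr (2 * b - 3) \<partial>M)"
          unfolding X_def by (rule integral_distr) (rule sum_rv[OF that], measurable)
        with le show ?thesis by (simp only: D)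
      qed
      moreover have "AE \<omega> in M. X k \<omega> \<noteq> 0"
        using nz unfolding D[symmetric] X_def by (subst (asm) AE_distr_iff) (auto intro: sum_rv[OF that])
      ultimately show ?thesis by blast
    qed
    then show "integrable M (\<lambda>\<omega>. norm (X k \<omega>) powr (2 * b))" "integrable M (\<lambda>\<omega>. norm (X k \<omega>) powr (2 * b - 3))"
      "(\<integral>\<omega>. norm (X k \<omega>) powr (2 * b - 3) \<partial>M) \<le> K" "AE \<omega> in M. X k \<omega> \<noteq> 0" by auto
  qed
  define E where "E k = (\<integral>\<omega>. exp (\<i> * of_real (\<xi> \<bullet> S k \<omega>)) * of_real (norm (X k \<omega>) powr (2 * b)) \<partial>M)" for k
  have step: "norm (E (Suc k) - E k) \<le> C * K" if k: "k < n" for k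
  proof -
    have "norm (E (Suc k) - E k) \<le> C * (\<integral>\<omega>. norm (X k \<omega>) powr (2 * b - 3) \<partial>M)"
      unfolding E_def X_def S_def
      using k facts[of k] facts[of "Suc k"]
      by (intro random_walk_step[OF ind k \<sigma> law[OF k] step]) (simp_all add: X_def)
    also have "\<dots> \<le> C * K" using facts(3)[of k] k C by (intro mult_left_mono) auto
    finally show ?thesis .
  qed
  have "norm (E k - E 0) \<le> real k * (C * K)" if "k \<le> n" for k
    using that
  proof (induction k)
    case (Suc k)
    then have "norm (E (Suc k) - E 0) \<le> norm (E (Suc k) - E k) + norm (E k - E 0)"
      using norm_triangle_ineq[of "E (Suc k) - E k" "E k - E 0"] by simp
    also have "\<dots> \<le> C * K + real k * (C * K)" using Suc step[of k] by (intro add_mono) auto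
    finally show ?case by (simp add: algebra_simps)
  qed simp
  from this[of n] show ?thesis
    by (simp add: E_def X_def S_def prob_space)
qed

section \<open>Characteristic function of the winding process\<close>

lemma standard_brownian_motion_increment_law:
  assumes "standard_brownian_motion M W w" "0 \<le> s" "s < t"
  shows "distr M borel (\<lambda>\<omega>. W t \<omega> - W s \<omega>) = isotropic_normal (sqrt (t - s))"
proof -
  have "distributed M lborel (\<lambda>\<omega>. W t \<omega> - W s \<omega>) (\<lambda>x. ennreal (isotropic_normal_density (sqrt (t - s)) x))"
    using assms by (auto simp: standard_brownian_motion_def)
  from distributed_distr_eq_density[OF this]
  have "distr M lborel (\<lambda>\<omega>. W t \<omega> - W s \<omega>) = isotropic_normal (sqrt (t - s))"
    by (simp add: isotropic_normal_def)
  moreover have "distr M lborel (\<lambda>\<omega>. W t \<omega> - W s \<omega>) = distr M borel (\<lambda>\<omega>. W t \<omega> - W s \<omega>)"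
    by (rule distr_cong) auto
  ultimately show ?thesis by simp
qed

lemma stratonovich_sum_winding_form:
  "stratonovich_sum winding_form W n \<tau> \<omega> =
    (\<Sum>k<n. stratonovich_increment (W (\<tau> k) \<omega>) (W (\<tau> (Suc k)) \<omega> - W (\<tau> k) \<omega>))"
  by (simp add: stratonovich_sum_def stratonovich_increment_def)

lemma stratonovich_sum_winding_form_measurable:
  assumes "\<And>k. k \<le> n \<Longrightarrow> W (\<tau> k) \<in> borel_measurable M"
  shows "stratonovich_sum winding_form W n \<tau> \<in> borel_measurable M"
  unfolding stratonovich_sum_winding_form[abs_def]
  using assms by (intro borel_measurable_sum stratonovich_increment_measurable borel_measurable_diff) auto

text \<open>n steps of standard deviation \<open>sqrt (T / n)\<close> cost a multiple of
  \<open>n * (T / n) powr (3/2)\<close>. The constant depends on T, which is harmless since n grows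
  with T fixed.\<close>

lemma stratonovich_sum_char:
  fixes \<xi> :: "real^3" and w :: quat
  assumes w: "w \<noteq> 0" and bm: "standard_brownian_motion M W w" and T: "0 < T"
    and b: "0 \<le> b" "b \<le> 1" "4 * b * (b + 1) = (norm \<xi>)\<^sup>2"
  obtains C where
    "\<And>n. 0 < n \<Longrightarrow> norm ((\<integral>\<omega>. exp (\<i> * of_real (\<xi> \<bullet> stratonovich_sum winding_form W n (\<lambda>k. real k * (T / real n)) \<omega>)) *
        of_real (norm (w + (W T \<omega> - W 0 \<omega>)) powr (2 * b)) \<partial>M) - of_real (norm w powr (2 * b))) \<le> C / sqrt (real n)"
proof -
  interpret prob_space M using bm by (simp add: standard_brownian_motion_def)
  have W: "W t \<in> borel_measurable M" if "0 \<le> t" for t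
    using bm that by (auto simp: standard_brownian_motion_def)
  have W0: "AE \<omega> in M. W 0 \<omega> = w" using bm by (simp add: standard_brownian_motion_def)
  obtain C where C: "0 \<le> C" "\<And>X h. X \<noteq> 0 \<Longrightarrow> 0 < h \<Longrightarrow>
      norm ((\<integral>Y. exp (\<i> * of_real (\<xi> \<bullet> stratonovich_increment X Y)) * of_real (norm (X + Y) powr (2 * b)) \<partial>isotropic_normal h)
        - of_real (norm X powr (2 * b))) \<le> C * h ^ 3 * norm X powr (2 * b - 3)"
    by (rule stratonovich_increment_expectation[OF b]) blast
  have "0 \<le> 3 - 2 * b" "3 - 2 * b \<le> 3" using b by auto
  then obtain K0 where K0: "0 \<le> K0"
    "\<And>\<sigma>. 0 < \<sigma> \<Longrightarrow> (\<integral>\<^sup>+z. ennreal (norm (w + z) powr (- (3 - 2 * b))) \<partial>isotropic_normal \<sigma>) \<le> ennreal K0"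
    by (rule negative_moment_start_nonzero[OF w]) blast
  define K where "K = max K0 (norm w powr (2 * b - 3))"
  have K: "0 \<le> K" "norm w powr (2 * b - 3) \<le> K"
      "\<And>\<sigma>. 0 < \<sigma> \<Longrightarrow> (\<integral>\<^sup>+z. ennreal (norm (w + z) powr (2 * b - 3)) \<partial>isotropic_normal \<sigma>) \<le> ennreal K"
  proof -
    show "0 \<le> K" "norm w powr (2 * b - 3) \<le> K" using K0(1) by (auto simp: K_def)
    fix \<sigma> :: real assume "0 < \<sigma>"
    from order_trans[OF K0(2)[OF this] ennreal_leI[of K0 K]]
    show "(\<integral>\<^sup>+z. ennreal (norm (w + z) powr (2 * b - 3)) \<partial>isotropic_normal \<sigma>) \<le> ennreal K"
      by (simp add: K_def)
  qed
  show ?thesis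
  proof (rule that[of "C * sqrt T ^ 3 * K"])
    fix n :: nat assume n: "0 < n"
    define \<tau> where "\<tau> k = real k * (T / real n)" for k :: nat
    define Y where "Y k \<omega> = W (\<tau> (Suc k)) \<omega> - W (\<tau> k) \<omega>" for k \<omega>
    define \<sigma> where "\<sigma> = sqrt (T / n)"
    have \<sigma>: "0 < \<sigma>" using T n by (simp add: \<sigma>_def)
    have \<tau>: "0 \<le> \<tau> k" "\<tau> k < \<tau> (Suc k)" "\<tau> 0 = 0" "\<tau> n = T" "\<tau> (Suc k) - \<tau> k = T / n" for k
      using T n by (auto simp: \<tau>_def field_simps)
    have ind: "indep_vars (\<lambda>_. borel) Y {..<n}"
    proof -
      have "\<forall>n (\<tau> :: nat \<Rightarrow> real). 0 \<le> \<tau> 0 \<longrightarrow> (\<forall>k<n. \<tau> k \<le> \<tau> (Suc k)) \<longrightarrow>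
        indep_vars (\<lambda>_. borel) (\<lambda>k \<omega>. W (\<tau> (Suc k)) \<omega> - W (\<tau> k) \<omega>) {..<n}"
        using bm unfolding standard_brownian_motion_def by blast
      then have "indep_vars (\<lambda>_. borel) (\<lambda>k \<omega>. W (\<tau> (Suc k)) \<omega> - W (\<tau> k) \<omega>) {..<n}"
        using \<tau> by (simp add: less_imp_le)
      then show ?thesis by (simp add: Y_def[abs_def])
    qed
    have law: "distr M borel (Y k) = isotropic_normal \<sigma>" for k
      unfolding Y_def[abs_def] \<sigma>_def
      using standard_brownian_motion_increment_law[OF bm, of "\<tau> k" "\<tau> (Suc k)"] \<tau> by simp
    have sumY: "(\<Sum>j<k. Y j \<omega>) = W (\<tau> k) \<omega> - W 0 \<omega>" for k \<omega>
      unfolding Y_def using sum_lessThan_telescope[of "\<lambda>j. W (\<tau> j) \<omega>" k] \<tau>(3) by simp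
    have sum_law: "distr M borel (\<lambda>\<omega>. \<Sum>j<k. Y j \<omega>) = isotropic_normal (sqrt k * \<sigma>)" if "0 < k" for k
    proof -
      have "0 < \<tau> k" using that T n by (simp add: \<tau>_def)
      moreover have "sqrt k * \<sigma> = sqrt (\<tau> k - 0)" unfolding \<sigma>_def \<tau>_def real_sqrt_mult[symmetric] by simp
      ultimately show ?thesis
        unfolding sumY using standard_brownian_motion_increment_law[OF bm, of 0 "\<tau> k"] by simp
    qed
    define S where "S \<omega> = (\<Sum>j<n. stratonovich_increment (w + (\<Sum>i<j. Y i \<omega>)) (Y j \<omega>))" for \<omega>
    \<comment> \<open>\<open>W 0 = w\<close> holds only almost surely, so the walk started at
      \<open>w\<close> reproduces the Stratonovich sum outside a null set.\<close>
    have S: "AE \<omega> in M. stratonovich_sum winding_form W n \<tau> \<omega> = S \<omega>"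
      using W0
    proof eventually_elim
      case (elim \<omega>)
      have "w + (\<Sum>i<j. Y i \<omega>) = W (\<tau> j) \<omega>" for j unfolding sumY using elim by simp
      then show ?case unfolding S_def stratonovich_sum_winding_form by (simp add: Y_def)
    qed
    have Sm [measurable]: "stratonovich_sum winding_form W n \<tau> \<in> borel_measurable M"
      by (intro stratonovich_sum_winding_form_measurable W \<tau>)
    have Ym [measurable]: "Y k \<in> borel_measurable M" for k
      unfolding Y_def[abs_def] using W \<tau> by simp
    have [measurable]: "S \<in> borel_measurable M" unfolding S_def[abs_def] by measurable
    note [measurable] = W[OF order_refl] W[OF less_imp_le[OF T]]
    have "norm ((\<integral>\<omega>. exp (\<i> * of_real (\<xi> \<bullet> S \<omega>)) * of_real (norm (w + (\<Sum>j<n. Y j \<omega>)) powr (2 * b)) \<partial>M) - of_real (norm w powr (2 * b)))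
      \<le> real n * (C * \<sigma> ^ 3 * K)"
      unfolding S_def
      by (rule random_walk_winding_char[OF w b(1,2) ind \<sigma> law sum_law _ C(2)[OF _ \<sigma>] K])
         (use C(1) \<sigma> in auto)
    also have "(\<integral>\<omega>. exp (\<i> * of_real (\<xi> \<bullet> S \<omega>)) * of_real (norm (w + (\<Sum>j<n. Y j \<omega>)) powr (2 * b)) \<partial>M) =
      (\<integral>\<omega>. exp (\<i> * of_real (\<xi> \<bullet> stratonovich_sum winding_form W n \<tau> \<omega>)) * of_real (norm (w + (W T \<omega> - W 0 \<omega>)) powr (2 * b)) \<partial>M)"
      unfolding sumY \<tau>(4)
    proof (rule integral_cong_AE)
      show "AE \<omega> in M. exp (\<i> * of_real (\<xi> \<bullet> S \<omega>)) * of_real (norm (w + (W T \<omega> - W 0 \<omega>)) powr (2 * b)) =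
        exp (\<i> * of_real (\<xi> \<bullet> stratonovich_sum winding_form W n \<tau> \<omega>)) * of_real (norm (w + (W T \<omega> - W 0 \<omega>)) powr (2 * b))"
        using S by eventually_elim simp
    qed measurable
    also have "real n * (C * \<sigma> ^ 3 * K) = C * sqrt T ^ 3 * K / sqrt (real n)"
    proof -
      have "real n = sqrt n * sqrt n" by simp
      then have "real n * \<sigma> ^ 3 = sqrt T ^ 3 / sqrt n"
        using n unfolding \<sigma>_def real_sqrt_divide power_divide power3_eq_cube by (simp add: field_simps)
      then show ?thesis by (metis (no_types, opaque_lifting) mult.assoc mult.commute times_divide_eq_left)
    qed
    finally show "norm ((\<integral>\<omega>. exp (\<i> * of_real (\<xi> \<bullet> stratonovich_sum winding_form W n (\<lambda>k. real k * (T / real n)) \<omega>)) *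
        of_real (norm (w + (W T \<omega> - W 0 \<omega>)) powr (2 * b)) \<partial>M) - of_real (norm w powr (2 * b))) \<le> C * sqrt T ^ 3 * K / sqrt (real n)"
      by (simp only: \<tau>_def[abs_def])
  qed
qed

section \<open>From the sums to the winding process\<close>

lemma norm_iexp_diff_le:
  "norm (exp (\<i> * of_real x) - exp (\<i> * of_real y)) \<le> \<bar>x - y\<bar>"
  "norm (exp (\<i> * of_real x) - exp (\<i> * of_real y)) \<le> 2"
proof -
  have "exp (\<i> * of_real x) - exp (\<i> * of_real y) = exp (\<i> * of_real y) * (exp (\<i> * of_real (x - y)) - 1)"
    by (simp add: right_diff_distrib exp_add[symmetric] distrib_left[symmetric])
  then show "norm (exp (\<i> * of_real x) - exp (\<i> * of_real y)) \<le> \<bar>x - y\<bar>"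
    using iexp_approx1[of "x - y" 0] by (simp add: norm_mult)
  show "norm (exp (\<i> * of_real x) - exp (\<i> * of_real y)) \<le> 2"
    using norm_triangle_ineq4[of "exp (\<i> * of_real x)" "exp (\<i> * of_real y)"] by simp
qed

text \<open>Off the exceptional event the exponential is Lipschitz with constant |\<xi>|; on it, two
  unit complex numbers differ by at most 2.\<close>

lemma (in prob_space) char_diff_le_dist:
  fixes S Z :: "'a \<Rightarrow> real^'n::finite"
  assumes [measurable]: "S \<in> borel_measurable M" "Z \<in> borel_measurable M"
    and \<epsilon>: "0 \<le> \<epsilon>" and prob: "prob {\<omega> \<in> space M. dist (S \<omega>) (Z \<omega>) > \<epsilon>} \<le> p"
  shows "norm ((\<integral>\<omega>. exp (\<i> * of_real (\<xi> \<bullet> Z \<omega>)) \<partial>M) - (\<integral>\<omega>. exp (\<i> * of_real (\<xi> \<bullet> S \<omega>)) \<partial>M)) \<le> norm \<xi> * \<epsilon> + 2 * p"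
proof -
  define A where "A = {\<omega> \<in> space M. dist (S \<omega>) (Z \<omega>) > \<epsilon>}"
  have [measurable]: "A \<in> sets M" unfolding A_def by measurable
  have I: "integrable M (\<lambda>\<omega>. exp (\<i> * of_real (\<xi> \<bullet> Z \<omega>)))" "integrable M (\<lambda>\<omega>. exp (\<i> * of_real (\<xi> \<bullet> S \<omega>)))"
    by (rule integrable_const_bound[where B=1]; simp)+
  have IA: "integrable M (\<lambda>\<omega>. norm \<xi> * \<epsilon> + 2 * indicator A \<omega> :: real)"
    by (rule integrable_const_bound[where B="norm \<xi> * \<epsilon> + 2"]) (use \<epsilon> in \<open>auto simp: indicator_def\<close>)
  have "norm (\<integral>\<omega>. exp (\<i> * of_real (\<xi> \<bullet> Z \<omega>)) - exp (\<i> * of_real (\<xi> \<bullet> S \<omega>)) \<partial>M) \<le> (\<integral>\<omega>. norm \<xi> * \<epsilon> + 2 * indicator A \<omega> \<partial>M)"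
  proof (rule integral_norm_bound_AE)
    show "AE \<omega> in M. norm (exp (\<i> * of_real (\<xi> \<bullet> Z \<omega>)) - exp (\<i> * of_real (\<xi> \<bullet> S \<omega>))) \<le> norm \<xi> * \<epsilon> + 2 * indicator A \<omega>"
    proof (rule AE_I2)
      fix \<omega> assume \<omega>: "\<omega> \<in> space M"
      show "norm (exp (\<i> * of_real (\<xi> \<bullet> Z \<omega>)) - exp (\<i> * of_real (\<xi> \<bullet> S \<omega>))) \<le> norm \<xi> * \<epsilon> + 2 * indicator A \<omega>"
      proof (cases "\<omega> \<in> A")
        case True
        then show ?thesis using norm_iexp_diff_le(2)[of "\<xi> \<bullet> Z \<omega>" "\<xi> \<bullet> S \<omega>"] \<epsilon> by (simp add: add_increasing)
      next
        case False
        have "\<bar>\<xi> \<bullet> Z \<omega> - \<xi> \<bullet> S \<omega>\<bar> \<le> norm \<xi> * norm (Z \<omega> - S \<omega>)"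
          unfolding inner_diff_right[symmetric] by (rule Cauchy_Schwarz_ineq2)
        also have "\<dots> \<le> norm \<xi> * \<epsilon>" using False \<omega> by (intro mult_left_mono) (auto simp: A_def dist_norm norm_minus_commute)
        finally show ?thesis using False norm_iexp_diff_le(1)[of "\<xi> \<bullet> Z \<omega>" "\<xi> \<bullet> S \<omega>"] by simp
      qed
    qed
  qed (use I IA in auto)
  also have "\<dots> = norm \<xi> * \<epsilon> + 2 * prob A"
  proof -
    have "integrable M (indicator A :: 'a \<Rightarrow> real)"
      by (rule integrable_const_bound[where B=1]) (auto simp: indicator_def)
    then show ?thesis by (subst Bochner_Integration.integral_add) (auto simp: prob_space)
  qed
  also have "\<dots> \<le> norm \<xi> * \<epsilon> + 2 * p" using prob by (simp add: A_def)
  finally show ?thesis using I by simp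
qed

text \<open>K depends on neither T nor \<xi>. The discretisation error is sent to 0 for each fixed
  T, so what survives is the mean distance of the normalised radial factor from 1; the phase
  multiplying it has modulus 1 whatever the partition.\<close>

lemma winding_char_estimate:
  fixes w :: quat
  assumes w: "w \<noteq> 0" and bm: "standard_brownian_motion M W w"
    and strat: "stratonovich_line_integral M winding_form W \<zeta>"
  obtains K where "0 \<le> K" "\<And>T b \<xi>. 1 \<le> T \<Longrightarrow> 0 \<le> b \<Longrightarrow> b \<le> 1 / 2 \<Longrightarrow> 4 * b * (b + 1) = (norm \<xi>)\<^sup>2 \<Longrightarrow>
    norm ((\<integral>\<omega>. exp (\<i> * of_real (\<xi> \<bullet> \<zeta> T \<omega>)) \<partial>M) - of_real ((norm w / sqrt T) powr (2 * b))) \<le> K * b"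
proof -
  interpret prob_space M using bm by (simp add: standard_brownian_motion_def)
  have W: "W t \<in> borel_measurable M" if "0 \<le> t" for t
    using bm that by (auto simp: standard_brownian_motion_def)
  obtain K where K: "0 \<le> K" "\<And>T b. 1 \<le> T \<Longrightarrow> 0 \<le> b \<Longrightarrow> b \<le> 1 / 2 \<Longrightarrow>
    (\<integral>\<^sup>+z. ennreal \<bar>1 - (norm (w + z) / sqrt T) powr (2 * b)\<bar> \<partial>isotropic_normal (sqrt T)) \<le> ennreal (K * b)"
    by (rule radial_power_close_to_one[of w]) blast
  show ?thesis
  proof (rule that[OF K(1)])
    fix T b :: real and \<xi> :: "real^3"
    assume T: "1 \<le> T" and b: "0 \<le> b" "b \<le> 1 / 2" and b\<xi>: "4 * b * (b + 1) = (norm \<xi>)\<^sup>2"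
    have T0: "0 < T" using T by simp
    have \<zeta>m [measurable]: "\<zeta> T \<in> borel_measurable M" using strat T by (simp add: stratonovich_line_integral_def)
    note [measurable] = W[OF order_refl] W[OF less_imp_le[OF T0]]
    define R where "R \<omega> = norm (w + (W T \<omega> - W 0 \<omega>))" for \<omega>
    have [measurable]: "R \<in> borel_measurable M" unfolding R_def[abs_def] by measurable
    \<comment> \<open>The defect of the normalised radial factor. The normaliser
      \<open>T powr b\<close> is at least 1, so dividing the discretisation error by it does no
      harm.\<close>
    define d where "d \<omega> = 1 - (R \<omega> / sqrt T) powr (2 * b)" for \<omega>
    have [measurable]: "d \<in> borel_measurable M" unfolding d_def[abs_def] by measurable
    have d_nn: "(\<integral>\<^sup>+\<omega>. ennreal \<bar>d \<omega>\<bar> \<partial>M) \<le> ennreal (K * b)"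
    proof -
      have "(\<integral>\<^sup>+\<omega>. ennreal \<bar>d \<omega>\<bar> \<partial>M) =
        (\<integral>\<^sup>+z. ennreal \<bar>1 - (norm (w + z) / sqrt T) powr (2 * b)\<bar> \<partial>distr M borel (\<lambda>\<omega>. W T \<omega> - W 0 \<omega>))"
        by (subst nn_integral_distr) (auto simp: d_def R_def)
      then show ?thesis
        using K(2)[OF T b] standard_brownian_motion_increment_law[OF bm, of 0 T] T0 by simp
    qed
    have d_int: "integrable M d" using d_nn by (intro integrableI_bounded) (auto intro: le_less_trans)
    have d_le: "(\<integral>\<omega>. \<bar>d \<omega>\<bar> \<partial>M) \<le> K * b"
      using d_nn K(1) b by (simp add: nn_integral_eq_integral[OF integrable_abs[OF d_int]])
    have Tb: "sqrt T powr (2 * b) = T powr b" using T0 by (simp add: powr_half_sqrt[symmetric] powr_powr)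
    have Tb1: "1 \<le> T powr b" using T b by (simp add: ge_one_powr_ge_zero)
    obtain C where C: "\<And>n. 0 < n \<Longrightarrow> norm ((\<integral>\<omega>. exp (\<i> * of_real (\<xi> \<bullet> stratonovich_sum winding_form W n (\<lambda>k. real k * (T / real n)) \<omega>)) *
        of_real (norm (w + (W T \<omega> - W 0 \<omega>)) powr (2 * b)) \<partial>M) - of_real (norm w powr (2 * b))) \<le> C / sqrt (real n)"
      by (rule stratonovich_sum_char[OF w bm T0 b(1) _ b\<xi>]) (use b in auto)
    \<comment> \<open>One \<epsilon> serves as distance, as probability and as discretisation error:
      the first two cost \<open>norm \<xi> * \<epsilon> + 2 * \<epsilon>\<close>, the last one
      \<epsilon>.\<close>
    have approx: "norm ((\<integral>\<omega>. exp (\<i> * of_real (\<xi> \<bullet> \<zeta> T \<omega>)) \<partial>M) - of_real ((norm w / sqrt T) powr (2 * b)))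
      \<le> K * b + \<epsilon> * (norm \<xi> + 3)" if \<epsilon>: "0 < \<epsilon>" for \<epsilon>
    proof -
      have "\<exists>\<delta>>0. \<forall>n \<tau>. interval_partition T n \<tau> \<longrightarrow> (\<forall>k<n. \<tau> (Suc k) - \<tau> k < \<delta>) \<longrightarrow>
           measure M {\<omega> \<in> space M. dist (stratonovich_sum winding_form W n \<tau> \<omega>) (\<zeta> T \<omega>) > \<epsilon>} < \<epsilon>"
        using strat T0 \<epsilon> unfolding stratonovich_line_integral_def by (meson less_imp_le)
      then obtain \<delta> where \<delta>: "0 < \<delta>" "\<And>n \<tau>. interval_partition T n \<tau> \<Longrightarrow> (\<And>k. k < n \<Longrightarrow> \<tau> (Suc k) - \<tau> k < \<delta>) \<Longrightarrow>
           measure M {\<omega> \<in> space M. dist (stratonovich_sum winding_form W n \<tau> \<omega>) (\<zeta> T \<omega>) > \<epsilon>} < \<epsilon>"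
        by blast
      have "(\<lambda>n. T / real n) \<longlonglongrightarrow> 0" by (rule lim_const_over_n)
      then have e1: "\<forall>\<^sub>F n in sequentially. T / real n < \<delta>" using \<delta>(1) by (rule order_tendstoD)
      have "filterlim (\<lambda>n. sqrt (real n)) at_top sequentially"
        by (intro filterlim_compose[OF sqrt_at_top] filterlim_real_sequentially)
      then have "(\<lambda>n. C / sqrt (real n)) \<longlonglongrightarrow> 0" by (rule tendsto_divide_0[OF tendsto_const filterlim_at_top_imp_at_infinity])
      then have e2: "\<forall>\<^sub>F n in sequentially. C / sqrt (real n) < \<epsilon>" using \<epsilon> by (rule order_tendstoD)
      obtain n where n: "T / real n < \<delta>" "C / sqrt (real n) < \<epsilon>" "0 < n"
        using eventually_happens'[OF _ eventually_conj[OF e1 eventually_conj[OF e2 eventually_gt_at_top[of 0]]]] by auto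
      define \<tau> where "\<tau> k = real k * (T / real n)" for k :: nat
      have part: "interval_partition T n \<tau>" using n(3) T0 by (auto simp: interval_partition_def \<tau>_def field_simps)
      have mesh: "\<tau> (Suc k) - \<tau> k < \<delta>" for k
      proof -
        have "\<tau> (Suc k) - \<tau> k = T / n" using n by (simp add: \<tau>_def field_simps)
        then show ?thesis using n(1) by simp
      qed
      define S where "S = stratonovich_sum winding_form W n \<tau>"
      have Sm [measurable]: "S \<in> borel_measurable M"
        unfolding S_def using T0 by (intro stratonovich_sum_winding_form_measurable W) (simp add: \<tau>_def)
      have t1: "norm ((\<integral>\<omega>. exp (\<i> * of_real (\<xi> \<bullet> \<zeta> T \<omega>)) \<partial>M) - (\<integral>\<omega>. exp (\<i> * of_real (\<xi> \<bullet> S \<omega>)) \<partial>M)) \<le> norm \<xi> * \<epsilon> + 2 * \<epsilon>"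
        using \<delta>(2)[OF part mesh] \<epsilon> by (intro char_diff_le_dist[OF Sm \<zeta>m]) (auto simp: S_def)
      have IS: "integrable M (\<lambda>\<omega>. exp (\<i> * of_real (\<xi> \<bullet> S \<omega>)))"
        by (rule integrable_const_bound[where B=1]) auto
      have Id: "integrable M (\<lambda>\<omega>. exp (\<i> * of_real (\<xi> \<bullet> S \<omega>)) * of_real (d \<omega>))"
        by (rule Bochner_Integration.integrable_bound[OF d_int]) (auto simp: norm_mult)
      have "norm (\<integral>\<omega>. exp (\<i> * of_real (\<xi> \<bullet> S \<omega>)) * of_real (d \<omega>) \<partial>M) \<le> (\<integral>\<omega>. \<bar>d \<omega>\<bar> \<partial>M)"
        by (rule integral_norm_bound_AE[OF Id integrable_abs[OF d_int]]) (simp add: norm_mult)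
      with d_le have t2: "norm (\<integral>\<omega>. exp (\<i> * of_real (\<xi> \<bullet> S \<omega>)) * of_real (d \<omega>) \<partial>M) \<le> K * b" by linarith
      define P where "P = (\<integral>\<omega>. exp (\<i> * of_real (\<xi> \<bullet> S \<omega>)) * of_real (R \<omega> powr (2 * b)) \<partial>M)"
      have "norm (P - of_real (norm w powr (2 * b))) \<le> C / sqrt n"
        using C[OF n(3)] by (simp add: P_def R_def S_def \<tau>_def[abs_def])
      also have "\<dots> \<le> \<epsilon> * T powr b" using n(2) Tb1 \<epsilon> by (simp add: mult_le_cancel_left1 order_trans[OF less_imp_le])
      finally have t3: "norm ((P - of_real (norm w powr (2 * b))) / of_real (T powr b)) \<le> \<epsilon>"
        using Tb1 T0 by (simp add: norm_divide divide_le_eq)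
      have pd: "of_real (R \<omega> powr (2 * b)) = of_real (T powr b) * (1 - complex_of_real (d \<omega>))" for \<omega>
      proof -
        have "R \<omega> powr (2 * b) = T powr b * (1 - d \<omega>)"
          using T0 Tb by (simp add: d_def R_def powr_divide)
        then show ?thesis by simp
      qed
      have "P = (\<integral>\<omega>. of_real (T powr b) * (exp (\<i> * of_real (\<xi> \<bullet> S \<omega>)) - exp (\<i> * of_real (\<xi> \<bullet> S \<omega>)) * of_real (d \<omega>)) \<partial>M)"
        unfolding P_def pd by (intro Bochner_Integration.integral_cong) (auto simp: algebra_simps)
      also have "\<dots> = of_real (T powr b) * ((\<integral>\<omega>. exp (\<i> * of_real (\<xi> \<bullet> S \<omega>)) \<partial>M) - (\<integral>\<omega>. exp (\<i> * of_real (\<xi> \<bullet> S \<omega>)) * of_real (d \<omega>) \<partial>M))"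
        using IS Id by simp
      finally have P: "(\<integral>\<omega>. exp (\<i> * of_real (\<xi> \<bullet> S \<omega>)) \<partial>M) = P / of_real (T powr b) + (\<integral>\<omega>. exp (\<i> * of_real (\<xi> \<bullet> S \<omega>)) * of_real (d \<omega>) \<partial>M)"
        using Tb1 T0 by (simp add: field_simps)
      have cw: "of_real ((norm w / sqrt T) powr (2 * b)) = complex_of_real (norm w powr (2 * b)) / of_real (T powr b)"
        using T0 by (simp add: powr_divide Tb)
      have "(\<integral>\<omega>. exp (\<i> * of_real (\<xi> \<bullet> \<zeta> T \<omega>)) \<partial>M) - of_real ((norm w / sqrt T) powr (2 * b)) =
        ((\<integral>\<omega>. exp (\<i> * of_real (\<xi> \<bullet> \<zeta> T \<omega>)) \<partial>M) - (\<integral>\<omega>. exp (\<i> * of_real (\<xi> \<bullet> S \<omega>)) \<partial>M)) +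
        ((\<integral>\<omega>. exp (\<i> * of_real (\<xi> \<bullet> S \<omega>)) * of_real (d \<omega>) \<partial>M) + (P - of_real (norm w powr (2 * b))) / of_real (T powr b))"
        unfolding cw by (simp add: P diff_divide_distrib)
      also have "norm \<dots> \<le> (norm \<xi> * \<epsilon> + 2 * \<epsilon>) + (K * b + \<epsilon>)"
        by (intro norm_triangle_le add_mono order_trans[OF norm_triangle_ineq] t1 t2 t3)
      finally show ?thesis by (simp add: algebra_simps)
    qed
    show "norm ((\<integral>\<omega>. exp (\<i> * of_real (\<xi> \<bullet> \<zeta> T \<omega>)) \<partial>M) - of_real ((norm w / sqrt T) powr (2 * b))) \<le> K * b"
    proof (rule field_le_epsilon)
      fix e :: real assume e: "0 < e"
      have p: "0 < norm \<xi> + 3" by (simp add: add_nonneg_pos)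
      then have "e / (norm \<xi> + 3) * (norm \<xi> + 3) = e" by simp
      then show "norm ((\<integral>\<omega>. exp (\<i> * of_real (\<xi> \<bullet> \<zeta> T \<omega>)) \<partial>M) - of_real ((norm w / sqrt T) powr (2 * b))) \<le> K * b + e"
        using approx[of "e / (norm \<xi> + 3)"] e p by simp
    qed
  qed
qed

text \<open>The nonnegative root b of \<open>4 * b * (b + 1) = 2 * U / ln T\<close>. With
  \<open>U = (norm u)\<^sup>2\<close> the right side is the squared norm of the rescaled frequency
  \<open>sqrt (2 / ln T) *\<^sub>R u\<close>.\<close>

definition winding_exponent :: "real \<Rightarrow> real \<Rightarrow> real" where
  "winding_exponent U T = (sqrt (1 + 2 * U / ln T) - 1) / 2"

lemma winding_exponent_tendsto_0: "(winding_exponent U \<longlongrightarrow> 0) at_top"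
proof -
  have "((\<lambda>T. 2 * U / ln T) \<longlongrightarrow> 0) at_top"
    by (rule tendsto_divide_0[OF tendsto_const filterlim_at_top_imp_at_infinity[OF ln_at_top]])
  then have "((\<lambda>T. (sqrt (1 + 2 * U / ln T) - 1) / 2) \<longlongrightarrow> (sqrt (1 + 0) - 1) / 2) at_top"
    by (intro tendsto_intros) auto
  then show ?thesis by (simp add: winding_exponent_def[abs_def])
qed

text \<open>Rationalising \<open>sqrt (1 + x) - 1\<close> as \<open>x / (sqrt (1 + x) + 1)\<close>
  with \<open>x = 2 * U / ln T\<close> cancels the logarithm.\<close>

lemma winding_exponent_ln_tendsto:
  assumes "0 \<le> U"
  shows "((\<lambda>T. winding_exponent U T * ln T) \<longlongrightarrow> U / 2) at_top"
proof -
  have "((\<lambda>T. 2 * U / ln T) \<longlongrightarrow> 0) at_top"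
    by (rule tendsto_divide_0[OF tendsto_const filterlim_at_top_imp_at_infinity[OF ln_at_top]])
  then have "((\<lambda>T. U / (sqrt (1 + 2 * U / ln T) + 1)) \<longlongrightarrow> U / (sqrt (1 + 0) + 1)) at_top"
    by (intro tendsto_intros) auto
  then have lim: "((\<lambda>T. U / (sqrt (1 + 2 * U / ln T) + 1)) \<longlongrightarrow> U / 2) at_top" by simp
  have "\<forall>\<^sub>F T in at_top. U / (sqrt (1 + 2 * U / ln T) + 1) = winding_exponent U T * ln T"
    using eventually_gt_at_top[of 1]
  proof eventually_elim
    case (elim T)
    then have l: "0 < ln T" by simp
    define q where "q = sqrt (1 + 2 * U / ln T)"
    have q: "0 \<le> q" "q * q = 1 + 2 * U / ln T" using l assms by (simp_all add: q_def)
    have "(q - 1) * (q + 1) * ln T = 2 * U" using l by (simp add: algebra_simps q(2))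
    then show ?case using q(1) unfolding winding_exponent_def q_def[symmetric] by (simp add: field_simps)
  qed
  with lim show ?thesis by (rule Lim_transform_eventually)
qed

text \<open>The starting radius enters only through \<open>2 * b * ln c\<close>, which vanishes with
  b; the limit comes from \<open>- b * ln T\<close> alone.\<close>

lemma winding_exponent_limit:
  assumes "0 \<le> U" "0 < c"
  shows "((\<lambda>T. (c / sqrt T) powr (2 * winding_exponent U T)) \<longlongrightarrow> exp (- U / 2)) at_top"
proof -
  have "((\<lambda>T. exp (2 * winding_exponent U T * ln c - winding_exponent U T * ln T)) \<longlongrightarrow> exp (2 * 0 * ln c - U / 2)) at_top"
    by (intro tendsto_intros winding_exponent_tendsto_0 winding_exponent_ln_tendsto assms)
  moreover have "\<forall>\<^sub>F T in at_top. exp (2 * winding_exponent U T * ln c - winding_exponent U T * ln T) =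
      (c / sqrt T) powr (2 * winding_exponent U T)"
    using eventually_gt_at_top[of 0]
  proof eventually_elim
    case (elim T)
    then show ?case using assms by (simp add: powr_def ln_div ln_sqrt algebra_simps)
  qed
  ultimately have "((\<lambda>T. (c / sqrt T) powr (2 * winding_exponent U T)) \<longlongrightarrow> exp (2 * 0 * ln c - U / 2)) at_top"
    by (rule Lim_transform_eventually)
  then show ?thesis by simp
qed

theorem theorem2p4:
  fixes M :: "'a measure"
    and W :: "real \<Rightarrow> 'a \<Rightarrow> quat"
    and \<zeta> :: "real \<Rightarrow> 'a \<Rightarrow> real^3"
    and w :: quat
  assumes "w \<noteq> 0"
    and "standard_brownian_motion M W w"
    and "stratonovich_line_integral M winding_form W \<zeta>"
  shows "converges_in_distribution M (\<lambda>t \<omega>. sqrt (2 / ln t) *\<^sub>R \<zeta> t \<omega>) std_normal_measure at_top"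
  unfolding converges_in_distribution_def weakly_converges_def
proof (intro allI impI)
  fix f :: "real^3 \<Rightarrow> real" assume f: "continuous_on UNIV f" "bounded (range f)"
  interpret prob_space M using assms(2) by (simp add: standard_brownian_motion_def)
  define Z where "Z t \<omega> = sqrt (2 / ln t) *\<^sub>R \<zeta> t \<omega>" for t \<omega>
  have Zm: "Z t \<in> borel_measurable M" if "0 \<le> t" for t
    using assms(3) that unfolding Z_def[abs_def] stratonovich_line_integral_def by auto
  obtain K where K: "0 \<le> K" "\<And>T b \<xi>. 1 \<le> T \<Longrightarrow> 0 \<le> b \<Longrightarrow> b \<le> 1 / 2 \<Longrightarrow> 4 * b * (b + 1) = (norm \<xi>)\<^sup>2 \<Longrightarrow>
    norm ((\<integral>\<omega>. exp (\<i> * of_real (\<xi> \<bullet> \<zeta> T \<omega>)) \<partial>M) - of_real ((norm w / sqrt T) powr (2 * b))) \<le> K * b"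
    by (rule winding_char_estimate[OF assms]) blast
  have char: "((\<lambda>T. char_vec (distr M borel (Z T)) u) \<longlongrightarrow> char_vec std_normal_measure u) at_top" for u
  proof -
    define U where "U = (norm u)\<^sup>2"
    have U: "0 \<le> U" by (simp add: U_def)
    let ?b = "winding_exponent U"
    have lim: "((\<lambda>T. complex_of_real ((norm w / sqrt T) powr (2 * ?b T))) \<longlongrightarrow> of_real (exp (- U / 2))) at_top"
      using winding_exponent_limit[OF U, of "norm w"] assms(1) by (intro tendsto_of_real) simp
    have "((\<lambda>T. char_vec (distr M borel (Z T)) u - of_real ((norm w / sqrt T) powr (2 * ?b T))) \<longlongrightarrow> 0) at_top"
    proof (rule Lim_null_comparison)
      show "((\<lambda>T. K * ?b T) \<longlongrightarrow> 0) at_top"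
        using tendsto_mult[OF tendsto_const winding_exponent_tendsto_0, of K U] by simp
      have small: "\<forall>\<^sub>F T in at_top. ?b T < 1 / 2"
        by (rule order_tendstoD(2)[OF winding_exponent_tendsto_0]) simp
      show "\<forall>\<^sub>F T in at_top. norm (char_vec (distr M borel (Z T)) u - of_real ((norm w / sqrt T) powr (2 * ?b T))) \<le> K * ?b T"
        using small eventually_gt_at_top[of 1]
      proof eventually_elim
        case (elim T)
        then have l: "0 < ln T" by simp
        define \<xi> where "\<xi> = sqrt (2 / ln T) *\<^sub>R u"
        have n\<xi>: "(norm \<xi>)\<^sup>2 = 2 * U / ln T" using l by (simp add: \<xi>_def U_def power_mult_distrib)
        have b0: "0 \<le> ?b T" using l U by (simp add: winding_exponent_def)
        \<comment> \<open>Completing the square: the relation between b and \<xi> says that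
          \<open>(2 * b + 1)\<^sup>2 = 1 + (norm \<xi>)\<^sup>2\<close>.\<close>
        have "2 * ((x - 1) / 2) + 1 = x" for x :: real by (simp add: field_simps)
        then have "2 * ?b T + 1 = sqrt (1 + 2 * U / ln T)" unfolding winding_exponent_def .
        then have "(2 * ?b T + 1)\<^sup>2 = 1 + 2 * U / ln T" using l U by simp
        then have "4 * ?b T * (?b T + 1) = (norm \<xi>)\<^sup>2"
          unfolding n\<xi> by (simp add: power2_eq_square algebra_simps)
        then have "norm ((\<integral>\<omega>. exp (\<i> * of_real (\<xi> \<bullet> \<zeta> T \<omega>)) \<partial>M) - of_real ((norm w / sqrt T) powr (2 * ?b T))) \<le> K * ?b T"
          using elim b0 by (intro K(2)) auto
        moreover have "char_vec (distr M borel (Z T)) u = (\<integral>\<omega>. exp (\<i> * of_real (\<xi> \<bullet> \<zeta> T \<omega>)) \<partial>M)"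
          unfolding char_vec_def using Zm[of T] elim by (subst integral_distr) (auto simp: Z_def \<xi>_def)
        ultimately show ?case by simp
      qed
    qed
    from tendsto_add[OF this lim] show ?thesis by (simp add: char_vec_std_normal U_def)
  qed
  have "((\<lambda>t. integral\<^sup>L (distr M borel (Z t)) f) \<longlongrightarrow> integral\<^sup>L std_normal_measure f) at_top"
  proof (rule tendsto_at_topI_sequentially)
    fix X :: "nat \<Rightarrow> real" assume X: "filterlim X at_top sequentially"
    \<comment> \<open>Measurability of \<open>Z t\<close> is known only for t \<ge> 0, while the
      continuity theorem asks for a probability measure at every index. The truncation changes only
      finitely many terms.\<close>
    define X' where "X' k = max 0 (X k)" for k
    have ev: "\<forall>\<^sub>F k in sequentially. X' k = X k"
      using filterlim_at_top_dense[THEN iffD1, OF X, rule_format, of 0] by eventually_elim (simp add: X'_def)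
    have X': "filterlim X' at_top sequentially"
      using X ev by (subst filterlim_cong[OF refl refl ev])
    have "weakly_converges (\<lambda>k. distr M borel (Z (X' k))) std_normal_measure sequentially"
    proof (rule levy_continuity_vec)
      show "prob_space (distr M borel (Z (X' k)))" for k
        by (intro prob_space_distr Zm) (simp add: X'_def)
      show "(\<lambda>k. char_vec (distr M borel (Z (X' k))) u) \<longlonglongrightarrow> char_vec std_normal_measure u" for u
        by (rule filterlim_compose[OF char X'])
    qed (auto intro: prob_space_std_normal_measure)
    then have "(\<lambda>k. integral\<^sup>L (distr M borel (Z (X' k))) f) \<longlonglongrightarrow> integral\<^sup>L std_normal_measure f"
      using f unfolding weakly_converges_def by blast
    moreover have "\<forall>\<^sub>F k in sequentially. integral\<^sup>L (distr M borel (Z (X' k))) f = integral\<^sup>L (distr M borel (Z (X k))) f"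
      using ev by eventually_elim simp
    ultimately show "(\<lambda>k. integral\<^sup>L (distr M borel (Z (X k))) f) \<longlonglongrightarrow> integral\<^sup>L std_normal_measure f"
      by (rule Lim_transform_eventually)
  qed
  then show "((\<lambda>t. integral\<^sup>L (distr M borel (\<lambda>\<omega>. sqrt (2 / ln t) *\<^sub>R \<zeta> t \<omega>)) f) \<longlongrightarrow> integral\<^sup>L std_normal_measure f) at_top"
    by (simp only: Z_def[abs_def])
qed

end
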